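(* Let $N\ge 2$, let $B\subset\mathbb R^N$ be a Hanner polytope with nonempty interior in $\mathbb R^N$, and let $H\subset\mathbb R^N$ be a hyperplane through the origin. If $K=B\cap H$, or if $K=P(B)$ for some linear projection $P$ of $\mathbb R^N$ onto $H$, then $$\operatorname{vol}_{N-1}(K)\cdot\operatorname{vol}_{N-1}(K^\circ)\ \ge\ \frac{4^{N-1}}{(N-1)!},$$ where $K$ is regarded as a centrally symmetric convex body in the $(N-1)$-dimensional Euclidean space $H$ and $K^\circ\subset H$ is its polar in $H$.
   Context: For a centrally symmetric (about the origin) convex body $K$ in an $n$-dimensional Euclidean space $V$, the polar is $K^\circ=\{y\in V : \langle x,y\rangle\le 1 \text{ for all } x\in K\}$. Mahler's conjecture for such $K$ is the inequality $\operatorname{vol}_n(K)\operatorname{vol}_n(K^\circ)\ge 4^n/n!$; it is invariant under linear isomorphisms of $V$. Hanner polytopes are the centrally symmetric (about the origin) polytopes that can be obtained from origin-symmetric segments by repeatedly applying one of the following two operations to already obtained polytopes placed in orthogonal linear subspaces: taking the Cartesian product, or taking the $\ell_1$-sum, i.e. the convex hull of the union of the two polytopes. A linear projection onto $H$ is a linear map $P:\mathbb R^N\to\mathbb R^N$ with $P^2=P$ and image $H$; it need not be orthogonal. *)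

theory Defs
  imports "HOL-Analysis.Analysis"
begin

text \<open>
  All polytopes live in one ambient space; the Cartesian product of two polytopes lying in
  orthogonal linear subspaces is their Minkowski sum.  Segments are non-degenerate.
\<close>

inductive hanner_polytope :: "'a::euclidean_space set \<Rightarrow> bool" where
  segment: "v \<noteq> 0 \<Longrightarrow> hanner_polytope (closed_segment (- v) v)"
| cartesian_product:
    "\<lbrakk>hanner_polytope A; hanner_polytope B; subspace U; subspace W;
      \<forall>u\<in>U. \<forall>w\<in>W. orthogonal u w; A \<subseteq> U; B \<subseteq> W\<rbrakk>
     \<Longrightarrow> hanner_polytope {x + y | x y. x \<in> A \<and> y \<in> B}"
| l1_sum:
    "\<lbrakk>hanner_polytope A; hanner_polytope B; subspace U; subspace W;
      \<forall>u\<in>U. \<forall>w\<in>W. orthogonal u w; A \<subseteq> U; B \<subseteq> W\<rbrakk>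
     \<Longrightarrow> hanner_polytope (convex hull (A \<union> B))"

definition linear_hyperplane :: "'a::euclidean_space set \<Rightarrow> bool" where
  "linear_hyperplane H \<longleftrightarrow> subspace H \<and> dim H + 1 = DIM('a)"

definition linear_projection_onto :: "('a::euclidean_space \<Rightarrow> 'a) \<Rightarrow> 'a set \<Rightarrow> bool" where
  "linear_projection_onto P H \<longleftrightarrow> linear P \<and> P \<circ> P = P \<and> range P = H"

definition polar_in :: "'a::euclidean_space set \<Rightarrow> 'a set \<Rightarrow> 'a set" where
  "polar_in V K = {y \<in> V. \<forall>x\<in>K. x \<bullet> y \<le> 1}"

definition orthonormal_basis_of :: "'a::euclidean_space set \<Rightarrow> 'a set \<Rightarrow> bool" where
  "orthonormal_basis_of V E \<longleftrightarrow>
     pairwise orthogonal E \<and> (\<forall>e\<in>E. norm e = 1) \<and> span E = V"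

lemma orthonormal_basis_of_exists:
  assumes "subspace V"
  shows "\<exists>E. orthonormal_basis_of V E"
  unfolding orthonormal_basis_of_def
  using orthonormal_basis_subspace [OF assms] by metis

text \<open>
  Lebesgue measure of a linear subspace \<open>V\<close>, as a measure on the Borel sets of the ambient
  space.  The construction is that of \<^const>\<open>lborel\<close>, with an orthonormal basis of \<open>V\<close> in place
  of \<^const>\<open>Basis\<close>; by rotation invariance the choice of that basis does not matter.
\<close>

definition subspace_lborel :: "'a::euclidean_space set \<Rightarrow> 'a measure" where
  "subspace_lborel V =
     (let E = (SOME E. orthonormal_basis_of V E)
      in distr (\<Pi>\<^sub>M e\<in>E. lborel) borel (\<lambda>c. \<Sum>e\<in>E. c e *\<^sub>R e))"

definition vol_in :: "'a::euclidean_space set \<Rightarrow> 'a set \<Rightarrow> real" where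
  "vol_in V K = measure (subspace_lborel V) K"

end

theory Submission
  imports Defs "HOL-Probability.Distributions"
begin

text \<open>
  A Hanner polytope \<open>B\<close> of dimension \<open>n\<close> is the unit ball of a norm built from absolute values of
  orthogonal coordinates by maxima and sums; interchanging the two operations gives the dual norm
  \<open>M\<close>.  The proof is an elementary form of a billiard (symplectic) argument: the billiard between
  \<open>B\<close> and its polar has only closed, centrally symmetric trajectories, all of the same length.
  Hence, for a linear functional \<open>z\<close>, there is a random path \<open>q\<close> in \<open>B\<close> with \<open>q (2) = - q (0)\<close>
  for which, at a random time, \<open>q\<close> is uniform in \<open>B\<close> and its velocity is independent of \<open>q\<close>
  and distributed as \<open>\<nabla>M\<close>.  As \<open>z\<close> changes sign along each path, counting zeros yields
  \<open>2 f(0) E\<bar>\<langle>z, \<nabla>M\<rangle>\<bar> \<ge> 1\<close>, where \<open>f\<close> is the density of \<open>\<langle>z, q\<rangle>\<close>.  Here \<open>f(0)\<close> is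
  proportional to the volume of a hyperplane section of \<open>B\<close>, and \<open>E\<bar>\<langle>z, \<nabla>M\<rangle>\<bar>\<close> is bounded by the
  volume of a projection of the polar body; together with \<open>vol B * vol B\<degree> = 4 ^ n / n!\<close> this is
  the claim.  Only the process \<open>\<langle>z, q\<rangle>\<close> matters, so the random path is replaced by
  its dual description: an inequality between functionals valid on every antiperiodic real path
  persists for the averages over \<open>B\<close>, by induction over the construction of \<open>B\<close>.
\<close>

section \<open>Joint laws of norm and slope along a tree of max and sum operations\<close>

text \<open>The two operations act differently on trajectories, and this dictates the functionals.
  Hence every functional has a start term \<open>c\<close> beside its occupation term
  \<open>k\<close>, and both must pass through the induction. In a product the factors move
  simultaneously with the same size, but a boundary point need put only one factor on its own
  boundary; the other is caught in the middle of its trajectory, at a uniformly random phase. This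
  step uses occupation terms of the second factor at one prescribed size, and a random time shift.
  The constant arises thus: a slab of width \<open>2 * \<epsilon>\<close> and the two signs of the
  slope give a factor 4, the integral of \<open>r ^ (n - 1) * exp (- r)\<close> over the levels
  gives \<open>(n - 1)!\<close>, and \<open>4 ^ n\<close> divided by 4 is
  \<open>4 ^ (n - 1)\<close>. Sections and oblique projections are two instances of one estimate in
  a frame where \<open>z \<bullet> u = 1\<close>.\<close>

datatype 'a htree = Seg 'a | LInf "'a htree" "'a htree" | LOne "'a htree" "'a htree"

primrec hdim :: "'a htree \<Rightarrow> nat" where
  "hdim (Seg a) = 1"
| "hdim (LInf s t) = hdim s + hdim t"
| "hdim (LOne s t) = hdim s + hdim t"

lemma hdim_pos: "hdim t > 0"
  by (induction t) auto

lemma hdim_map [simp]: "hdim (map_htree f t) = hdim t"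
  by (induction t) auto

text \<open>The laws live on the Borel sets of the plane rather than on a product sigma-algebra, so
  the projections need measurability rules of their own.\<close>

lemma borel_measurable_fst [measurable (raw)]:
  fixes f :: "'c \<Rightarrow> 'a::second_countable_topology \<times> 'b::second_countable_topology"
  shows "f \<in> borel_measurable M \<Longrightarrow> (\<lambda>x. fst (f x)) \<in> borel_measurable M"
  by (erule measurable_compose) (intro borel_measurable_continuous_onI continuous_intros)

lemma borel_measurable_snd [measurable (raw)]:
  fixes f :: "'c \<Rightarrow> 'a::second_countable_topology \<times> 'b::second_countable_topology"
  shows "f \<in> borel_measurable M \<Longrightarrow> (\<lambda>x. snd (f x)) \<in> borel_measurable M"
  by (erule measurable_compose) (intro borel_measurable_continuous_onI continuous_intros)

section \<open>Measures on pairs (norm, position) or (norm, slope), and their combination\<close>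

definition push_pair ::
    "(real \<times> real \<Rightarrow> real \<times> real \<Rightarrow> real \<times> real) \<Rightarrow> (real \<times> real) measure \<Rightarrow> (real \<times> real) measure \<Rightarrow> (real \<times> real) measure"
  where "push_pair f A B = distr (A \<Otimes>\<^sub>M B) borel (\<lambda>(x, y). f x y)"

text \<open>The laws are images of Lebesgue measure and hence infinite. Finiteness over bounded
  values of the norm, the first coordinate, is the property that survives all three combinations
  below and that provides sigma-finiteness for Tonelli.\<close>

definition strip_finite :: "(real \<times> real) measure \<Rightarrow> bool" where
  "strip_finite A \<longleftrightarrow> sets A = sets borel \<and> (\<forall>k. emeasure A {x. \<bar>fst x\<bar> \<le> k} < \<infinity>)"

lemma strip_finite_sets: "strip_finite A \<Longrightarrow> sets A = sets borel"
  by (simp add: strip_finite_def)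

lemma strip_finite_measurable:
  "strip_finite A \<Longrightarrow> measurable A M = measurable borel M"
  by (rule measurable_cong_sets) (simp_all add: strip_finite_def)

lemma strip_sets [measurable]: "{x::real \<times> real. \<bar>fst x\<bar> \<le> k} \<in> sets borel"
  by (intro borel_closed closed_Collect_le continuous_intros)

lemma strip_finite_sigma:
  assumes "strip_finite A" shows "sigma_finite_measure A"
proof
  have sp: "space A = UNIV" using assms sets_eq_imp_space_eq[of A borel]
    by (simp add: strip_finite_def)
  let ?S = "(\<lambda>n::nat. {x::real \<times> real. \<bar>fst x\<bar> \<le> real n}) ` UNIV"
  have "\<Union> ?S = UNIV" using real_arch_simple by auto
  moreover have "?S \<subseteq> sets A" using assms by (auto simp: strip_finite_def)
  moreover have "\<forall>a\<in>?S. emeasure A a \<noteq> \<infinity>" using assms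
    by (auto simp: strip_finite_def less_top)
  ultimately show "\<exists>S. countable S \<and> S \<subseteq> sets A \<and> \<Union> S = space A \<and> (\<forall>a\<in>S. emeasure A a \<noteq> \<infinity>)"
    using sp by (intro exI[of _ ?S]) auto
qed

lemma nn_integral_push_pair:
  assumes A: "strip_finite A" and B: "strip_finite B"
    and f: "(\<lambda>(x, y). f x y) \<in> borel \<Otimes>\<^sub>M borel \<rightarrow>\<^sub>M borel"
    and g: "g \<in> borel_measurable borel"
  shows "(\<integral>\<^sup>+x. g x \<partial>push_pair f A B) = (\<integral>\<^sup>+x. \<integral>\<^sup>+y. g (f x y) \<partial>B \<partial>A)"
proof -
  interpret B: sigma_finite_measure B using B by (rule strip_finite_sigma)
  have s: "sets (A \<Otimes>\<^sub>M B) = sets (borel \<Otimes>\<^sub>M borel)"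
    using A B by (intro sets_pair_measure_cong strip_finite_sets)
  have m: "measurable (A \<Otimes>\<^sub>M B) N = measurable (borel \<Otimes>\<^sub>M borel) N" for N :: "'z measure"
    by (rule measurable_cong_sets[OF s refl])
  have m2: "(\<lambda>(x, y). f x y) \<in> A \<Otimes>\<^sub>M B \<rightarrow>\<^sub>M borel"
    using f measurable_cong_sets[OF s refl] by blast
  have m3: "(\<lambda>p. g (case p of (x, y) \<Rightarrow> f x y)) \<in> borel_measurable (A \<Otimes>\<^sub>M B)"
    by (rule measurable_compose[OF m2 g])
  have "(\<integral>\<^sup>+x. g x \<partial>push_pair f A B) = (\<integral>\<^sup>+p. g (case p of (x, y) \<Rightarrow> f x y) \<partial>(A \<Otimes>\<^sub>M B))"
    unfolding push_pair_def by (rule nn_integral_distr[OF m2]) (use g in simp)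
  also have "\<dots> = (\<integral>\<^sup>+x. \<integral>\<^sup>+y. g (f x y) \<partial>B \<partial>A)"
    using B.nn_integral_fst[OF m3] by simp
  finally show ?thesis .
qed

text \<open>The combined norm dominates both old ones, so the preimage of a strip lies in a product
  of two strips.\<close>

lemma strip_finite_push_pair:
  assumes A: "strip_finite A" and B: "strip_finite B"
    and f: "(\<lambda>(x, y). f x y) \<in> borel \<Otimes>\<^sub>M borel \<rightarrow>\<^sub>M borel"
    and le: "\<And>x y. \<bar>fst x\<bar> \<le> \<bar>fst (f x y)\<bar>" "\<And>x y. \<bar>fst y\<bar> \<le> \<bar>fst (f x y)\<bar>"
  shows "strip_finite (push_pair f A B)"
  unfolding strip_finite_def
proof (intro conjI allI)
  show "sets (push_pair f A B) = sets borel" by (simp add: push_pair_def)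
  fix k :: real
  have sA: "sets A = sets borel" and sB: "sets B = sets borel" using A B by (auto simp: strip_finite_def)
  have "emeasure (push_pair f A B) {x. \<bar>fst x\<bar> \<le> k} = (\<integral>\<^sup>+x. indicator {x. \<bar>fst x\<bar> \<le> k} x \<partial>push_pair f A B)"
    by (subst nn_integral_indicator) (simp_all add: push_pair_def)
  also have "\<dots> = (\<integral>\<^sup>+x. \<integral>\<^sup>+y. indicator {x. \<bar>fst x\<bar> \<le> k} (f x y) \<partial>B \<partial>A)"
    by (rule nn_integral_push_pair[OF A B f]) measurable
  also have "\<dots> \<le> (\<integral>\<^sup>+x. \<integral>\<^sup>+y. indicator {x. \<bar>fst x\<bar> \<le> k} x * indicator {x. \<bar>fst x\<bar> \<le> k} y \<partial>B \<partial>A)"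
  proof (intro nn_integral_mono)
    fix x y
    show "(indicator {x. \<bar>fst x\<bar> \<le> k} (f x y) :: ennreal) \<le> indicator {x. \<bar>fst x\<bar> \<le> k} x * indicator {x. \<bar>fst x\<bar> \<le> k} y"
      using order_trans[OF le(1)[of x y]] order_trans[OF le(2)[of y x]] by (simp add: indicator_def)
  qed
  also have "\<dots> = emeasure A {x. \<bar>fst x\<bar> \<le> k} * emeasure B {x. \<bar>fst x\<bar> \<le> k}"
    using sA sB by (simp add: nn_integral_cmult nn_integral_multc)
  also have "\<dots> < \<infinity>" using A B by (simp add: strip_finite_def ennreal_mult_less_top)
  finally show "emeasure (push_pair f A B) {x. \<bar>fst x\<bar> \<le> k} < \<infinity>" .
qed

lemma nn_integral_Tonelli:
  assumes A: "sigma_finite_measure A" and B: "sigma_finite_measure B"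
    and f: "(\<lambda>(x, y). f x y) \<in> borel_measurable (A \<Otimes>\<^sub>M B)"
  shows "(\<integral>\<^sup>+x. \<integral>\<^sup>+y. f x y \<partial>B \<partial>A) = (\<integral>\<^sup>+y. \<integral>\<^sup>+x. f x y \<partial>A \<partial>B)"
proof -
  interpret pair_sigma_finite A B using A B by (simp add: pair_sigma_finite_def)
  show ?thesis using Fubini'[OF f] by simp
qed

text \<open>A change of variables with constant Jacobian \<open>c\<close>: the image of
  \<open>A\<close> under \<open>\<psi>\<close>, multiplied by \<open>c\<close>, is \<open>A\<close>
  again.\<close>

definition quasi_inv :: "(real \<times> real) measure \<Rightarrow> real \<Rightarrow> (real \<times> real \<Rightarrow> real \<times> real) \<Rightarrow> bool" where
  "quasi_inv A c \<psi> \<longleftrightarrow> (\<forall>f \<in> borel_measurable borel. ennreal c * (\<integral>\<^sup>+x. f (\<psi> x) \<partial>A) = (\<integral>\<^sup>+x. f x \<partial>A))"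

lemma quasi_invD:
  "quasi_inv A c \<psi> \<Longrightarrow> f \<in> borel_measurable borel \<Longrightarrow> ennreal c * (\<integral>\<^sup>+x. f (\<psi> x) \<partial>A) = (\<integral>\<^sup>+x. f x \<partial>A)"
  by (simp add: quasi_inv_def)

text \<open>Since \<open>\<psi>\<close> commutes with the combination \<open>f\<close>, the two
  changes of variables can be carried out one after the other in the iterated integral, and the
  Jacobians multiply.\<close>

lemma quasi_inv_push_pair:
  assumes A: "strip_finite A" and B: "strip_finite B"
    and f: "(\<lambda>(x, y). f x y) \<in> borel \<Otimes>\<^sub>M borel \<rightarrow>\<^sub>M borel"
    and \<psi>: "\<psi> \<in> borel \<rightarrow>\<^sub>M borel"
    and qA: "quasi_inv A c \<psi>" and qB: "quasi_inv B d \<psi>" and c: "c \<ge> 0" and d: "d \<ge> 0"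
    and eq: "\<And>x y. \<psi> (f x y) = f (\<psi> x) (\<psi> y)"
  shows "quasi_inv (push_pair f A B) (c * d) \<psi>"
  unfolding quasi_inv_def
proof
  fix g :: "real \<times> real \<Rightarrow> ennreal" assume g[measurable]: "g \<in> borel_measurable borel"
  note [measurable] = f \<psi>
  have f': "(\<lambda>x. f (u x) (v x)) \<in> M \<rightarrow>\<^sub>M borel" if "u \<in> M \<rightarrow>\<^sub>M borel" "v \<in> M \<rightarrow>\<^sub>M borel" for u v and M :: "'z measure"
    using measurable_compose[OF measurable_Pair[OF that] f] by simp
  note sA = strip_finite_measurable[OF A] and sB = strip_finite_measurable[OF B]
  interpret B: sigma_finite_measure B using B by (rule strip_finite_sigma)
  have [measurable_cong]: "sets A = sets borel" "sets B = sets borel" using A B by (auto simp: strip_finite_def)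
  have m1: "(\<lambda>x. \<integral>\<^sup>+y. g (f (\<psi> x) (\<psi> y)) \<partial>B) \<in> borel_measurable borel"
    by (intro B.borel_measurable_nn_integral) (use f' in measurable)
  have m2: "(\<lambda>x. \<integral>\<^sup>+y. g (f x y) \<partial>B) \<in> borel_measurable borel"
    by (intro B.borel_measurable_nn_integral) (use f' in measurable)
  have "(\<lambda>x. g (\<psi> x)) \<in> borel_measurable borel" by measurable
  from nn_integral_push_pair[OF A B f this]
  have "ennreal (c * d) * (\<integral>\<^sup>+x. g (\<psi> x) \<partial>push_pair f A B) = ennreal (c * d) * (\<integral>\<^sup>+x. \<integral>\<^sup>+y. g (f (\<psi> x) (\<psi> y)) \<partial>B \<partial>A)"
    by (simp add: eq)
  also have "\<dots> = ennreal c * (\<integral>\<^sup>+x. ennreal d * (\<integral>\<^sup>+y. g (f (\<psi> x) (\<psi> y)) \<partial>B) \<partial>A)"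
    using c d m1 by (simp add: nn_integral_cmult sA ennreal_mult mult.assoc)
  also have "\<dots> = ennreal c * (\<integral>\<^sup>+x. \<integral>\<^sup>+y. g (f (\<psi> x) y) \<partial>B \<partial>A)"
  proof -
    have "ennreal d * (\<integral>\<^sup>+y. g (f (\<psi> x) (\<psi> y)) \<partial>B) = (\<integral>\<^sup>+y. g (f (\<psi> x) y) \<partial>B)" for x
    proof -
      have "(\<lambda>y. g (f (\<psi> x) y)) \<in> borel_measurable borel" using f' by measurable
      with qB show ?thesis by (auto simp: quasi_inv_def)
    qed
    then show ?thesis by simp
  qed
  also have "\<dots> = (\<integral>\<^sup>+x. \<integral>\<^sup>+y. g (f x y) \<partial>B \<partial>A)"
    using qA m2 by (auto simp: quasi_inv_def)
  also have "\<dots> = (\<integral>\<^sup>+x. g x \<partial>push_pair f A B)"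
    by (rule nn_integral_push_pair[OF A B f g, symmetric])
  finally show "ennreal (c * d) * (\<integral>\<^sup>+x. g (\<psi> x) \<partial>push_pair f A B) = (\<integral>\<^sup>+x. g x \<partial>push_pair f A B)" .
qed

text \<open>Only nonnegative norms occur, but the absolute values make the bounds required by
  \<open>strip_finite_push_pair\<close> true on the whole plane. Second coordinates add because the
  two factors are orthogonal.\<close>

definition max_pair :: "real \<times> real \<Rightarrow> real \<times> real \<Rightarrow> real \<times> real" where
  "max_pair x y = (max \<bar>fst x\<bar> \<bar>fst y\<bar>, snd x + snd y)"
definition sum_pair :: "real \<times> real \<Rightarrow> real \<times> real \<Rightarrow> real \<times> real" where
  "sum_pair x y = (\<bar>fst x\<bar> + \<bar>fst y\<bar>, snd x + snd y)"
text \<open>The gradient of the maximum of two norms in separate variables is the gradient of the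
  larger one. Ties go to the first argument, in agreement with \<open>gslope\<close> below.\<close>

definition sel_pair :: "real \<times> real \<Rightarrow> real \<times> real \<Rightarrow> real \<times> real" where
  "sel_pair x y = (if \<bar>fst y\<bar> \<le> \<bar>fst x\<bar> then (\<bar>fst x\<bar>, snd x) else (\<bar>fst y\<bar>, snd y))"

lemma exp_sum_pair: "ennreal (exp (- \<bar>fst (sum_pair x y)\<bar>)) = ennreal (exp (- \<bar>fst x\<bar>)) * ennreal (exp (- \<bar>fst y\<bar>))"
  by (simp add: sum_pair_def flip: ennreal_mult exp_add)

lemma snd_sum_pair: "snd (sum_pair x y) = snd x + snd y"
  by (simp add: sum_pair_def)

lemma max_pair_measurable: "(\<lambda>(x, y). max_pair x y) \<in> borel \<Otimes>\<^sub>M borel \<rightarrow>\<^sub>M borel"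
  unfolding max_pair_def borel_prod[symmetric] by measurable
lemma sum_pair_measurable: "(\<lambda>(x, y). sum_pair x y) \<in> borel \<Otimes>\<^sub>M borel \<rightarrow>\<^sub>M borel"
  unfolding sum_pair_def borel_prod[symmetric] by measurable
lemma sel_pair_measurable: "(\<lambda>(x, y). sel_pair x y) \<in> borel \<Otimes>\<^sub>M borel \<rightarrow>\<^sub>M borel"
  unfolding sel_pair_def borel_prod[symmetric] by measurable

text \<open>
  For leaves \<open>\<langle>v, z\<rangle>\<close>, \<open>pos_law\<close> is the joint law of \<open>(\<parallel>x\<parallel>, \<langle>x, z\<rangle>)\<close> under Lebesgue measure in the
  leaf coordinates, and \<open>grad_law\<close> that of \<open>(M p, \<langle>\<nabla>M p, z\<rangle>)\<close> for the dual norm \<open>M\<close>.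
\<close>

primrec pos_law :: "real htree \<Rightarrow> (real \<times> real) measure" where
  "pos_law (Seg a) = distr lborel borel (\<lambda>t. (\<bar>t\<bar>, t * a))"
| "pos_law (LInf s t) = push_pair max_pair (pos_law s) (pos_law t)"
| "pos_law (LOne s t) = push_pair sum_pair (pos_law s) (pos_law t)"

primrec grad_law :: "real htree \<Rightarrow> (real \<times> real) measure" where
  "grad_law (Seg a) = distr lborel borel (\<lambda>t. (\<bar>t\<bar>, sgn t * a))"
| "grad_law (LInf s t) = push_pair sum_pair (grad_law s) (grad_law t)"
| "grad_law (LOne s t) = push_pair sel_pair (grad_law s) (grad_law t)"

lemma seg_measurable [measurable]:
  "(\<lambda>t. (\<bar>t\<bar>, t * a)) \<in> borel \<rightarrow>\<^sub>M (borel :: (real \<times> real) measure)"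
  "(\<lambda>t. (\<bar>t\<bar>, sgn t * a)) \<in> borel \<rightarrow>\<^sub>M (borel :: (real \<times> real) measure)"
  unfolding borel_prod[symmetric] by measurable

lemma abs_le_Icc: "{t::real. \<bar>t\<bar> \<le> k} = {-k..k}" by auto

lemma strip_finite_pos_law: "strip_finite (pos_law t)"
proof (induction t)
  case (Seg a)
  then show ?case
    by (auto simp: strip_finite_def emeasure_distr vimage_def abs_le_Icc emeasure_lborel_Icc_eq)
next
  case (LInf s t)
  then show ?case by (auto intro!: strip_finite_push_pair max_pair_measurable simp: max_pair_def)
next
  case (LOne s t)
  then show ?case by (auto intro!: strip_finite_push_pair sum_pair_measurable simp: sum_pair_def)
qed

lemma strip_finite_grad_law: "strip_finite (grad_law t)"
proof (induction t)
  case (Seg a)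
  then show ?case
    by (auto simp: strip_finite_def emeasure_distr vimage_def abs_le_Icc emeasure_lborel_Icc_eq)
next
  case (LInf s t)
  then show ?case by (auto intro!: strip_finite_push_pair sum_pair_measurable simp: sum_pair_def)
next
  case (LOne s t)
  then show ?case by (auto intro!: strip_finite_push_pair sel_pair_measurable simp: sel_pair_def)
qed

section \<open>Homogeneity, reflection symmetry and null spheres\<close>

lemma scale_measurable [measurable]:
  "(\<lambda>x::real\<times>real. (s * fst x, s * snd x)) \<in> borel \<rightarrow>\<^sub>M borel"
  "(\<lambda>x::real\<times>real. (s * fst x, snd x)) \<in> borel \<rightarrow>\<^sub>M borel"
  "(\<lambda>x::real\<times>real. (fst x, - snd x)) \<in> borel \<rightarrow>\<^sub>M borel"
  unfolding borel_prod[symmetric] by measurable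

lemma pos_law_scale:
  assumes s: "s > 0" shows "quasi_inv (pos_law t) (s ^ hdim t) (\<lambda>x. (s * fst x, s * snd x))"
proof (induction t)
  case (Seg a)
  show ?case unfolding quasi_inv_def
  proof
    fix f :: "real \<times> real \<Rightarrow> ennreal" assume [measurable]: "f \<in> borel_measurable borel"
    have "(\<integral>\<^sup>+t. f (\<bar>t\<bar>, t * a) \<partial>lborel) = ennreal s * (\<integral>\<^sup>+t. f (\<bar>s * t\<bar>, s * t * a) \<partial>lborel)"
      using nn_integral_real_affine[of "\<lambda>t. f (\<bar>t\<bar>, t * a)" s 0] s by simp
    then show "ennreal (s ^ hdim (Seg a)) * (\<integral>\<^sup>+x. f (s * fst x, s * snd x) \<partial>pos_law (Seg a)) = (\<integral>\<^sup>+x. f x \<partial>pos_law (Seg a))"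
      using s by (simp add: nn_integral_distr abs_mult mult.assoc)
  qed
next
  case (LInf s1 t1)
  then show ?case using s unfolding hdim.simps power_add pos_law.simps
    by (intro quasi_inv_push_pair strip_finite_pos_law max_pair_measurable)
       (auto simp: max_pair_def abs_mult algebra_simps max_mult_distrib_left)
next
  case (LOne s1 t1)
  then show ?case using s unfolding hdim.simps power_add pos_law.simps
    by (intro quasi_inv_push_pair strip_finite_pos_law sum_pair_measurable)
       (auto simp: sum_pair_def abs_mult algebra_simps)
qed

text \<open>A norm is homogeneous of degree 1 and its gradient of degree 0, so only the first
  coordinate is scaled, in contrast to \<open>pos_law_scale\<close>.\<close>

lemma grad_law_scale:
  assumes s: "s > 0" shows "quasi_inv (grad_law t) (s ^ hdim t) (\<lambda>x. (s * fst x, snd x))"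
proof (induction t)
  case (Seg a)
  show ?case unfolding quasi_inv_def
  proof
    fix f :: "real \<times> real \<Rightarrow> ennreal" assume [measurable]: "f \<in> borel_measurable borel"
    have "(\<integral>\<^sup>+t. f (\<bar>t\<bar>, sgn t * a) \<partial>lborel) = ennreal s * (\<integral>\<^sup>+t. f (\<bar>s * t\<bar>, sgn (s * t) * a) \<partial>lborel)"
      using nn_integral_real_affine[of "\<lambda>t. f (\<bar>t\<bar>, sgn t * a)" s 0] s by simp
    then show "ennreal (s ^ hdim (Seg a)) * (\<integral>\<^sup>+x. f (s * fst x, snd x) \<partial>grad_law (Seg a)) = (\<integral>\<^sup>+x. f x \<partial>grad_law (Seg a))"
      using s by (simp add: nn_integral_distr abs_mult sgn_mult)
  qed
next
  case (LInf s1 t1)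
  then show ?case using s unfolding hdim.simps power_add grad_law.simps
    by (intro quasi_inv_push_pair strip_finite_grad_law sum_pair_measurable)
       (auto simp: sum_pair_def abs_mult algebra_simps)
next
  case (LOne s1 t1)
  then show ?case using s unfolding hdim.simps power_add grad_law.simps
    by (intro quasi_inv_push_pair strip_finite_grad_law sel_pair_measurable)
       (auto simp: sel_pair_def abs_mult)
qed

lemma pos_law_neg: "quasi_inv (pos_law t) 1 (\<lambda>x. (fst x, - snd x))"
proof (induction t)
  case (Seg a)
  show ?case unfolding quasi_inv_def
  proof
    fix f :: "real \<times> real \<Rightarrow> ennreal" assume [measurable]: "f \<in> borel_measurable borel"
    have "(\<integral>\<^sup>+t. f (\<bar>t\<bar>, t * a) \<partial>lborel) = (\<integral>\<^sup>+t. f (\<bar>t\<bar>, - (t * a)) \<partial>lborel)"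
      using nn_integral_real_affine[of "\<lambda>t. f (\<bar>t\<bar>, t * a)" "-1" 0] by simp
    then show "ennreal 1 * (\<integral>\<^sup>+x. f (fst x, - snd x) \<partial>pos_law (Seg a)) = (\<integral>\<^sup>+x. f x \<partial>pos_law (Seg a))"
      by (simp add: nn_integral_distr)
  qed
next
  case (LInf s1 t1)
  then have "quasi_inv (push_pair max_pair (pos_law s1) (pos_law t1)) (1 * 1) (\<lambda>x. (fst x, - snd x))"
    by (intro quasi_inv_push_pair strip_finite_pos_law max_pair_measurable) (auto simp: max_pair_def)
  then show ?case by simp
next
  case (LOne s1 t1)
  then have "quasi_inv (push_pair sum_pair (pos_law s1) (pos_law t1)) (1 * 1) (\<lambda>x. (fst x, - snd x))"
    by (intro quasi_inv_push_pair strip_finite_pos_law sum_pair_measurable) (auto simp: sum_pair_def)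
  then show ?case by simp
qed

lemma grad_law_neg: "quasi_inv (grad_law t) 1 (\<lambda>x. (fst x, - snd x))"
proof (induction t)
  case (Seg a)
  show ?case unfolding quasi_inv_def
  proof
    fix f :: "real \<times> real \<Rightarrow> ennreal" assume [measurable]: "f \<in> borel_measurable borel"
    have "(\<integral>\<^sup>+t. f (\<bar>t\<bar>, sgn t * a) \<partial>lborel) = (\<integral>\<^sup>+t. f (\<bar>t\<bar>, - (sgn t * a)) \<partial>lborel)"
      using nn_integral_real_affine[of "\<lambda>t. f (\<bar>t\<bar>, sgn t * a)" "-1" 0] by (simp add: sgn_minus)
    then show "ennreal 1 * (\<integral>\<^sup>+x. f (fst x, - snd x) \<partial>grad_law (Seg a)) = (\<integral>\<^sup>+x. f x \<partial>grad_law (Seg a))"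
      by (simp add: nn_integral_distr)
  qed
next
  case (LInf s1 t1)
  then have "quasi_inv (push_pair sum_pair (grad_law s1) (grad_law t1)) (1 * 1) (\<lambda>x. (fst x, - snd x))"
    by (intro quasi_inv_push_pair strip_finite_grad_law sum_pair_measurable) (auto simp: sum_pair_def)
  then show ?case by simp
next
  case (LOne s1 t1)
  then have "quasi_inv (push_pair sel_pair (grad_law s1) (grad_law t1)) (1 * 1) (\<lambda>x. (fst x, - snd x))"
    by (intro quasi_inv_push_pair strip_finite_grad_law sel_pair_measurable) (auto simp: sel_pair_def)
  then show ?case by simp
qed

text \<open>Homogeneity excludes spheres of positive mass. At radius 0 the finite mass equals
  \<open>(1/2) ^ n\<close> times itself. For positive radii the masses are \<open>s ^ n\<close>
  times that of the unit sphere, hence no smaller than it for \<open>s\<close> between 1 and 2,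
  while by Tonelli their integral over \<open>s\<close> is 0 because each point lies on one sphere
  only.\<close>

lemma strip_scale_null:
  assumes A: "strip_finite A" and n: "n > 0"
    and q: "\<And>s. s > 0 \<Longrightarrow> quasi_inv A (s ^ n) (\<phi> s)" and \<phi>: "\<And>s x. fst (\<phi> s x) = s * fst x"
  shows "AE x in A. \<bar>fst x\<bar> \<noteq> r"
proof -
  let ?e = "\<lambda>s. emeasure A {x. \<bar>fst x\<bar> = s}"
  have [measurable_cong]: "sets A = sets borel" by (rule strip_finite_sets[OF A])
  have c: "{x::real\<times>real. \<bar>fst x\<bar> = s} \<in> sets borel" for s
    by (intro borel_closed closed_Collect_eq continuous_intros)
  have scale: "ennreal (s ^ n) * ?e (r / s) = ?e r" if s: "s > 0" for s r
  proof -
    have "ennreal (s ^ n) * (\<integral>\<^sup>+x. indicator {x. \<bar>fst x\<bar> = r} (\<phi> s x) \<partial>A) = (\<integral>\<^sup>+x. indicator {x. \<bar>fst x\<bar> = r} x \<partial>A)"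
      using q[OF s] c by (simp add: quasi_inv_def)
    also have "(\<lambda>x. indicator {x. \<bar>fst x\<bar> = r} (\<phi> s x) :: ennreal) = indicator {x. \<bar>fst x\<bar> = r / s}"
      using s by (auto simp: fun_eq_iff indicator_def \<phi> abs_mult field_simps)
    finally show ?thesis using c by (simp add: strip_finite_sets[OF A])
  qed
  have fin: "?e s < \<infinity>" for s
    using A le_less_trans[OF emeasure_mono[of "{x. \<bar>fst x\<bar> = s}" "{x. \<bar>fst x\<bar> \<le> s}" A]]
    by (auto simp: strip_finite_def)
  have "?e r = 0"
  proof -
    consider "r < 0" | "r = 0" | "r > 0" by linarith
    then show ?thesis
    proof cases
      case 1
      then have "{x::real\<times>real. \<bar>fst x\<bar> = r} = {}" by auto
      then show ?thesis by simp
    next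
      case 2
      obtain e where e: "?e 0 = ennreal e" "e \<ge> 0" using fin[of 0] by (metis infinity_ennreal_def less_top_ennreal)
      have "ennreal ((1/2) ^ n * e) = ennreal e"
        using scale[of "1/2" 0] e by (simp add: ennreal_mult)
      then have "(1/2) ^ n * e = e" using e by (subst (asm) ennreal_inj) auto
      moreover have "(1/2::real) ^ n \<noteq> 1" using n power_strict_decreasing[of 0 n "1/2::real"] by auto
      ultimately have "e = 0" by auto
      then show ?thesis using 2 e by simp
    next
      case 3
      interpret A: sigma_finite_measure A by (rule strip_finite_sigma[OF A])
      have "(\<integral>\<^sup>+s. \<integral>\<^sup>+x. indicator {x. \<bar>fst x\<bar> = s} x \<partial>A \<partial>lborel) = (\<integral>\<^sup>+x. \<integral>\<^sup>+s. indicator {x. \<bar>fst x\<bar> = s} x \<partial>lborel \<partial>A)"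
      proof (rule nn_integral_Tonelli[OF sigma_finite_lborel strip_finite_sigma[OF A]])
        have "{p :: real \<times> real \<times> real. \<bar>fst (snd p)\<bar> = fst p} \<in> sets borel"
          by (intro borel_closed closed_Collect_eq continuous_intros)
        then have "indicator {p :: real \<times> real \<times> real. \<bar>fst (snd p)\<bar> = fst p} \<in> borel_measurable (borel \<Otimes>\<^sub>M borel :: (real \<times> real \<times> real) measure)"
          by (simp add: borel_prod)
        moreover have "sets (lborel \<Otimes>\<^sub>M A) = sets (borel \<Otimes>\<^sub>M borel)"
          by (intro sets_pair_measure_cong) (auto simp: strip_finite_sets[OF A])
        ultimately have "indicator {p :: real \<times> real \<times> real. \<bar>fst (snd p)\<bar> = fst p} \<in> borel_measurable (lborel \<Otimes>\<^sub>M A)"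
          using measurable_cong_sets by blast
        moreover have "(\<lambda>(s, x). indicator {x. \<bar>fst x\<bar> = s} x :: ennreal) = indicator {p :: real \<times> real \<times> real. \<bar>fst (snd p)\<bar> = fst p}"
          by (auto simp: fun_eq_iff split: split_indicator)
        ultimately show "(\<lambda>(s, x). indicator {x. \<bar>fst x\<bar> = s} x :: ennreal) \<in> borel_measurable (lborel \<Otimes>\<^sub>M A)"
          by simp
      qed
      also have "(\<lambda>x::real\<times>real. \<integral>\<^sup>+s. indicator {x. \<bar>fst x\<bar> = s} x \<partial>lborel) = (\<lambda>x. 0)"
      proof
        fix x :: "real \<times> real"
        have "(\<integral>\<^sup>+s. indicator {x. \<bar>fst x\<bar> = s} x \<partial>lborel) = (\<integral>\<^sup>+s. indicator {\<bar>fst x\<bar>} s \<partial>lborel)"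
          by (intro nn_integral_cong) (auto split: split_indicator)
        then show "(\<integral>\<^sup>+s. indicator {x. \<bar>fst x\<bar> = s} x \<partial>lborel) = (0::ennreal)" by simp
      qed
      finally have int0: "(\<integral>\<^sup>+s. ?e s \<partial>lborel) = 0"
        using c by (simp add: strip_finite_sets[OF A])
      have es: "?e s = ennreal (s ^ n) * ?e 1" if "s > 0" for s
        using scale[OF that, of s] that by simp
      have "indicator {1..2::real} s * ?e 1 \<le> ?e s" for s
      proof (cases "s \<in> {1..2}")
        case True
        then have "1 * ?e 1 \<le> ennreal (s ^ n) * ?e 1" by (intro mult_right_mono) auto
        then show ?thesis using True es[of s] by simp
      qed simp
      then have "(\<integral>\<^sup>+s. indicator {1..2::real} s * ?e 1 \<partial>lborel) \<le> (\<integral>\<^sup>+s. ?e s \<partial>lborel)"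
        by (intro nn_integral_mono)
      with int0 have "?e 1 = 0" by (simp add: nn_integral_multc)
      then show ?thesis using scale[OF 3, of r] 3 by simp
    qed
  qed
  then show ?thesis
    by (intro AE_I[where N="{x. \<bar>fst x\<bar> = r}"]) (auto simp: strip_finite_sets[OF A] c)
qed

lemma pos_law_null: "AE x in pos_law t. \<bar>fst x\<bar> \<noteq> s"
  by (rule strip_scale_null[OF strip_finite_pos_law hdim_pos pos_law_scale]) auto

lemma grad_law_null: "AE x in grad_law t. \<bar>fst x\<bar> \<noteq> s"
  by (rule strip_scale_null[OF strip_finite_grad_law hdim_pos grad_law_scale]) auto

section \<open>Exponential weights, unit balls and the volume product\<close>

lemma nn_integral_exp_layer:
  assumes A: "strip_finite A" and G[measurable]: "G \<in> borel_measurable borel"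
    and h: "\<And>r. r > 0 \<Longrightarrow> (\<integral>\<^sup>+x. G x * indicator {x. \<bar>fst x\<bar> \<le> r} x \<partial>A)
        = ennreal (r ^ m) * (\<integral>\<^sup>+x. G x * indicator {x. \<bar>fst x\<bar> \<le> 1} x \<partial>A)"
  shows "(\<integral>\<^sup>+x. G x * ennreal (exp (- \<bar>fst x\<bar>)) \<partial>A)
    = ennreal (fact m) * (\<integral>\<^sup>+x. G x * indicator {x. \<bar>fst x\<bar> \<le> 1} x \<partial>A)" (is "_ = _ * ?a")
proof -
  have [measurable_cong]: "sets A = sets borel" by (rule strip_finite_sets[OF A])
  have G': "G \<in> borel_measurable A" using G by (simp add: strip_finite_measurable[OF A])
  have m: "{p :: (real \<times> real) \<times> real. \<bar>fst (fst p)\<bar> \<le> snd p} \<in> sets borel"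
    by (intro borel_closed closed_Collect_le continuous_intros)
  \<comment> \<open>Layer-cake representation: the weight becomes an integral over the levels
    \<open>r\<close> of strip indicators. By \<open>h\<close> each strip contributes
    \<open>r ^ m\<close> times the unit strip, and the Gamma integral turns this into the
    factorial.\<close>
  have ex: "ennreal (exp (- \<bar>t\<bar>)) = (\<integral>\<^sup>+r. ennreal (exp (- r)) * indicator {\<bar>t\<bar>..} r \<partial>lborel)" for t :: real
  proof -
    have "(\<integral>\<^sup>+r. ennreal (exp (- r)) * indicator {\<bar>t\<bar>..} r \<partial>lborel) = 0 - (- exp (- \<bar>t\<bar>))"
    proof (rule nn_integral_FTC_atLeast)
      show "((\<lambda>x::real. - exp (- x)) \<longlongrightarrow> 0) at_top"
        by (rule tendsto_eq_rhs[OF tendsto_minus[OF filterlim_compose[OF exp_at_bot filterlim_uminus_at_bot_at_top]]]) simp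
    qed (auto intro!: derivative_eq_intros)
    then show ?thesis by simp
  qed
  have ind: "indicator {\<bar>fst x\<bar>..} r = indicator {p :: (real \<times> real) \<times> real. \<bar>fst (fst p)\<bar> \<le> snd p} (x, r)" for x :: "real \<times> real" and r
    by (simp add: indicator_def)
  have "(\<integral>\<^sup>+x. G x * ennreal (exp (- \<bar>fst x\<bar>)) \<partial>A)
    = (\<integral>\<^sup>+x. \<integral>\<^sup>+r. G x * (ennreal (exp (- r)) * indicator {\<bar>fst x\<bar>..} r) \<partial>lborel \<partial>A)"
    by (simp add: ex nn_integral_cmult)
  also have "\<dots> = (\<integral>\<^sup>+r. \<integral>\<^sup>+x. G x * (ennreal (exp (- r)) * indicator {\<bar>fst x\<bar>..} r) \<partial>A \<partial>lborel)"
  proof (rule nn_integral_Tonelli[OF strip_finite_sigma[OF A] sigma_finite_lborel])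
    have "(\<lambda>p::(real \<times> real) \<times> real. G (fst p) * (ennreal (exp (- snd p)) * indicator {p :: (real \<times> real) \<times> real. \<bar>fst (fst p)\<bar> \<le> snd p} p)) \<in> borel_measurable borel"
      using m by measurable
    moreover have "sets (A \<Otimes>\<^sub>M lborel) = sets (borel :: ((real \<times> real) \<times> real) measure)"
      using sets_pair_measure_cong[OF strip_finite_sets[OF A] sets_lborel[where 'a=real]]
      by (rule trans) (rule arg_cong[OF borel_prod])
    ultimately have "(\<lambda>p::(real \<times> real) \<times> real. G (fst p) * (ennreal (exp (- snd p)) * indicator {p :: (real \<times> real) \<times> real. \<bar>fst (fst p)\<bar> \<le> snd p} p)) \<in> borel_measurable (A \<Otimes>\<^sub>M lborel)"
      using measurable_cong_sets by blast
    then show "(\<lambda>(x, r). G x * (ennreal (exp (- r)) * indicator {\<bar>fst x\<bar>..} r)) \<in> borel_measurable (A \<Otimes>\<^sub>M lborel)"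
      by (simp add: ind case_prod_beta)
  qed
  also have "\<dots> = (\<integral>\<^sup>+r. ennreal (exp (- r)) * (\<integral>\<^sup>+x. G x * indicator {x. \<bar>fst x\<bar> \<le> r} x \<partial>A) \<partial>lborel)"
  proof (rule nn_integral_cong)
    fix r :: real
    have "(\<integral>\<^sup>+x. G x * (ennreal (exp (- r)) * indicator {\<bar>fst x\<bar>..} r) \<partial>A)
      = (\<integral>\<^sup>+x. ennreal (exp (- r)) * (G x * indicator {x. \<bar>fst x\<bar> \<le> r} x) \<partial>A)"
      by (intro nn_integral_cong) (auto split: split_indicator simp: mult_ac)
    also have "\<dots> = ennreal (exp (- r)) * (\<integral>\<^sup>+x. G x * indicator {x. \<bar>fst x\<bar> \<le> r} x \<partial>A)"
      by (rule nn_integral_cmult) measurable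
    finally show "(\<integral>\<^sup>+x. G x * (ennreal (exp (- r)) * indicator {\<bar>fst x\<bar>..} r) \<partial>A) = \<dots>" .
  qed
  also have "\<dots> = (\<integral>\<^sup>+r. ennreal (r ^ m * exp (- r)) * indicator {0..} r * ?a \<partial>lborel)"
  proof (rule nn_integral_cong_AE, rule AE_mp[OF AE_lborel_singleton[of 0]], rule AE_I2, rule impI)
    fix r :: real assume r: "r \<noteq> 0"
    show "ennreal (exp (- r)) * (\<integral>\<^sup>+x. G x * indicator {x. \<bar>fst x\<bar> \<le> r} x \<partial>A) = ennreal (r ^ m * exp (- r)) * indicator {0..} r * ?a"
    proof (cases "r > 0")
      case True
      then show ?thesis by (subst h[OF True]) (simp add: ennreal_mult' mult_ac)
    next
      case False
      then have "{x::real\<times>real. \<bar>fst x\<bar> \<le> r} = {}" using r by auto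
      then show ?thesis using False r by simp
    qed
  qed
  also have "\<dots> = ennreal (fact m) * ?a"
    by (simp add: nn_integral_multc nn_intergal_power_times_exp_Ici)
  finally show ?thesis .
qed

text \<open>Volume of the polar body in coordinates where every segment has half-length 1. The
  labels of the leaves enter the second coordinate only and do not affect it.\<close>

definition dual_vol :: "real htree \<Rightarrow> ennreal" where
  "dual_vol t = emeasure (grad_law t) {x. \<bar>fst x\<bar> \<le> 1}"

lemma grad_law_layer:
  assumes [measurable]: "f \<in> borel_measurable borel" and r: "r > 0"
  shows "(\<integral>\<^sup>+x. f (snd x) * indicator {x. \<bar>fst x\<bar> \<le> r} x \<partial>grad_law t)
      = ennreal (r ^ hdim t) * (\<integral>\<^sup>+x. f (snd x) * indicator {x. \<bar>fst x\<bar> \<le> 1} x \<partial>grad_law t)"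
proof -
  have "ennreal (r ^ hdim t) * (\<integral>\<^sup>+x. f (snd x) * indicator {x. \<bar>fst x\<bar> \<le> r} (r * fst x, snd x) \<partial>grad_law t)
     = (\<integral>\<^sup>+x. f (snd x) * indicator {x. \<bar>fst x\<bar> \<le> r} x \<partial>grad_law t)"
    using quasi_invD[OF grad_law_scale[OF r], of "\<lambda>x. f (snd x) * indicator {x. \<bar>fst x\<bar> \<le> r} x" t] by simp
  moreover have "(\<lambda>x::real\<times>real. indicator {x. \<bar>fst x\<bar> \<le> r} (r * fst x, snd x) :: ennreal) = indicator {x. \<bar>fst x\<bar> \<le> 1}"
    using r by (auto simp: fun_eq_iff indicator_def abs_mult)
  ultimately show ?thesis by (simp add: fun_eq_iff)
qed

lemma grad_law_exp:
  assumes [measurable]: "f \<in> borel_measurable borel"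
  shows "(\<integral>\<^sup>+x. f (snd x) * ennreal (exp (- \<bar>fst x\<bar>)) \<partial>grad_law t)
      = ennreal (fact (hdim t)) * (\<integral>\<^sup>+x. f (snd x) * indicator {x. \<bar>fst x\<bar> \<le> 1} x \<partial>grad_law t)"
  by (rule nn_integral_exp_layer[OF strip_finite_grad_law _ grad_law_layer]) measurable

lemma grad_law_exp1:
  "(\<integral>\<^sup>+x. ennreal (exp (- \<bar>fst x\<bar>)) \<partial>grad_law t) = ennreal (fact (hdim t)) * dual_vol t"
  using grad_law_exp[of "\<lambda>_. 1" t] by (simp add: dual_vol_def strip_finite_sets[OF strip_finite_grad_law])

lemma pos_law_layer:
  assumes r: "r > 0"
  shows "emeasure (pos_law t) {x. \<bar>fst x\<bar> \<le> r} = ennreal (r ^ hdim t) * emeasure (pos_law t) {x. \<bar>fst x\<bar> \<le> 1}"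
proof -
  have "ennreal (r ^ hdim t) * (\<integral>\<^sup>+x. indicator {x. \<bar>fst x\<bar> \<le> r} (r * fst x, r * snd x) \<partial>pos_law t)
     = (\<integral>\<^sup>+x. indicator {x. \<bar>fst x\<bar> \<le> r} x \<partial>pos_law t)"
    using pos_law_scale[OF r, of t] by (auto simp: quasi_inv_def)
  moreover have "(\<lambda>x::real\<times>real. indicator {x. \<bar>fst x\<bar> \<le> r} (r * fst x, r * snd x) :: ennreal) = indicator {x. \<bar>fst x\<bar> \<le> 1}"
    using r by (auto simp: fun_eq_iff indicator_def abs_mult)
  ultimately show ?thesis by (simp add: strip_finite_sets[OF strip_finite_pos_law])
qed

lemma pos_law_exp1:
  "(\<integral>\<^sup>+x. ennreal (exp (- \<bar>fst x\<bar>)) \<partial>pos_law t) = ennreal (fact (hdim t)) * emeasure (pos_law t) {x. \<bar>fst x\<bar> \<le> 1}"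
proof -
  have "(\<integral>\<^sup>+x. 1 * ennreal (exp (- \<bar>fst x\<bar>)) \<partial>pos_law t)
      = ennreal (fact (hdim t)) * (\<integral>\<^sup>+x. 1 * indicator {x. \<bar>fst x\<bar> \<le> 1} x \<partial>pos_law t)"
  proof (rule nn_integral_exp_layer[OF strip_finite_pos_law])
    fix r :: real assume "r > 0"
    from pos_law_layer[OF this, of t]
    show "(\<integral>\<^sup>+x. 1 * indicator {x. \<bar>fst x\<bar> \<le> r} x \<partial>pos_law t)
        = ennreal (r ^ hdim t) * (\<integral>\<^sup>+x. 1 * indicator {x. \<bar>fst x\<bar> \<le> 1} x \<partial>pos_law t)"
      by (simp add: strip_finite_sets[OF strip_finite_pos_law])
  qed simp
  then show ?thesis by (simp add: strip_finite_sets[OF strip_finite_pos_law])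
qed

lemma nn_integral_prod_fun:
  assumes A: "strip_finite A" and B: "strip_finite B"
    and [measurable]: "f \<in> borel_measurable borel" "g \<in> borel_measurable borel"
  shows "(\<integral>\<^sup>+x. \<integral>\<^sup>+y. f x * g y \<partial>B \<partial>A) = (\<integral>\<^sup>+x. f x \<partial>A) * (\<integral>\<^sup>+y. g y \<partial>B)"
  by (simp add: nn_integral_cmult nn_integral_multc strip_finite_measurable[OF A] strip_finite_measurable[OF B])

text \<open>This is \<open>vol B * vol B\<degree> = 4 ^ n / n!\<close> with the factorial absorbed
  into the exponential integral. Where norms are combined by a maximum, the indicator of the unit
  ball factorises; where they are added, the exponential does. Every node is of one kind on the
  primal side and of the other kind on the dual side.\<close>

lemma volume_product:
  "emeasure (pos_law t) {x. \<bar>fst x\<bar> \<le> 1} * (\<integral>\<^sup>+x. ennreal (exp (- \<bar>fst x\<bar>)) \<partial>grad_law t) = ennreal (4 ^ hdim t)"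
proof (induction t)
  case (Seg a)
  have "(\<integral>\<^sup>+x. ennreal (exp (- \<bar>fst x\<bar>)) \<partial>grad_law (Seg a)) = dual_vol (Seg a)"
    using grad_law_exp1[of "Seg a"] by simp
  also have "\<dots> = 2"
    by (simp add: dual_vol_def emeasure_distr vimage_def abs_le_Icc)
  finally show ?case
    by (simp add: emeasure_distr vimage_def abs_le_Icc flip: ennreal_numeral ennreal_mult)
next
  case (LInf s t)
  have 1: "emeasure (pos_law (LInf s t)) {x. \<bar>fst x\<bar> \<le> 1} = emeasure (pos_law s) {x. \<bar>fst x\<bar> \<le> 1} * emeasure (pos_law t) {x. \<bar>fst x\<bar> \<le> 1}"
  proof -
    have "emeasure (pos_law (LInf s t)) {x. \<bar>fst x\<bar> \<le> 1} = (\<integral>\<^sup>+x. indicator {x. \<bar>fst x\<bar> \<le> 1} x \<partial>push_pair max_pair (pos_law s) (pos_law t))"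
      by (subst nn_integral_indicator) (auto simp: push_pair_def)
    also have "\<dots> = (\<integral>\<^sup>+x. \<integral>\<^sup>+y. indicator {x. \<bar>fst x\<bar> \<le> 1} (max_pair x y) \<partial>pos_law t \<partial>pos_law s)"
      by (rule nn_integral_push_pair[OF strip_finite_pos_law strip_finite_pos_law max_pair_measurable]) simp
    also have "\<dots> = (\<integral>\<^sup>+x. \<integral>\<^sup>+y. indicator {x. \<bar>fst x\<bar> \<le> 1} x * indicator {x. \<bar>fst x\<bar> \<le> 1} y \<partial>pos_law t \<partial>pos_law s)"
      by (intro nn_integral_cong) (simp add: max_pair_def indicator_def)
    also have "\<dots> = emeasure (pos_law s) {x. \<bar>fst x\<bar> \<le> 1} * emeasure (pos_law t) {x. \<bar>fst x\<bar> \<le> 1}"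
      by (subst nn_integral_prod_fun[OF strip_finite_pos_law strip_finite_pos_law]) (simp_all add: strip_finite_sets[OF strip_finite_pos_law])
    finally show ?thesis .
  qed
  have 2: "(\<integral>\<^sup>+x. ennreal (exp (- \<bar>fst x\<bar>)) \<partial>grad_law (LInf s t)) = (\<integral>\<^sup>+x. ennreal (exp (- \<bar>fst x\<bar>)) \<partial>grad_law s) * (\<integral>\<^sup>+x. ennreal (exp (- \<bar>fst x\<bar>)) \<partial>grad_law t)"
    unfolding grad_law.simps
    by (subst nn_integral_push_pair[OF strip_finite_grad_law strip_finite_grad_law sum_pair_measurable])
       (auto simp: exp_sum_pair nn_integral_prod_fun[OF strip_finite_grad_law strip_finite_grad_law])
  have "a * b * (c * d) = (a * c) * (b * d)" for a b c d :: ennreal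
    by (simp only: mult_ac)
  then show ?case unfolding 1 2 by (simp add: LInf power_add ennreal_mult)
next
  case (LOne s t)
  have 1: "dual_vol (LOne s t) = dual_vol s * dual_vol t"
  proof -
    have "dual_vol (LOne s t) = (\<integral>\<^sup>+x. indicator {x. \<bar>fst x\<bar> \<le> 1} x \<partial>push_pair sel_pair (grad_law s) (grad_law t))"
      unfolding dual_vol_def by (subst nn_integral_indicator) (auto simp: push_pair_def)
    also have "\<dots> = (\<integral>\<^sup>+x. \<integral>\<^sup>+y. indicator {x. \<bar>fst x\<bar> \<le> 1} (sel_pair x y) \<partial>grad_law t \<partial>grad_law s)"
      by (rule nn_integral_push_pair[OF strip_finite_grad_law strip_finite_grad_law sel_pair_measurable]) simp
    also have "\<dots> = (\<integral>\<^sup>+x. \<integral>\<^sup>+y. indicator {x. \<bar>fst x\<bar> \<le> 1} x * indicator {x. \<bar>fst x\<bar> \<le> 1} y \<partial>grad_law t \<partial>grad_law s)"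
      by (intro nn_integral_cong) (simp add: sel_pair_def indicator_def)
    also have "\<dots> = dual_vol s * dual_vol t"
      unfolding dual_vol_def
      by (subst nn_integral_prod_fun[OF strip_finite_grad_law strip_finite_grad_law]) (simp_all add: strip_finite_sets[OF strip_finite_grad_law])
    finally show ?thesis .
  qed
  have 2: "(\<integral>\<^sup>+x. ennreal (exp (- \<bar>fst x\<bar>)) \<partial>pos_law (LOne s t)) = (\<integral>\<^sup>+x. ennreal (exp (- \<bar>fst x\<bar>)) \<partial>pos_law s) * (\<integral>\<^sup>+x. ennreal (exp (- \<bar>fst x\<bar>)) \<partial>pos_law t)"
    unfolding pos_law.simps
    by (subst nn_integral_push_pair[OF strip_finite_pos_law strip_finite_pos_law sum_pair_measurable])
       (auto simp: exp_sum_pair nn_integral_prod_fun[OF strip_finite_pos_law strip_finite_pos_law])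
  \<comment> \<open>The factorial is moved from the dual to the primal side, where now the
    exponential integral factorises, while the dual side factorises as a volume.\<close>
  have "emeasure (pos_law (LOne s t)) {x. \<bar>fst x\<bar> \<le> 1} * (ennreal (fact (hdim (LOne s t))) * dual_vol (LOne s t))
     = (ennreal (fact (hdim (LOne s t))) * emeasure (pos_law (LOne s t)) {x. \<bar>fst x\<bar> \<le> 1}) * (dual_vol s * dual_vol t)"
    by (simp only: 1 mult_ac)
  also have "\<dots> = ennreal (fact (hdim s)) * emeasure (pos_law s) {x. \<bar>fst x\<bar> \<le> 1} * (ennreal (fact (hdim t)) * emeasure (pos_law t) {x. \<bar>fst x\<bar> \<le> 1}) * (dual_vol s * dual_vol t)"
    using 2 unfolding pos_law_exp1 by simp
  also have "\<dots> = ennreal (4 ^ hdim s) * ennreal (4 ^ hdim t)"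
  proof -
    have "a * b * (c * d) * (e * f) = (b * (a * e)) * (d * (c * f))" for a b c d e f :: ennreal
      by (simp only: mult_ac)
    then show ?thesis using LOne unfolding grad_law_exp1 by simp
  qed
  finally show ?case unfolding grad_law_exp1 by (simp add: power_add ennreal_mult)
qed

section \<open>The law of the slope over the dual unit ball\<close>

lemma dual_vol_finite: "dual_vol t < \<infinity>"
  using strip_finite_grad_law by (simp add: dual_vol_def strip_finite_def)

lemma dual_vol_nonzero: "dual_vol t \<noteq> 0"
  using volume_product[of t] unfolding grad_law_exp1 by auto

text \<open>The law of the velocity: the slope at a uniformly distributed point of the polar body.
  Because slopes are homogeneous of degree 0, a density proportional to \<open>exp (- M)\<close>
  yields the same law, which is what makes sums of norms tractable.\<close>

definition slope_law :: "real htree \<Rightarrow> real measure" where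
  "slope_law t = distr (density (grad_law t) (\<lambda>x. indicator {x. \<bar>fst x\<bar> \<le> 1} x / dual_vol t)) borel snd"

lemma sets_slope_law [measurable_cong, simp]: "sets (slope_law t) = sets borel"
  by (simp add: slope_law_def)

lemma space_slope_law [simp]: "space (slope_law t) = UNIV"
  by (simp add: slope_law_def)

lemma slope_law_integral:
  assumes [measurable]: "f \<in> borel_measurable borel"
  shows "dual_vol t * (\<integral>\<^sup>+w. f w \<partial>slope_law t) = (\<integral>\<^sup>+x. f (snd x) * indicator {x. \<bar>fst x\<bar> \<le> 1} x \<partial>grad_law t)"
proof -
  have [measurable_cong]: "sets (grad_law t) = sets borel" by (rule strip_finite_sets[OF strip_finite_grad_law])
  have [measurable]: "snd \<in> borel_measurable (density (grad_law t) g)" for g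
    unfolding measurable_density_eq1 by measurable
  have "(\<integral>\<^sup>+w. f w \<partial>slope_law t) = (\<integral>\<^sup>+x. f (snd x) * indicator {x. \<bar>fst x\<bar> \<le> 1} x / dual_vol t \<partial>grad_law t)"
    unfolding slope_law_def
    by (subst nn_integral_distr, measurable, subst nn_integral_density)
       (auto intro!: nn_integral_cong simp: ennreal_times_divide mult.commute)
  also have "\<dots> = (\<integral>\<^sup>+x. f (snd x) * indicator {x. \<bar>fst x\<bar> \<le> 1} x \<partial>grad_law t) / dual_vol t"
    by (rule nn_integral_divide) measurable
  finally show ?thesis
    using dual_vol_finite[of t] dual_vol_nonzero[of t]
    by (simp add: ennreal_times_divide ennreal_mult_divide_eq mult.commute[of "dual_vol t"])
qed

lemma ennreal_cancel_left: "a * b = a * c \<Longrightarrow> a \<noteq> 0 \<Longrightarrow> a < \<infinity> \<Longrightarrow> b = (c::ennreal)"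
  by (auto simp: ennreal_mult_cancel_left)

lemma prob_space_slope_law: "prob_space (slope_law t)"
proof
  have "dual_vol t * (\<integral>\<^sup>+w. 1 \<partial>slope_law t) = dual_vol t * 1"
    by (subst slope_law_integral) (simp_all add: dual_vol_def strip_finite_sets[OF strip_finite_grad_law])
  then show "emeasure (slope_law t) (space (slope_law t)) = 1"
    using ennreal_cancel_left[OF _ dual_vol_nonzero dual_vol_finite] by simp
qed

lemma sigma_finite_slope_law: "sigma_finite_measure (slope_law t)"
  using prob_space_slope_law prob_space_imp_sigma_finite by blast

text \<open>The dual norm of a segment has slope \<open>a\<close> on one half of its unit ball and
  \<open>- a\<close> on the other. The factor 2 avoids a division in \<open>ennreal\<close>.\<close>

lemma slope_law_Seg:
  assumes [measurable]: "f \<in> borel_measurable borel"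
  shows "2 * (\<integral>\<^sup>+w. f w \<partial>slope_law (Seg a)) = f a + f (- a)"
proof -
  have g: "dual_vol (Seg a) = 2" by (simp add: dual_vol_def emeasure_distr vimage_def abs_le_Icc)
  have "dual_vol (Seg a) * (\<integral>\<^sup>+w. f w \<partial>slope_law (Seg a)) = (\<integral>\<^sup>+t. f (sgn t * a) * indicator {x. \<bar>fst x\<bar> \<le> 1} (\<bar>t\<bar>, sgn t * a) \<partial>lborel)"
    unfolding slope_law_integral[OF assms] grad_law.simps by (subst nn_integral_distr) auto
  \<comment> \<open>Because \<open>sgn 0 = 0\<close>, and because both closed intervals contain 0,
    the integrands may differ at that single point.\<close>
  also have "\<dots> = (\<integral>\<^sup>+t. f a * indicator {0..1} t + f (- a) * indicator {-1..0::real} t \<partial>lborel)"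
  proof (rule nn_integral_cong_AE, rule eventually_mono[OF AE_lborel_singleton[of "0::real"]])
    fix t :: real assume "t \<noteq> 0"
    then show "f (sgn t * a) * indicator {x::real\<times>real. \<bar>fst x\<bar> \<le> 1} (\<bar>t\<bar>, sgn t * a)
      = f a * indicator {0..1} t + f (- a) * indicator {-1..0::real} t"
      by (auto split: split_indicator simp: sgn_if)
  qed
  also have "\<dots> = f a + f (- a)" by (subst nn_integral_add) (auto simp: nn_integral_cmult)
  finally show ?thesis by (simp add: g)
qed

text \<open>The dual norm is a sum here, so under the density \<open>exp (- M)\<close> the two
  factors are independent and their slopes add: a convolution.\<close>

lemma slope_law_LInf:
  assumes [measurable]: "f \<in> borel_measurable borel"
  shows "(\<integral>\<^sup>+w. f w \<partial>slope_law (LInf s t)) = (\<integral>\<^sup>+v. \<integral>\<^sup>+w. f (v + w) \<partial>slope_law t \<partial>slope_law s)"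
proof -
  have *: "ennreal (fact (hdim (LInf s t))) * dual_vol (LInf s t) * (\<integral>\<^sup>+w. f w \<partial>slope_law (LInf s t))
    = (ennreal (fact (hdim s)) * dual_vol s) * (ennreal (fact (hdim t)) * dual_vol t) * (\<integral>\<^sup>+v. \<integral>\<^sup>+w. f (v + w) \<partial>slope_law t \<partial>slope_law s)"
    if [measurable]: "f \<in> borel_measurable borel" for f
  proof -
    interpret S: sigma_finite_measure "slope_law t" by (rule sigma_finite_slope_law)
    have exp_slope: "(\<integral>\<^sup>+x. g (snd x) * ennreal (exp (- \<bar>fst x\<bar>)) \<partial>grad_law t) = ennreal (fact (hdim t)) * dual_vol t * (\<integral>\<^sup>+w. g w \<partial>slope_law t)"
      if "g \<in> borel_measurable borel" for g t
      unfolding grad_law_exp[OF that] slope_law_integral[OF that, symmetric] by (simp only: mult.assoc)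
    have "ennreal (fact (hdim (LInf s t))) * dual_vol (LInf s t) * (\<integral>\<^sup>+w. f w \<partial>slope_law (LInf s t))
       = (\<integral>\<^sup>+x. f (snd x) * ennreal (exp (- \<bar>fst x\<bar>)) \<partial>push_pair sum_pair (grad_law s) (grad_law t))"
      using exp_slope[of f "LInf s t"] by (simp only: grad_law.simps assms that)
    also have "\<dots> = (\<integral>\<^sup>+x. \<integral>\<^sup>+y. ennreal (exp (- \<bar>fst x\<bar>)) * (f (snd x + snd y) * ennreal (exp (- \<bar>fst y\<bar>))) \<partial>grad_law t \<partial>grad_law s)"
      by (subst nn_integral_push_pair[OF strip_finite_grad_law strip_finite_grad_law sum_pair_measurable])
         (auto simp: exp_sum_pair snd_sum_pair mult_ac intro!: nn_integral_cong)
    also have "\<dots> = (\<integral>\<^sup>+x. ennreal (exp (- \<bar>fst x\<bar>)) * (ennreal (fact (hdim t)) * dual_vol t * (\<integral>\<^sup>+w. f (snd x + w) \<partial>slope_law t)) \<partial>grad_law s)"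
    proof (rule nn_integral_cong)
      fix x :: "real \<times> real"
      have "(\<integral>\<^sup>+y. ennreal (exp (- \<bar>fst x\<bar>)) * (f (snd x + snd y) * ennreal (exp (- \<bar>fst y\<bar>))) \<partial>grad_law t)
        = ennreal (exp (- \<bar>fst x\<bar>)) * (\<integral>\<^sup>+y. (f (snd x + snd y) * ennreal (exp (- \<bar>fst y\<bar>))) \<partial>grad_law t)"
        by (rule nn_integral_cmult) (simp add: strip_finite_measurable[OF strip_finite_grad_law])
      also have "\<dots> = ennreal (exp (- \<bar>fst x\<bar>)) * (ennreal (fact (hdim t)) * dual_vol t * (\<integral>\<^sup>+w. f (snd x + w) \<partial>slope_law t))"
        using exp_slope[of "\<lambda>w. f (snd x + w)" t] by simp
      finally show "(\<integral>\<^sup>+y. ennreal (exp (- \<bar>fst x\<bar>)) * (f (snd x + snd y) * ennreal (exp (- \<bar>fst y\<bar>))) \<partial>grad_law t) = \<dots>" .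
    qed
    also have "\<dots> = (\<integral>\<^sup>+x. (ennreal (fact (hdim t)) * dual_vol t * (\<integral>\<^sup>+w. f (snd x + w) \<partial>slope_law t)) * ennreal (exp (- \<bar>fst x\<bar>)) \<partial>grad_law s)"
      by (simp add: mult.commute)
    also have "\<dots> = ennreal (fact (hdim s)) * dual_vol s * (\<integral>\<^sup>+v. ennreal (fact (hdim t)) * dual_vol t * (\<integral>\<^sup>+w. f (v + w) \<partial>slope_law t) \<partial>slope_law s)"
      by (rule exp_slope) measurable
    also have "\<dots> = ennreal (fact (hdim s)) * dual_vol s * (ennreal (fact (hdim t)) * dual_vol t * (\<integral>\<^sup>+v. \<integral>\<^sup>+w. f (v + w) \<partial>slope_law t \<partial>slope_law s))"
      by (subst nn_integral_cmult) measurable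
    finally show ?thesis by (simp add: mult.assoc)
  qed
  interpret s: prob_space "slope_law s" by (rule prob_space_slope_law)
  interpret t: prob_space "slope_law t" by (rule prob_space_slope_law)
  interpret l: prob_space "slope_law (LInf s t)" by (rule prob_space_slope_law)
  \<comment> \<open>The normalising constants of the two sides are compared by inserting the
    constant function 1.\<close>
  have 1: "ennreal (fact (hdim (LInf s t))) * dual_vol (LInf s t) = (ennreal (fact (hdim s)) * dual_vol s) * (ennreal (fact (hdim t)) * dual_vol t)"
    using *[of "\<lambda>_. 1"] s.emeasure_space_1 t.emeasure_space_1 l.emeasure_space_1 by simp
  have 2: "(ennreal (fact (hdim s)) * dual_vol s) * (ennreal (fact (hdim t)) * dual_vol t) \<noteq> 0"
    using dual_vol_nonzero[of s] dual_vol_nonzero[of t] by simp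
  have 3: "(ennreal (fact (hdim s)) * dual_vol s) * (ennreal (fact (hdim t)) * dual_vol t) < \<infinity>"
    using dual_vol_finite[of s] dual_vol_finite[of t] by (simp add: ennreal_mult_less_top)
  show ?thesis
    by (rule ennreal_cancel_left[OF _ 2 3]) (rule *[OF assms, unfolded 1])
qed

text \<open>Within the unit ball norm and slope are independent, and the norm has density
  \<open>n * r ^ (n - 1)\<close> for \<open>n = hdim t\<close>; its moment of order \<open>k\<close>
  is \<open>n / (n + k)\<close>.\<close>

lemma grad_law_radial:
  assumes [measurable]: "B \<in> sets borel" and k: "k > 0"
  shows "ennreal (real (hdim t + k)) * (\<integral>\<^sup>+x. indicator B (snd x) * ennreal (\<bar>fst x\<bar> ^ k) * indicator {x. \<bar>fst x\<bar> \<le> 1} x \<partial>grad_law t)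
    = ennreal (real (hdim t)) * (\<integral>\<^sup>+x. indicator B (snd x) * indicator {x. \<bar>fst x\<bar> \<le> 1} x \<partial>grad_law t)"
    (is "_ * ?X = _ * ?a")
proof -
  let ?n = "hdim t"
  let ?A = "grad_law t"
  have [measurable_cong]: "sets ?A = sets borel" by (rule strip_finite_sets[OF strip_finite_grad_law])
  let ?S = "{p :: (real \<times> real) \<times> real. \<bar>fst (fst p)\<bar> \<le> snd p \<and> snd p \<le> 1}"
  have m: "?S \<in> sets borel"
    by (intro borel_closed closed_Collect_conj closed_Collect_le continuous_intros)
  \<comment> \<open>Splitting 1 in this way expresses the defect of the moment through strips of
    radius \<open>r\<close>, whose masses are known by scaling, so that no disintegration along the
    norm is required.\<close>
  have one: "1 = ennreal (s ^ k) + (\<integral>\<^sup>+r. ennreal (real k * r ^ (k - 1)) * indicator {s..1} r \<partial>lborel)"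
    if "0 \<le> s" "s \<le> 1" for s :: real
  proof -
    have "(\<integral>\<^sup>+r. ennreal (real k * r ^ (k - 1)) * indicator {s..1} r \<partial>lborel) = 1 ^ k - s ^ k"
      by (rule nn_integral_FTC_Icc) (use that in \<open>auto intro!: derivative_eq_intros\<close>)
    then show ?thesis using that by (simp add: power_le_one flip: ennreal_plus)
  qed
  have "?a = (\<integral>\<^sup>+x. indicator B (snd x) * ennreal (\<bar>fst x\<bar> ^ k) * indicator {x. \<bar>fst x\<bar> \<le> 1} x
      + (\<integral>\<^sup>+r. indicator B (snd x) * (ennreal (real k * r ^ (k - 1)) * indicator ?S (x, r)) \<partial>lborel) \<partial>?A)"
  proof (rule nn_integral_cong)
    fix x :: "real \<times> real"
    have i: "indicator ?S (x, r) = indicator {\<bar>fst x\<bar>..1} r" for r by (simp add: indicator_def)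
    have "(\<integral>\<^sup>+r. indicator B (snd x) * (ennreal (real k * r ^ (k - 1)) * indicator ?S (x, r)) \<partial>lborel)
      = indicator B (snd x) * (\<integral>\<^sup>+r. ennreal (real k * r ^ (k - 1)) * indicator {\<bar>fst x\<bar>..1} r \<partial>lborel)"
      unfolding i by (rule nn_integral_cmult) measurable
    moreover have "indicator B (snd x) * indicator {x. \<bar>fst x\<bar> \<le> 1} x
      = indicator B (snd x) * ennreal (\<bar>fst x\<bar> ^ k) * indicator {x. \<bar>fst x\<bar> \<le> 1} x
      + indicator B (snd x) * (\<integral>\<^sup>+r. ennreal (real k * r ^ (k - 1)) * indicator {\<bar>fst x\<bar>..1} r \<partial>lborel)"
    proof (cases "\<bar>fst x\<bar> \<le> 1")
      case True
      have "indicator B (snd x) * (1::ennreal) = indicator B (snd x) *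
        (ennreal (\<bar>fst x\<bar> ^ k) + (\<integral>\<^sup>+r. ennreal (real k * r ^ (k - 1)) * indicator {\<bar>fst x\<bar>..1} r \<partial>lborel))"
        by (rule arg_cong[OF one]) (use True in auto)
      then show ?thesis using True by (simp add: distrib_left)
    qed simp
    ultimately show "indicator B (snd x) * indicator {x. \<bar>fst x\<bar> \<le> 1} x
      = indicator B (snd x) * ennreal (\<bar>fst x\<bar> ^ k) * indicator {x. \<bar>fst x\<bar> \<le> 1} x
      + (\<integral>\<^sup>+r. indicator B (snd x) * (ennreal (real k * r ^ (k - 1)) * indicator ?S (x, r)) \<partial>lborel)"
      by (simp only:)
  qed
  also have "\<dots> = ?X + (\<integral>\<^sup>+x. \<integral>\<^sup>+r. indicator B (snd x) * (ennreal (real k * r ^ (k - 1)) * indicator ?S (x, r)) \<partial>lborel \<partial>?A)"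
    using m by (intro nn_integral_add) measurable
  also have "(\<integral>\<^sup>+x. \<integral>\<^sup>+r. indicator B (snd x) * (ennreal (real k * r ^ (k - 1)) * indicator ?S (x, r)) \<partial>lborel \<partial>?A)
     = (\<integral>\<^sup>+r. \<integral>\<^sup>+x. indicator B (snd x) * (ennreal (real k * r ^ (k - 1)) * indicator ?S (x, r)) \<partial>?A \<partial>lborel)"
    using m by (intro nn_integral_Tonelli strip_finite_sigma strip_finite_grad_law sigma_finite_lborel) measurable
  also have "\<dots> = (\<integral>\<^sup>+r. ennreal (real k * r ^ (k - 1 + ?n)) * indicator {0..1} r * ?a \<partial>lborel)"
  proof (rule nn_integral_cong_AE, rule eventually_mono[OF AE_lborel_singleton[of "0::real"]])
    fix r :: real assume r: "r \<noteq> 0"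
    have "(\<integral>\<^sup>+x. indicator B (snd x) * (ennreal (real k * r ^ (k - 1)) * indicator ?S (x, r)) \<partial>?A)
      = (\<integral>\<^sup>+x. ennreal (real k * r ^ (k - 1)) * indicator {..1} r * (indicator B (snd x) * indicator {x. \<bar>fst x\<bar> \<le> r} x) \<partial>?A)"
      by (intro nn_integral_cong) (auto simp: indicator_def)
    also have "\<dots> = ennreal (real k * r ^ (k - 1)) * indicator {..1} r * (\<integral>\<^sup>+x. indicator B (snd x) * indicator {x. \<bar>fst x\<bar> \<le> r} x \<partial>?A)"
      by (rule nn_integral_cmult) measurable
    also have "\<dots> = ennreal (real k * r ^ (k - 1 + ?n)) * indicator {0..1} r * ?a"
    proof (cases "r > 0")
      case True
      then show ?thesis
        by (subst grad_law_layer[OF _ True]) (auto simp: power_add ennreal_mult' mult_ac split: split_indicator)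
    next
      case False
      then have "{x::real\<times>real. \<bar>fst x\<bar> \<le> r} = {}" using r by auto
      then show ?thesis using False r by simp
    qed
    finally show "(\<integral>\<^sup>+x. indicator B (snd x) * (ennreal (real k * r ^ (k - 1)) * indicator ?S (x, r)) \<partial>?A) = \<dots>" .
  qed
  also have "\<dots> = (\<integral>\<^sup>+r. ennreal (real k * r ^ (k - 1 + ?n)) * indicator {0..1} r \<partial>lborel) * ?a"
    by (rule nn_integral_multc) measurable
  also have "(\<integral>\<^sup>+r. ennreal (real k * r ^ (k - 1 + ?n)) * indicator {0..1} r \<partial>lborel) = real k / real (?n + k)"
  proof -
    have "(\<integral>\<^sup>+r. ennreal (real k * r ^ (k - 1 + ?n)) * indicator {0..1} r \<partial>lborel)
      = real k / real (?n + k) * 1 ^ (?n + k) - real k / real (?n + k) * 0 ^ (?n + k)"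
    proof (rule nn_integral_FTC_Icc)
      fix x :: real
      have e: "k - 1 + ?n = ?n + k - 1" using k by simp
      show "((\<lambda>r. real k / real (?n + k) * r ^ (?n + k)) has_real_derivative real k * x ^ (k - 1 + ?n)) (at x)"
        unfolding e using k by (auto intro!: derivative_eq_intros)
    qed auto
    then show ?thesis using k by (simp add: power_0_left)
  qed
  finally have eq: "?a = ?X + ennreal (real k / real (?n + k)) * ?a" .
  \<comment> \<open>The identity \<open>eq\<close> has to be solved for the moment. Subtraction
    requires real numbers, hence the finiteness of all terms.\<close>
  have "?a \<le> (\<integral>\<^sup>+x. indicator {x. \<bar>fst x\<bar> \<le> 1} x \<partial>?A)"
    by (intro nn_integral_mono) (auto split: split_indicator)
  also have "\<dots> = dual_vol t" by (simp add: dual_vol_def strip_finite_sets[OF strip_finite_grad_law])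
  finally have "?a < \<infinity>" using dual_vol_finite le_less_trans by blast
  then obtain a where a: "?a = ennreal a" "a \<ge> 0" by (cases ?a) auto
  have "?X \<le> ?a" by (rule order_trans[OF _ eq_refl[OF eq[symmetric]]]) simp
  then obtain X where X: "?X = ennreal X" "X \<ge> 0" using \<open>?a < \<infinity>\<close>
    by (cases ?X) (auto simp: top_unique)
  have "ennreal a = ennreal (X + real k / real (?n + k) * a)"
    using eq unfolding a(1) X(1) using a X by (simp flip: ennreal_mult ennreal_plus)
  then have "a = X + real k / real (?n + k) * a" using a X by (subst (asm) ennreal_inj) auto
  then have "real (?n + k) * X = real ?n * a" using k by (simp add: field_simps)
  then have "ennreal (real (?n + k)) * ennreal X = ennreal (real ?n) * ennreal a"
    using a(2) X(2) by (simp only: ennreal_mult[symmetric] of_nat_0_le_iff)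
  then show ?thesis unfolding a(1) X(1) .
qed

lemma grad_law_radial_slope_law:
  assumes f[measurable]: "f \<in> borel_measurable borel" and k: "k > 0"
  shows "ennreal (real (hdim t + k)) * (\<integral>\<^sup>+x. f (snd x) * ennreal (\<bar>fst x\<bar> ^ k) * indicator {x. \<bar>fst x\<bar> \<le> 1} x \<partial>grad_law t)
    = ennreal (real (hdim t)) * dual_vol t * (\<integral>\<^sup>+w. f w \<partial>slope_law t)"
proof -
  let ?c = "ennreal (real (hdim t + k))"
  let ?d = "\<lambda>x. ?c * (ennreal (\<bar>fst x\<bar> ^ k) * indicator {x. \<bar>fst x\<bar> \<le> 1} x)"
  define M1 where "M1 = distr (density (grad_law t) ?d) borel snd"
  have [measurable_cong]: "sets (grad_law t) = sets borel" by (rule strip_finite_sets[OF strip_finite_grad_law])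
  have s: "snd \<in> borel_measurable (density (grad_law t) ?d)"
    unfolding measurable_density_eq1 by measurable
  have M1: "(\<integral>\<^sup>+w. g w \<partial>M1) = ?c * (\<integral>\<^sup>+x. g (snd x) * ennreal (\<bar>fst x\<bar> ^ k) * indicator {x. \<bar>fst x\<bar> \<le> 1} x \<partial>grad_law t)"
    if [measurable]: "g \<in> borel_measurable borel" for g
  proof -
    have "(\<integral>\<^sup>+w. g w \<partial>M1) = (\<integral>\<^sup>+x. ?c * (g (snd x) * ennreal (\<bar>fst x\<bar> ^ k) * indicator {x. \<bar>fst x\<bar> \<le> 1} x) \<partial>grad_law t)"
      unfolding M1_def nn_integral_distr[OF s that[folded measurable_distr_eq1[of "density (grad_law t) ?d" borel snd]]]
      by (subst nn_integral_density) (auto simp: mult_ac intro!: nn_integral_cong)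
    then show ?thesis by (simp add: nn_integral_cmult)
  qed
  have eq: "M1 = scale_measure (ennreal (real (hdim t)) * dual_vol t) (slope_law t)"
  proof (rule measure_eqI)
    show "sets M1 = sets (scale_measure (ennreal (real (hdim t)) * dual_vol t) (slope_law t))"
      by (simp add: M1_def)
    fix B assume "B \<in> sets M1"
    then have [measurable]: "B \<in> sets borel" by (simp add: M1_def)
    have "emeasure M1 B = (\<integral>\<^sup>+w. indicator B w \<partial>M1)" by (simp add: M1_def)
    also have "\<dots> = ennreal (real (hdim t)) * (\<integral>\<^sup>+x. indicator B (snd x) * indicator {x. \<bar>fst x\<bar> \<le> 1} x \<partial>grad_law t)"
      by (simp only: M1[OF borel_measurable_indicator[OF \<open>B \<in> sets borel\<close>]] grad_law_radial[OF \<open>B \<in> sets borel\<close> k])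
    also have "\<dots> = ennreal (real (hdim t)) * (dual_vol t * (\<integral>\<^sup>+w. indicator B w \<partial>slope_law t))"
      by (subst slope_law_integral) auto
    finally show "emeasure M1 B = emeasure (scale_measure (ennreal (real (hdim t)) * dual_vol t) (slope_law t)) B"
      by (simp add: mult.assoc)
  qed
  show ?thesis
    using M1[OF f] unfolding eq by (simp add: nn_integral_scale_measure)
qed

lemma emeasure_grad_law_strip:
  assumes "r \<ge> 0" shows "emeasure (grad_law t) {x. \<bar>fst x\<bar> \<le> r} = ennreal (r ^ hdim t) * dual_vol t"
proof (cases "r = 0")
  case True
  have "{x::real\<times>real. \<bar>fst x\<bar> \<le> 0} = {x. \<not> \<bar>fst x\<bar> \<noteq> 0}" by auto
  moreover have "emeasure (grad_law t) {x. \<not> \<bar>fst x\<bar> \<noteq> 0} = 0"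
    using grad_law_null[where t=t and s=0] AE_iff_measurable[of "{x. \<not> \<bar>fst x\<bar> \<noteq> 0}" "grad_law t" "\<lambda>x. \<bar>fst x\<bar> \<noteq> 0"]
      strip_sets[of 0]
    by (simp add: strip_finite_sets[OF strip_finite_grad_law] sets_eq_imp_space_eq[OF strip_finite_sets[OF strip_finite_grad_law]])
  ultimately show ?thesis using True hdim_pos[of t] by (simp add: power_0_left)
next
  case False
  then have r: "r > 0" using assms by simp
  show ?thesis using grad_law_layer[OF _ r, of "\<lambda>_. 1" t]
    by (simp add: dual_vol_def strip_finite_sets[OF strip_finite_grad_law])
qed

text \<open>The dual norm is a maximum, and the slope is that of the factor with the larger norm. If
  the first norm is \<open>\<rho>\<close>, the second point lies in the ball of radius
  \<open>\<rho>\<close>, a share \<open>\<rho> ^ hdim t\<close> of the unit ball. By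
  \<open>grad_law_radial\<close> this share has mean \<open>hdim s / (hdim s + hdim t)\<close>
  independently of the slope, so the law is a mixture weighted by dimension.\<close>

lemma slope_law_LOne:
  assumes [measurable]: "f \<in> borel_measurable borel"
  shows "ennreal (real (hdim s + hdim t)) * (\<integral>\<^sup>+w. f w \<partial>slope_law (LOne s t))
    = ennreal (real (hdim s)) * (\<integral>\<^sup>+w. f w \<partial>slope_law s) + ennreal (real (hdim t)) * (\<integral>\<^sup>+w. f w \<partial>slope_law t)"
proof -
  have *: "dual_vol (LOne s t) * (ennreal (real (hdim s + hdim t)) * (\<integral>\<^sup>+w. f w \<partial>slope_law (LOne s t)))
    = dual_vol s * dual_vol t * (ennreal (real (hdim s)) * (\<integral>\<^sup>+w. f w \<partial>slope_law s) + ennreal (real (hdim t)) * (\<integral>\<^sup>+w. f w \<partial>slope_law t))"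
    if f[measurable]: "f \<in> borel_measurable borel" for f
  proof -
    have [measurable_cong]: "sets (grad_law t) = sets borel" for t by (rule strip_finite_sets[OF strip_finite_grad_law])
    let ?I = "indicator {x::real\<times>real. \<bar>fst x\<bar> \<le> 1} :: _ \<Rightarrow> ennreal"
    let ?L = "indicator {p::(real\<times>real)\<times>(real\<times>real). \<bar>fst (snd p)\<bar> \<le> \<bar>fst (fst p)\<bar>} :: _ \<Rightarrow> ennreal"
    let ?S = "indicator {p::(real\<times>real)\<times>(real\<times>real). \<bar>fst (fst p)\<bar> < \<bar>fst (snd p)\<bar>} :: _ \<Rightarrow> ennreal"
    have "{p::(real\<times>real)\<times>(real\<times>real). \<bar>fst (snd p)\<bar> \<le> \<bar>fst (fst p)\<bar>} \<in> sets borel"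
      by (intro borel_closed closed_Collect_le continuous_intros)
    then have [measurable]: "?L \<in> borel_measurable borel" by simp
    have "{p::(real\<times>real)\<times>(real\<times>real). \<bar>fst (fst p)\<bar> < \<bar>fst (snd p)\<bar>} \<in> sets borel"
      by (intro borel_open open_Collect_less continuous_intros)
    then have [measurable]: "?S \<in> borel_measurable borel" by simp
    interpret t: sigma_finite_measure "grad_law t" by (rule strip_finite_sigma[OF strip_finite_grad_law])
    have "dual_vol (LOne s t) * (\<integral>\<^sup>+w. f w \<partial>slope_law (LOne s t)) = (\<integral>\<^sup>+x. f (snd x) * ?I x \<partial>push_pair sel_pair (grad_law s) (grad_law t))"
      by (simp add: slope_law_integral)
    also have "\<dots> = (\<integral>\<^sup>+x. \<integral>\<^sup>+y. f (snd (sel_pair x y)) * ?I (sel_pair x y) \<partial>grad_law t \<partial>grad_law s)"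
      by (rule nn_integral_push_pair[OF strip_finite_grad_law strip_finite_grad_law sel_pair_measurable]) simp
    also have "\<dots> = (\<integral>\<^sup>+x. \<integral>\<^sup>+y. f (snd x) * ?I x * ?L (x, y) + f (snd y) * ?I y * ?S (x, y) \<partial>grad_law t \<partial>grad_law s)"
      by (intro nn_integral_cong) (auto simp: sel_pair_def indicator_def)
    also have "\<dots> = (\<integral>\<^sup>+x. (\<integral>\<^sup>+y. f (snd x) * ?I x * ?L (x, y) \<partial>grad_law t) + (\<integral>\<^sup>+y. f (snd y) * ?I y * ?S (x, y) \<partial>grad_law t) \<partial>grad_law s)"
      by (intro nn_integral_cong nn_integral_add) measurable
    also have "\<dots> = (\<integral>\<^sup>+x. \<integral>\<^sup>+y. f (snd x) * ?I x * ?L (x, y) \<partial>grad_law t \<partial>grad_law s) + (\<integral>\<^sup>+x. \<integral>\<^sup>+y. f (snd y) * ?I y * ?S (x, y) \<partial>grad_law t \<partial>grad_law s)"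
      by (intro nn_integral_add) measurable
    also have "(\<integral>\<^sup>+x. \<integral>\<^sup>+y. f (snd x) * ?I x * ?L (x, y) \<partial>grad_law t \<partial>grad_law s) = dual_vol t * (\<integral>\<^sup>+x. f (snd x) * ennreal (\<bar>fst x\<bar> ^ hdim t) * ?I x \<partial>grad_law s)"
    proof -
      have "(\<integral>\<^sup>+y. f (snd x) * ?I x * ?L (x, y) \<partial>grad_law t) = dual_vol t * (f (snd x) * ennreal (\<bar>fst x\<bar> ^ hdim t) * ?I x)" for x
      proof -
        have "(\<integral>\<^sup>+y. f (snd x) * ?I x * ?L (x, y) \<partial>grad_law t) = (\<integral>\<^sup>+y. f (snd x) * ?I x * indicator {y. \<bar>fst y\<bar> \<le> \<bar>fst x\<bar>} y \<partial>grad_law t)"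
          by (simp add: indicator_def)
        also have "\<dots> = f (snd x) * ?I x * emeasure (grad_law t) {y. \<bar>fst y\<bar> \<le> \<bar>fst x\<bar>}"
          by (rule nn_integral_cmult_indicator) measurable
        finally show ?thesis by (simp add: emeasure_grad_law_strip mult_ac)
      qed
      then show ?thesis by (simp add: nn_integral_cmult)
    qed
    also have "(\<integral>\<^sup>+x. \<integral>\<^sup>+y. f (snd y) * ?I y * ?S (x, y) \<partial>grad_law t \<partial>grad_law s) = dual_vol s * (\<integral>\<^sup>+x. f (snd x) * ennreal (\<bar>fst x\<bar> ^ hdim s) * ?I x \<partial>grad_law t)"
    proof -
      have "(\<integral>\<^sup>+x. \<integral>\<^sup>+y. f (snd y) * ?I y * ?S (x, y) \<partial>grad_law t \<partial>grad_law s) = (\<integral>\<^sup>+y. \<integral>\<^sup>+x. f (snd y) * ?I y * ?S (x, y) \<partial>grad_law s \<partial>grad_law t)"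
        by (intro nn_integral_Tonelli strip_finite_sigma strip_finite_grad_law) measurable
      moreover have "(\<integral>\<^sup>+x. f (snd y) * ?I y * ?S (x, y) \<partial>grad_law s) = dual_vol s * (f (snd y) * ennreal (\<bar>fst y\<bar> ^ hdim s) * ?I y)" for y
      proof -
        have "(\<integral>\<^sup>+x. f (snd y) * ?I y * ?S (x, y) \<partial>grad_law s) = (\<integral>\<^sup>+x. f (snd y) * ?I y * indicator {x. \<bar>fst x\<bar> \<le> \<bar>fst y\<bar>} x \<partial>grad_law s)"
          by (intro nn_integral_cong_AE eventually_mono[OF grad_law_null[where t=s and s="\<bar>fst y\<bar>"]]) (auto simp: indicator_def)
        also have "\<dots> = f (snd y) * ?I y * emeasure (grad_law s) {x. \<bar>fst x\<bar> \<le> \<bar>fst y\<bar>}"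
          by (rule nn_integral_cmult_indicator) measurable
        finally show ?thesis by (simp add: emeasure_grad_law_strip mult_ac)
      qed
      ultimately show ?thesis by (simp add: nn_integral_cmult)
    qed
    finally have E: "dual_vol (LOne s t) * (\<integral>\<^sup>+w. f w \<partial>slope_law (LOne s t)) = dual_vol t * (\<integral>\<^sup>+x. f (snd x) * ennreal (\<bar>fst x\<bar> ^ hdim t) * ?I x \<partial>grad_law s)
      + dual_vol s * (\<integral>\<^sup>+x. f (snd x) * ennreal (\<bar>fst x\<bar> ^ hdim s) * ?I x \<partial>grad_law t)" .
    have alg: "g * (c * I) = g1 * (c * P) + g2 * (c * Q)" if "g * I = g1 * P + g2 * Q" for g c I g1 P g2 Q :: ennreal
      using arg_cong[OF that, of "\<lambda>x. c * x"] by (simp only: distrib_left mult.left_commute)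
    have "dual_vol (LOne s t) * (ennreal (real (hdim s + hdim t)) * (\<integral>\<^sup>+w. f w \<partial>slope_law (LOne s t)))
      = dual_vol t * (ennreal (real (hdim s + hdim t)) * (\<integral>\<^sup>+x. f (snd x) * ennreal (\<bar>fst x\<bar> ^ hdim t) * ?I x \<partial>grad_law s))
      + dual_vol s * (ennreal (real (hdim t + hdim s)) * (\<integral>\<^sup>+x. f (snd x) * ennreal (\<bar>fst x\<bar> ^ hdim s) * ?I x \<partial>grad_law t))"
      unfolding add.commute[of "hdim t" "hdim s"] by (rule alg[OF E])
    also have "\<dots> = dual_vol t * (ennreal (real (hdim s)) * dual_vol s * (\<integral>\<^sup>+w. f w \<partial>slope_law s)) + dual_vol s * (ennreal (real (hdim t)) * dual_vol t * (\<integral>\<^sup>+w. f w \<partial>slope_law t))"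
      by (simp only: grad_law_radial_slope_law[OF f hdim_pos])
    finally show ?thesis by (simp only: distrib_left mult_ac)
  qed
  interpret s: prob_space "slope_law s" by (rule prob_space_slope_law)
  interpret t: prob_space "slope_law t" by (rule prob_space_slope_law)
  interpret l: prob_space "slope_law (LOne s t)" by (rule prob_space_slope_law)
  \<comment> \<open>The function 1 in the identity above shows that \<open>dual_vol\<close> is
    multiplicative, which supplies the common factor to cancel.\<close>
  have "dual_vol (LOne s t) * (ennreal (real (hdim s + hdim t)) * 1) = dual_vol s * dual_vol t * (ennreal (real (hdim s)) * 1 + ennreal (real (hdim t)) * 1)"
    using *[of "\<lambda>_. 1"] s.emeasure_space_1 t.emeasure_space_1 l.emeasure_space_1 by simp
  then have "ennreal (real (hdim s + hdim t)) * dual_vol (LOne s t) = ennreal (real (hdim s + hdim t)) * (dual_vol s * dual_vol t)"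
    by (simp add: mult.commute)
  then have 1: "dual_vol (LOne s t) = dual_vol s * dual_vol t"
    by (rule ennreal_cancel_left) (use hdim_pos[of s] in auto)
  show ?thesis
  proof (rule ennreal_cancel_left[OF _ dual_vol_nonzero[of "LOne s t"] dual_vol_finite])
    show "dual_vol (LOne s t) * (ennreal (real (hdim s + hdim t)) * (\<integral>\<^sup>+w. f w \<partial>slope_law (LOne s t)))
      = dual_vol (LOne s t) * (ennreal (real (hdim s)) * (\<integral>\<^sup>+w. f w \<partial>slope_law s) + ennreal (real (hdim t)) * (\<integral>\<^sup>+w. f w \<partial>slope_law t))"
      unfolding *[OF assms] unfolding 1 ..
  qed
qed

lemma slope_law_neg:
  assumes [measurable]: "f \<in> borel_measurable borel"
  shows "(\<integral>\<^sup>+w. f (- w) \<partial>slope_law t) = (\<integral>\<^sup>+w. f w \<partial>slope_law t)"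
proof (rule ennreal_cancel_left[OF _ dual_vol_nonzero dual_vol_finite])
  have "(\<integral>\<^sup>+x. f (- snd x) * indicator {x. \<bar>fst x\<bar> \<le> 1} x \<partial>grad_law t) = (\<integral>\<^sup>+x. f (- snd x) * indicator {x. \<bar>fst x\<bar> \<le> 1} (fst x, - snd x) \<partial>grad_law t)"
    by (simp add: indicator_def)
  also have "\<dots> = (\<integral>\<^sup>+x. f (snd x) * indicator {x. \<bar>fst x\<bar> \<le> 1} x \<partial>grad_law t)"
    using quasi_invD[OF grad_law_neg, of "\<lambda>x. f (snd x) * indicator {x. \<bar>fst x\<bar> \<le> 1} x" t] by simp
  finally show "dual_vol t * (\<integral>\<^sup>+w. f (- w) \<partial>slope_law t) = dual_vol t * (\<integral>\<^sup>+w. f w \<partial>slope_law t)"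
    by (simp add: slope_law_integral)
qed

section \<open>Averages along antiperiodic paths\<close>

text \<open>Two readings recur: \<open>win (fst x) r\<close> restricts to points of norm at most
  \<open>r\<close>, and \<open>win (t - r) r\<close> is the indicator of the time interval from 0 to
  \<open>2 * r\<close>.\<close>

definition win :: "real \<Rightarrow> real \<Rightarrow> ennreal" where
  "win s r = (if \<bar>s\<bar> \<le> r then 1 else 0)"

lemma win_measurable [measurable (raw)]:
  assumes [measurable]: "f \<in> borel_measurable M" "g \<in> borel_measurable M"
  shows "(\<lambda>x. win (f x) (g x)) \<in> borel_measurable M"
  unfolding win_def by measurable

lemma nn_integral_shift:
  fixes f :: "real \<Rightarrow> ennreal" assumes [measurable]: "f \<in> borel_measurable borel"
  shows "(\<integral>\<^sup>+t. f (c + t) \<partial>lborel) = (\<integral>\<^sup>+t. f t \<partial>lborel)"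
  using nn_integral_real_affine[of f 1 c] by simp

lemma nn_integral_reflect:
  fixes f :: "real \<Rightarrow> ennreal" assumes [measurable]: "f \<in> borel_measurable borel"
  shows "(\<integral>\<^sup>+t. f (c - t) \<partial>lborel) = (\<integral>\<^sup>+t. f t \<partial>lborel)"
  using nn_integral_real_affine[of f "-1" c] by simp

text \<open>The slope \<open>w\<close> is a derivative in the integral sense only, since
  trajectories have corners; its bound makes it Lebesgue integrable on intervals. The path is
  constrained on the times from 0 to \<open>2 * r\<close> alone, and its antiperiodic continuation
  is made explicit by \<open>ashift\<close>.\<close>

definition apath :: "real \<Rightarrow> (real \<Rightarrow> real) \<Rightarrow> (real \<Rightarrow> real) \<Rightarrow> bool" where
  "apath r Y w \<longleftrightarrow> Y \<in> borel_measurable borel \<and> w \<in> borel_measurable borel \<and> (\<exists>C. \<forall>t. \<bar>w t\<bar> \<le> C)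
     \<and> Y (2 * r) = - Y 0
     \<and> (\<forall>s t. 0 \<le> s \<longrightarrow> s \<le> t \<longrightarrow> t \<le> 2 * r \<longrightarrow> (w has_integral (Y t - Y s)) {s..t})"

lemma apathD:
  assumes "apath r Y w"
  shows "Y \<in> borel_measurable borel" "w \<in> borel_measurable borel" "Y (2 * r) = - Y 0"
    "\<And>s t. 0 \<le> s \<Longrightarrow> s \<le> t \<Longrightarrow> t \<le> 2 * r \<Longrightarrow> (w has_integral (Y t - Y s)) {s..t}"
  using assms by (auto simp: apath_def)

lemma apath_neg:
  assumes "apath r Y w" shows "apath r (\<lambda>t. - Y t) (\<lambda>t. - w t)"
proof -
  have "((\<lambda>t. - w t) has_integral (- Y t - - Y s)) {s..t}" if "0 \<le> s" "s \<le> t" "t \<le> 2 * r" for s t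
    using has_integral_neg[OF apathD(4)[OF assms that]] by simp
  then show ?thesis using assms by (auto simp: apath_def)
qed

lemma apath_add:
  assumes "apath r Y w" "apath r Z v" shows "apath r (\<lambda>t. Y t + Z t) (\<lambda>t. w t + v t)"
proof -
  have "((\<lambda>t. w t + v t) has_integral (Y t + Z t - (Y s + Z s))) {s..t}" if "0 \<le> s" "s \<le> t" "t \<le> 2 * r" for s t
    using has_integral_add[OF apathD(4)[OF assms(1) that] apathD(4)[OF assms(2) that]]
    by (simp add: algebra_simps)
  moreover obtain C D where "\<And>t. \<bar>w t\<bar> \<le> C" "\<And>t. \<bar>v t\<bar> \<le> D"
    using assms unfolding apath_def by blast
  then have "\<bar>w t + v t\<bar> \<le> C + D" for t
    by (meson abs_triangle_ineq add_mono order_trans)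
  ultimately show ?thesis using assms by (auto simp: apath_def)
qed

lemma apath_line: "apath r (\<lambda>t. a * (r - t)) (\<lambda>t. - a)"
proof -
  have "((\<lambda>t. - a) has_integral (a * (r - t) - a * (r - s))) {s..t}" if "s \<le> t" for s t
    using has_integral_const_real[of "- a" s t] that by (simp add: algebra_simps)
  then show ?thesis by (auto simp: apath_def algebra_simps)
qed

lemma apath_rescale:
  assumes p: "apath r Y w" and m: "m > 0"
  shows "apath (r / m) (\<lambda>t. Y (m * t) / m) (\<lambda>t. w (m * t))"
proof -
  have "((\<lambda>t. w (m * t)) has_integral (Y (m * t) / m - Y (m * s) / m)) {s..t}" if "0 \<le> s" "s \<le> t" "t \<le> 2 * (r / m)" for s t
  proof -
    have "m * s \<le> m * t" "0 \<le> m * s" "m * t \<le> 2 * r" using that m by (auto simp: field_simps)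
    from has_integral_affinity'[OF apathD(4)[OF p this(2,1,3), folded cbox_interval] m, of 0]
    have "((\<lambda>t. w (m * t)) has_integral (Y (m * t) - Y (m * s)) /\<^sub>R m) {s..t}"
      using m by (simp add: mult.assoc[symmetric])
    then show ?thesis by (simp add: diff_divide_distrib divide_inverse_commute right_diff_distrib)
  qed
  moreover have "\<exists>C. \<forall>t. \<bar>w (m * t)\<bar> \<le> C" using p by (auto simp: apath_def)
  moreover have "(\<lambda>t. Y (m * t) / m) \<in> borel_measurable borel" "(\<lambda>t. w (m * t)) \<in> borel_measurable borel"
    using apathD(1,2)[OF p] by measurable
  ultimately show ?thesis using apathD(3)[OF p] m by (auto simp: apath_def)
qed

lemma has_integral_shift_real:
  fixes f :: "real \<Rightarrow> real"
  assumes "(f has_integral I) {a + c..b + c}"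
  shows "((\<lambda>t. f (t + c)) has_integral I) {a..b}"
  using has_integral_affinity'[OF assms[folded cbox_interval], of 1 c] by simp

text \<open>The same trajectory started at time \<open>c\<close>. Beyond \<open>2 * r\<close> the
  antiperiodic continuation takes over, hence the minus sign.\<close>

definition ashift :: "real \<Rightarrow> real \<Rightarrow> (real \<Rightarrow> real) \<Rightarrow> real \<Rightarrow> real" where
  "ashift r c Y t = (if t + c \<le> 2 * r then Y (t + c) else - Y (t + c - 2 * r))"

lemma ashift_measurable [measurable (raw)]:
  assumes [measurable]: "Y \<in> borel_measurable borel" "f \<in> borel_measurable M" "g \<in> borel_measurable M"
  shows "(\<lambda>x. ashift r (f x) Y (g x)) \<in> borel_measurable M"
  unfolding ashift_def by measurable

lemma apath_shift:
  assumes p: "apath r Y w" and c: "0 \<le> c" "c \<le> 2 * r"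
  shows "apath r (ashift r c Y) (ashift r c w)"
proof -
  note [measurable] = apathD(1,2)[OF p]
  have A: "(ashift r c w has_integral (ashift r c Y t - ashift r c Y s)) {s..t}"
    if "0 \<le> s" "s \<le> t" "t \<le> 2 * r - c" for s t
  proof -
    have "((\<lambda>x. w (x + c)) has_integral (Y (t + c) - Y (s + c))) {s..t}"
      by (rule has_integral_shift_real, rule apathD(4)[OF p]) (use that c in auto)
    moreover have "w (x + c) = ashift r c w x" if "x \<in> {s..t}" for x
      using that \<open>t \<le> 2 * r - c\<close> by (auto simp: ashift_def)
    ultimately show ?thesis using that by (subst has_integral_cong[where g="\<lambda>x. w (x + c)"]) (auto simp: ashift_def)
  qed
  have B: "(ashift r c w has_integral (ashift r c Y t - ashift r c Y s)) {s..t}"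
    if "2 * r - c \<le> s" "s \<le> t" "t \<le> 2 * r" for s t
  proof -
    \<comment> \<open>At the joint \<open>2 * r - c\<close> the definition uses its first branch.
      For \<open>Y\<close> both branches agree there by antiperiodicity; for \<open>w\<close> they
      may differ, and this one point is removed below by a spike.\<close>
    have z: "ashift r c Y x = - Y (x + (c - 2 * r))" if "2 * r - c \<le> x" for x
    proof (cases "x = 2 * r - c")
      case True then show ?thesis using apathD(3)[OF p] by (simp add: ashift_def)
    next
      case False then show ?thesis using that by (simp add: ashift_def algebra_simps)
    qed
    have "((\<lambda>x. w (x + (c - 2 * r))) has_integral (Y (t + (c - 2 * r)) - Y (s + (c - 2 * r)))) {s..t}"
      by (rule has_integral_shift_real, rule apathD(4)[OF p]) (use that c in auto)
    from has_integral_neg[OF this]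
    have "((\<lambda>x. - w (x + (c - 2 * r))) has_integral (ashift r c Y t - ashift r c Y s)) {s..t}"
      using that by (simp add: z)
    then show ?thesis
      by (rule has_integral_spike_finite[of "{2 * r - c}", rotated 2])
         (use that in \<open>auto simp: ashift_def algebra_simps\<close>)
  qed
  have "(ashift r c w has_integral (ashift r c Y t - ashift r c Y s)) {s..t}"
    if "0 \<le> s" "s \<le> t" "t \<le> 2 * r" for s t
  proof -
    consider "t \<le> 2 * r - c" | "2 * r - c \<le> s" | "s \<le> 2 * r - c" "2 * r - c \<le> t" by linarith
    then show ?thesis
    proof cases
      case 3
      from has_integral_combine[OF 3 A B] that 3 c
      show ?thesis by simp
    qed (use A B that in auto)
  qed
  moreover obtain C where "\<And>t. \<bar>w t\<bar> \<le> C" using p unfolding apath_def by blast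
  then have "\<bar>ashift r c w t\<bar> \<le> C" for t by (simp add: ashift_def)
  moreover have "ashift r c Y (2 * r) = - ashift r c Y 0"
    using c apathD(3)[OF p] by (auto simp: ashift_def)
  ultimately show ?thesis unfolding apath_def by (auto intro!: exI[of _ C])
qed

text \<open>A trajectory in an l1-sum: \<open>Y\<close> runs while the second factor rests at
  \<open>Z 0\<close>, then \<open>Z\<close> runs while the first rests at \<open>Y (2 * r)\<close>.
  At the end both have changed sign, so the result is again antiperiodic, and the sizes add.\<close>

definition concat_path :: "real \<Rightarrow> (real \<Rightarrow> real) \<Rightarrow> (real \<Rightarrow> real) \<Rightarrow> real \<Rightarrow> real" where
  "concat_path r Y Z t = (if t \<le> 2 * r then Y t + Z 0 else Y (2 * r) + Z (t - 2 * r))"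

definition concat_slope :: "real \<Rightarrow> (real \<Rightarrow> real) \<Rightarrow> (real \<Rightarrow> real) \<Rightarrow> real \<Rightarrow> real" where
  "concat_slope r w v t = (if t \<le> 2 * r then w t else v (t - 2 * r))"

lemma apath_concat:
  assumes p: "apath r Y w" and q: "apath r' Z v" and r: "r > 0" "r' > 0"
  shows "apath (r + r') (concat_path r Y Z) (concat_slope r w v)"
proof -
  note [measurable] = apathD(1,2)[OF p] apathD(1,2)[OF q]
  have A: "(concat_slope r w v has_integral (concat_path r Y Z t - concat_path r Y Z s)) {s..t}"
    if "0 \<le> s" "s \<le> t" "t \<le> 2 * r" for s t
  proof -
    have "(w has_integral (Y t - Y s)) {s..t}" using apathD(4)[OF p that] .
    then show ?thesis using that
      by (subst has_integral_cong[where g=w]) (auto simp: concat_path_def concat_slope_def)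
  qed
  have B: "(concat_slope r w v has_integral (concat_path r Y Z t - concat_path r Y Z s)) {s..t}"
    if "2 * r \<le> s" "s \<le> t" "t \<le> 2 * (r + r')" for s t
  proof -
    have z: "concat_path r Y Z x = Y (2 * r) + Z (x + - (2 * r))" if "2 * r \<le> x" for x
      using that by (cases "x = 2 * r") (auto simp: concat_path_def)
    have "((\<lambda>x. v (x + - (2 * r))) has_integral (Z (t + - (2 * r)) - Z (s + - (2 * r)))) {s..t}"
      by (rule has_integral_shift_real, rule apathD(4)[OF q]) (use that r in auto)
    then have "((\<lambda>x. v (x + - (2 * r))) has_integral (concat_path r Y Z t - concat_path r Y Z s)) {s..t}"
      using that by (simp add: z)
    then show ?thesis
      by (rule has_integral_spike_finite[of "{2 * r}", rotated 2]) (use that in \<open>auto simp: concat_slope_def\<close>)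
  qed
  have "(concat_slope r w v has_integral (concat_path r Y Z t - concat_path r Y Z s)) {s..t}"
    if "0 \<le> s" "s \<le> t" "t \<le> 2 * (r + r')" for s t
  proof -
    consider "t \<le> 2 * r" | "2 * r \<le> s" | "s \<le> 2 * r" "2 * r \<le> t" by linarith
    then show ?thesis
    proof cases
      case 3
      from has_integral_combine[OF 3 A B] that 3 r
      show ?thesis by simp
    qed (use A B that in auto)
  qed
  moreover obtain C D where "\<And>t. \<bar>w t\<bar> \<le> C" "\<And>t. \<bar>v t\<bar> \<le> D" using p q unfolding apath_def by blast
  then have "\<bar>concat_slope r w v t\<bar> \<le> max C D" for t by (simp add: concat_slope_def le_max_iff_disj)
  moreover have "concat_path r Y Z (2 * (r + r')) = - concat_path r Y Z 0"
    using r apathD(3)[OF p] apathD(3)[OF q] by (simp add: concat_path_def distrib_left)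
  moreover have "concat_path r Y Z \<in> borel_measurable borel" "concat_slope r w v \<in> borel_measurable borel"
    unfolding concat_path_def concat_slope_def by measurable
  ultimately show ?thesis unfolding apath_def by blast
qed

text \<open>
  A path of size \<open>r\<close> starts at norm \<open>r\<close> and lasts for time \<open>2 * r\<close>; averaged over all starting
  points it visits each point of norm at most \<open>r\<close> equally often, with independent slope.
\<close>

definition path_sum :: "(real \<times> real \<Rightarrow> ennreal) \<Rightarrow> (real \<times> real \<times> real \<Rightarrow> ennreal) \<Rightarrow> real \<Rightarrow> (real \<Rightarrow> real) \<Rightarrow> (real \<Rightarrow> real) \<Rightarrow> ennreal" where
  "path_sum c k r Y w = c (r, Y 0) + (\<integral>\<^sup>+t. k (r, Y t, w t) * win (t - r) r \<partial>lborel)"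

definition occ_sum :: "real htree \<Rightarrow> (real \<times> real \<times> real \<Rightarrow> ennreal) \<Rightarrow> ennreal" where
  "occ_sum T k = (\<integral>\<^sup>+r. \<integral>\<^sup>+x. \<integral>\<^sup>+w. k (r, snd x, w) * win (fst x) r \<partial>slope_law T \<partial>pos_law T \<partial>lborel)"

text \<open>The average of \<open>path_sum\<close> over paths whose starts follow Lebesgue measure
  in leaf coordinates. With \<open>V\<close> the volume of the unit ball and
  \<open>n = hdim T\<close>, starts of norm in \<open>dr\<close> have mass
  \<open>n * V * r ^ (n - 1) * dr\<close> and their paths last \<open>2 * r\<close>; the product is
  \<open>2 * n\<close> times the volume of the ball of radius \<open>r\<close>, which is the domain
  of position in \<open>occ_sum\<close>.\<close>

definition mean_sum :: "real htree \<Rightarrow> (real \<times> real \<Rightarrow> ennreal) \<Rightarrow> (real \<times> real \<times> real \<Rightarrow> ennreal) \<Rightarrow> ennreal" where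
  "mean_sum T c k = (\<integral>\<^sup>+x. c (\<bar>fst x\<bar>, snd x) \<partial>pos_law T) + ennreal (2 * real (hdim T)) * occ_sum T k"

text \<open>Values are extended nonnegative, so the two sides of an inequality cannot be merged into
  one functional; each side keeps its own pair of start and occupation terms.\<close>

definition path_dominated where
  "path_dominated c k d h \<longleftrightarrow> (\<forall>r Y w. r > 0 \<longrightarrow> apath r Y w \<longrightarrow> path_sum c k r Y w \<le> path_sum d h r Y w)"

definition traceable :: "real htree \<Rightarrow> bool" where
  "traceable T \<longleftrightarrow> (\<forall>c \<in> borel_measurable borel. \<forall>k \<in> borel_measurable borel. \<forall>d \<in> borel_measurable borel. \<forall>h \<in> borel_measurable borel.
     path_dominated c k d h \<longrightarrow> mean_sum T c k \<le> mean_sum T d h)"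

lemma sets_pos_law [measurable_cong]: "sets (pos_law t) = sets borel"
  by (rule strip_finite_sets[OF strip_finite_pos_law])

lemma sigma_finite_pos_law: "sigma_finite_measure (pos_law t)"
  by (rule strip_finite_sigma[OF strip_finite_pos_law])

lemma lborel_half:
  fixes f :: "real \<Rightarrow> ennreal" assumes [measurable]: "f \<in> borel_measurable borel"
  shows "(\<integral>\<^sup>+t. f t \<partial>lborel) = (\<integral>\<^sup>+t. (f t + f (- t)) * indicator {0<..} t \<partial>lborel)"
proof -
  have "(\<integral>\<^sup>+t. f t \<partial>lborel) = (\<integral>\<^sup>+t. f t * indicator {0<..} t + f t * indicator {..<0} t \<partial>lborel)"
  proof (rule nn_integral_cong_AE, rule eventually_mono[OF AE_lborel_singleton[of "0::real"]])
    fix t :: real assume "t \<noteq> 0"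
    then show "f t = f t * indicator {0<..} t + f t * indicator {..<0} t" by (auto simp: indicator_def)
  qed
  also have "\<dots> = (\<integral>\<^sup>+t. f t * indicator {0<..} t \<partial>lborel) + (\<integral>\<^sup>+t. f t * indicator {..<0} t \<partial>lborel)"
    by (rule nn_integral_add) measurable
  also have "(\<integral>\<^sup>+t. f t * indicator {..<0} t \<partial>lborel) = (\<integral>\<^sup>+t. f (0 - t) * indicator {..<0} (0 - t) \<partial>lborel)"
    by (rule nn_integral_reflect[symmetric]) measurable
  also have "(\<integral>\<^sup>+t. f t * indicator {0<..} t \<partial>lborel) + \<dots> = (\<integral>\<^sup>+t. f t * indicator {0<..} t + f (0 - t) * indicator {..<0} (0 - t) \<partial>lborel)"
    by (rule nn_integral_add[symmetric]) measurable
  also have "\<dots> = (\<integral>\<^sup>+t. (f t + f (- t)) * indicator {0<..} t \<partial>lborel)"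
    by (intro nn_integral_cong) (auto simp: indicator_def)
  finally show ?thesis .
qed

text \<open>A segment carries two paths of size \<open>r\<close>, one from each end point.
  Reflecting or shifting time turns running time into the leaf coordinate. The slopes
  \<open>a\<close> and \<open>- a\<close> have probability 1/2 each, which is compensated by the
  weight \<open>2 * hdim = 2\<close>.\<close>

lemma mean_sum_Seg:
  assumes [measurable]: "c \<in> borel_measurable borel" "k \<in> borel_measurable borel"
  shows "mean_sum (Seg a) c k = (\<integral>\<^sup>+r. (path_sum c k r (\<lambda>t. a * (r - t)) (\<lambda>t. - a) + path_sum c k r (\<lambda>t. - a * (r - t)) (\<lambda>t. - (- a))) * indicator {0<..} r \<partial>lborel)"
proof -
  let ?P = "\<lambda>b r. \<integral>\<^sup>+t. k (r, t * a, b) * win t r \<partial>lborel"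
  have P1: "(\<integral>\<^sup>+t. k (r, a * (r - t), - a) * win (t - r) r \<partial>lborel) = ?P (- a) r" for r
    using nn_integral_reflect[of "\<lambda>t. k (r, t * a, - a) * win t r" r]
    by (simp add: mult.commute win_def abs_minus_commute)
  have P2: "(\<integral>\<^sup>+t. k (r, - (a * (r - t)), a) * win (t - r) r \<partial>lborel) = ?P a r" for r
    using nn_integral_shift[of "\<lambda>t. k (r, t * a, a) * win t r" "- r"]
    by (simp add: mult.commute algebra_simps)
  have m1: "(\<lambda>r. ?P b r) \<in> borel_measurable borel" for b by measurable
  have "(\<integral>\<^sup>+r. (path_sum c k r (\<lambda>t. a * (r - t)) (\<lambda>t. - a) + path_sum c k r (\<lambda>t. - a * (r - t)) (\<lambda>t. - (- a))) * indicator {0<..} r \<partial>lborel)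
    = (\<integral>\<^sup>+r. (c (r, a * r) + c (r, - (a * r))) * indicator {0<..} r + (?P a r + ?P (- a) r) \<partial>lborel)"
  proof (rule nn_integral_cong_AE, rule eventually_mono[OF AE_lborel_singleton[of "0::real"]])
    fix r :: real assume r: "r \<noteq> 0"
    show "(path_sum c k r (\<lambda>t. a * (r - t)) (\<lambda>t. - a) + path_sum c k r (\<lambda>t. - a * (r - t)) (\<lambda>t. - (- a))) * indicator {0<..} r
      = (c (r, a * r) + c (r, - (a * r))) * indicator {0<..} r + (?P a r + ?P (- a) r)"
    proof (cases "r > 0")
      case True
      then show ?thesis by (simp add: path_sum_def P1 P2 add_ac)
    next
      case False
      then have "win t r = 0" for t using r by (simp add: win_def)
      then show ?thesis using False by simp
    qed
  qed
  also have "\<dots> = (\<integral>\<^sup>+r. (c (r, a * r) + c (r, - (a * r))) * indicator {0<..} r \<partial>lborel) + (\<integral>\<^sup>+r. ?P a r + ?P (- a) r \<partial>lborel)"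
    by (rule nn_integral_add) measurable
  also have "(\<integral>\<^sup>+r. (c (r, a * r) + c (r, - (a * r))) * indicator {0<..} r \<partial>lborel) = (\<integral>\<^sup>+t. c (\<bar>t\<bar>, t * a) \<partial>lborel)"
    by (subst lborel_half) (auto intro!: nn_integral_cong simp: indicator_def mult.commute)
  also have "(\<integral>\<^sup>+r. ?P a r + ?P (- a) r \<partial>lborel) = (\<integral>\<^sup>+r. 2 * (\<integral>\<^sup>+t. \<integral>\<^sup>+w. k (r, t * a, w) * win t r \<partial>slope_law (Seg a) \<partial>lborel) \<partial>lborel)"
  proof (rule nn_integral_cong)
    fix r :: real
    have "?P a r + ?P (- a) r = (\<integral>\<^sup>+t. k (r, t * a, a) * win t r + k (r, t * a, - a) * win t r \<partial>lborel)"
      by (rule nn_integral_add[symmetric]) measurable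
    also have "\<dots> = (\<integral>\<^sup>+t. 2 * (\<integral>\<^sup>+w. k (r, t * a, w) * win t r \<partial>slope_law (Seg a)) \<partial>lborel)"
      by (intro nn_integral_cong slope_law_Seg[symmetric]) measurable
    also have "\<dots> = 2 * (\<integral>\<^sup>+t. \<integral>\<^sup>+w. k (r, t * a, w) * win t r \<partial>slope_law (Seg a) \<partial>lborel)"
    proof (rule nn_integral_cmult)
      interpret sigma_finite_measure "slope_law (Seg a)" by (rule sigma_finite_slope_law)
      show "(\<lambda>t. \<integral>\<^sup>+w. k (r, t * a, w) * win t r \<partial>slope_law (Seg a)) \<in> borel_measurable lborel"
        by measurable
    qed
    finally show "?P a r + ?P (- a) r = \<dots>" .
  qed
  also have "\<dots> = 2 * (\<integral>\<^sup>+r. \<integral>\<^sup>+t. \<integral>\<^sup>+w. k (r, t * a, w) * win t r \<partial>slope_law (Seg a) \<partial>lborel \<partial>lborel)"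
  proof (rule nn_integral_cmult)
    interpret sigma_finite_measure "slope_law (Seg a)" by (rule sigma_finite_slope_law)
    show "(\<lambda>r. \<integral>\<^sup>+t. \<integral>\<^sup>+w. k (r, t * a, w) * win t r \<partial>slope_law (Seg a) \<partial>lborel) \<in> borel_measurable lborel"
      by measurable
  qed
  also have "(\<lambda>r. \<integral>\<^sup>+t. \<integral>\<^sup>+w. k (r, t * a, w) * win t r \<partial>slope_law (Seg a) \<partial>lborel) = (\<lambda>r. \<integral>\<^sup>+x. \<integral>\<^sup>+w. k (r, snd x, w) * win (fst x) r \<partial>slope_law (Seg a) \<partial>pos_law (Seg a))"
  proof
    fix r :: real
    interpret sigma_finite_measure "slope_law (Seg a)" by (rule sigma_finite_slope_law)
    show "(\<integral>\<^sup>+t. \<integral>\<^sup>+w. k (r, t * a, w) * win t r \<partial>slope_law (Seg a) \<partial>lborel) = (\<integral>\<^sup>+x. \<integral>\<^sup>+w. k (r, snd x, w) * win (fst x) r \<partial>slope_law (Seg a) \<partial>pos_law (Seg a))"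
      unfolding pos_law.simps by (subst nn_integral_distr) (auto simp: win_def)
  qed
  also have "(\<integral>\<^sup>+t. c (\<bar>t\<bar>, t * a) \<partial>lborel) = (\<integral>\<^sup>+x. c (\<bar>fst x\<bar>, snd x) \<partial>pos_law (Seg a))"
    unfolding pos_law.simps by (subst nn_integral_distr) auto
  finally show ?thesis by (simp add: mean_sum_def occ_sum_def)
qed

lemma traceable_Seg: "traceable (Seg a)"
  unfolding traceable_def
proof (intro ballI impI)
  fix c d :: "real \<times> real \<Rightarrow> ennreal" and k h :: "real \<times> real \<times> real \<Rightarrow> ennreal"
  assume m: "c \<in> borel_measurable borel" "k \<in> borel_measurable borel" "d \<in> borel_measurable borel" "h \<in> borel_measurable borel"
    and dom: "path_dominated c k d h"
  show "mean_sum (Seg a) c k \<le> mean_sum (Seg a) d h"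
    unfolding mean_sum_Seg[OF m(1,2)] mean_sum_Seg[OF m(3,4)]
  proof (rule nn_integral_mono)
    fix r :: real
    show "(path_sum c k r (\<lambda>t. a * (r - t)) (\<lambda>t. - a) + path_sum c k r (\<lambda>t. - a * (r - t)) (\<lambda>t. - (- a))) * indicator {0<..} r
      \<le> (path_sum d h r (\<lambda>t. a * (r - t)) (\<lambda>t. - a) + path_sum d h r (\<lambda>t. - a * (r - t)) (\<lambda>t. - (- a))) * indicator {0<..} r"
    proof (cases "r > 0")
      case True
      then show ?thesis
        using dom apath_line[of r a] apath_line[of r "- a"] unfolding path_dominated_def
        by (intro mult_right_mono add_mono) auto
    qed simp
  qed
qed

text \<open>Averages in \<open>traceable\<close> run over all sizes. One size is isolated by
  homogeneity: a functional given at size \<open>r0\<close> is extended to the other sizes by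
  rescaling the path, so that every size yields the same inequality.\<close>

lemma traceable_fixed_size:
  assumes T: "traceable T" and r0: "r0 > 0"
    and [measurable]: "k \<in> borel_measurable borel" "h \<in> borel_measurable borel"
    and dom: "\<And>Y w. apath r0 Y w \<Longrightarrow>
      (\<integral>\<^sup>+t. k (Y t, w t) * win (t - r0) r0 \<partial>lborel) \<le> (\<integral>\<^sup>+t. h (Y t, w t) * win (t - r0) r0 \<partial>lborel)"
  shows "(\<integral>\<^sup>+x. \<integral>\<^sup>+w. k (snd x, w) * win (fst x) r0 \<partial>slope_law T \<partial>pos_law T)
    \<le> (\<integral>\<^sup>+x. \<integral>\<^sup>+w. h (snd x, w) * win (fst x) r0 \<partial>slope_law T \<partial>pos_law T)"
proof -
  interpret N: sigma_finite_measure "slope_law T" by (rule sigma_finite_slope_law)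
  interpret A: sigma_finite_measure "pos_law T" by (rule sigma_finite_pos_law)
  \<comment> \<open>The indicator of sizes between 0 and 1. The cut-off keeps the total weight
    \<open>C\<close> finite, so that it can be cancelled at the end.\<close>
  let ?e = "\<lambda>r. win (r - 1/2) (1/2)"
  let ?n = "hdim T"
  define ext where "ext g = (\<lambda>(r, y, w). ?e r * g ((r0 / r) * y, w))" for g :: "real \<times> real \<Rightarrow> ennreal"
  have ext_m[measurable]: "ext g \<in> borel_measurable borel" if [measurable]: "g \<in> borel_measurable borel" for g
    unfolding ext_def by measurable
  \<comment> \<open>The integral of \<open>(r / r0) ^ n\<close> over \<open>r\<close> from 0 to 1:
    the volume of the ball of radius \<open>r\<close> relative to the one of radius
    \<open>r0\<close>.\<close>
  define C where "C = (\<integral>\<^sup>+r. ennreal (1 / r0 ^ ?n) * (ennreal (r ^ ?n) * indicator {0..1} r) \<partial>lborel)"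
  have "(\<integral>\<^sup>+r. ennreal (r ^ ?n) * indicator {0..1::real} r \<partial>lborel) = 1 ^ Suc ?n / real (Suc ?n) - 0 ^ Suc ?n / real (Suc ?n)"
  proof (rule nn_integral_FTC_Icc)
    fix x :: real
    show "((\<lambda>x. x ^ Suc ?n / real (Suc ?n)) has_real_derivative x ^ ?n) (at x)"
      by (rule DERIV_cdivide[OF DERIV_pow, THEN DERIV_cong]) simp
  qed auto
  then have "C = ennreal (1 / r0 ^ ?n) * ennreal (1 / real (Suc ?n))"
    unfolding C_def by (subst nn_integral_cmult) auto
  then have C: "C \<noteq> 0" "C < \<infinity>" using r0 by (auto simp: ennreal_mult_less_top)
  have occ_sum_ext: "occ_sum T (ext g) = C * (\<integral>\<^sup>+x. \<integral>\<^sup>+w. g (snd x, w) * win (fst x) r0 \<partial>slope_law T \<partial>pos_law T)"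
    if [measurable]: "g \<in> borel_measurable borel" for g
  proof -
    let ?I = "\<integral>\<^sup>+x. \<integral>\<^sup>+w. g (snd x, w) * win (fst x) r0 \<partial>slope_law T \<partial>pos_law T"
    have "occ_sum T (ext g) = (\<integral>\<^sup>+r. ennreal (1 / r0 ^ ?n) * (ennreal (r ^ ?n) * indicator {0..1} r) * ?I \<partial>lborel)"
      unfolding occ_sum_def
    proof (rule nn_integral_cong_AE, rule eventually_mono[OF AE_lborel_singleton[of "0::real"]])
      fix r :: real assume r: "r \<noteq> 0"
      show "(\<integral>\<^sup>+x. \<integral>\<^sup>+w. ext g (r, snd x, w) * win (fst x) r \<partial>slope_law T \<partial>pos_law T) = ennreal (1 / r0 ^ ?n) * (ennreal (r ^ ?n) * indicator {0..1} r) * ?I"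
      proof (cases "0 < r \<and> r \<le> 1")
        case True
        then have e: "?e r = 1" by (auto simp: win_def abs_if)
        have s: "r / r0 > 0" using True r0 by simp
        have "(\<integral>\<^sup>+x. \<integral>\<^sup>+w. g ((r0 / r) * snd x, w) * win (fst x) r \<partial>slope_law T \<partial>pos_law T)
          = ennreal ((r / r0) ^ ?n) * (\<integral>\<^sup>+x. \<integral>\<^sup>+w. g ((r0 / r) * (r / r0 * snd x), w) * win (r / r0 * fst x) r \<partial>slope_law T \<partial>pos_law T)"
          using quasi_invD[OF pos_law_scale[OF s], of "\<lambda>x. \<integral>\<^sup>+w. g ((r0 / r) * snd x, w) * win (fst x) r \<partial>slope_law T" T] by simp
        also have "(\<integral>\<^sup>+x. \<integral>\<^sup>+w. g ((r0 / r) * (r / r0 * snd x), w) * win (r / r0 * fst x) r \<partial>slope_law T \<partial>pos_law T) = ?I"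
          using True r0 by (intro nn_integral_cong) (simp add: win_def abs_mult field_simps)
        finally show ?thesis using True r0
          by (simp add: ext_def e power_divide indicator_def flip: ennreal_mult)
      next
        case False
        then have "?e r = 0 \<or> r < 0" using r by (auto simp: win_def abs_if split: if_splits)
        then show ?thesis using False r by (auto simp: ext_def win_def indicator_def)
      qed
    qed
    also have "\<dots> = C * ?I" unfolding C_def by (rule nn_integral_multc) measurable
    finally show ?thesis .
  qed
  have "path_dominated (\<lambda>_. 0) (ext k) (\<lambda>_. 0) (ext h)"
    unfolding path_dominated_def
  proof (intro allI impI)
    fix r Y w assume r: "0 < r" and p: "apath r Y w"
    note [measurable] = apathD(1,2)[OF p]
    define m where "m = r / r0"
    have m: "m > 0" "r / m = r0" using r r0 by (auto simp: m_def)
    have q: "apath r0 (\<lambda>t. Y (m * t) / m) (\<lambda>t. w (m * t))" using apath_rescale[OF p m(1)] m(2) by simp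
    have path_sum_ext: "path_sum (\<lambda>_. 0) (ext g) r Y w = ennreal m * ?e r * (\<integral>\<^sup>+t. g (Y (m * t) / m, w (m * t)) * win (t - r0) r0 \<partial>lborel)"
      if [measurable]: "g \<in> borel_measurable borel" for g
    proof -
      have "path_sum (\<lambda>_. 0) (ext g) r Y w = ?e r * (\<integral>\<^sup>+t. g ((r0 / r) * Y t, w t) * win (t - r) r \<partial>lborel)"
        by (simp add: path_sum_def ext_def mult.assoc nn_integral_cmult)
      also have "(\<integral>\<^sup>+t. g ((r0 / r) * Y t, w t) * win (t - r) r \<partial>lborel) = ennreal m * (\<integral>\<^sup>+t. g ((r0 / r) * Y (m * t), w (m * t)) * win (m * t - r) r \<partial>lborel)"
        using nn_integral_real_affine[of "\<lambda>t. g ((r0 / r) * Y t, w t) * win (t - r) r" m 0] m by simp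
      also have "(\<integral>\<^sup>+t. g ((r0 / r) * Y (m * t), w (m * t)) * win (m * t - r) r \<partial>lborel) = (\<integral>\<^sup>+t. g (Y (m * t) / m, w (m * t)) * win (t - r0) r0 \<partial>lborel)"
      proof (rule nn_integral_cong)
        fix t
        have "r = m * r0" using r0 by (simp add: m_def)
        then have "win (m * t - r) r = win (m * (t - r0)) (m * r0)" by (simp add: algebra_simps)
        also have "\<dots> = win (t - r0) r0" using m by (simp add: win_def abs_mult)
        moreover have "(r0 / r) * Y (m * t) = Y (m * t) / m" using r r0 by (simp add: m_def)
        ultimately show "g ((r0 / r) * Y (m * t), w (m * t)) * win (m * t - r) r = g (Y (m * t) / m, w (m * t)) * win (t - r0) r0"
          by simp
      qed
      finally show ?thesis by (simp only: mult_ac)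
    qed
    show "path_sum (\<lambda>_. 0) (ext k) r Y w \<le> path_sum (\<lambda>_. 0) (ext h) r Y w"
      unfolding path_sum_ext[OF assms(3)] path_sum_ext[OF assms(4)] using dom[OF q] by (intro mult_left_mono) auto
  qed
  then have "mean_sum T (\<lambda>_. 0) (ext k) \<le> mean_sum T (\<lambda>_. 0) (ext h)"
    using T ext_m[OF assms(3)] ext_m[OF assms(4)] unfolding traceable_def by (metis borel_measurable_const)
  then have "(ennreal (2 * real ?n) * C) * (\<integral>\<^sup>+x. \<integral>\<^sup>+w. k (snd x, w) * win (fst x) r0 \<partial>slope_law T \<partial>pos_law T)
    \<le> (ennreal (2 * real ?n) * C) * (\<integral>\<^sup>+x. \<integral>\<^sup>+w. h (snd x, w) * win (fst x) r0 \<partial>slope_law T \<partial>pos_law T)"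
    by (simp add: mean_sum_def occ_sum_ext mult.assoc)
  moreover have "ennreal (2 * real ?n) * C \<noteq> 0" "ennreal (2 * real ?n) * C < \<infinity>"
    using C hdim_pos[of T] by (auto simp: ennreal_mult_less_top)
  ultimately show ?thesis by (subst (asm) ennreal_mult_le_mult_iff) auto
qed

section \<open>The l1-sum: factors moving in turn\<close>

lemma path_sum_concat:
  assumes p: "apath r1 Y w" and q: "apath r2 Z v" and r: "r1 > 0" "r2 > 0"
    and [measurable]: "k \<in> borel_measurable borel"
  shows "path_sum c k (r1 + r2) (concat_path r1 Y Z) (concat_slope r1 w v)
    = path_sum (\<lambda>(\<rho>, y). c (\<rho> + r2, y + Z 0) + (\<integral>\<^sup>+t. k (\<rho> + r2, - y + Z t, v t) * win (t - r2) r2 \<partial>lborel))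
          (\<lambda>(\<rho>, y, u). k (\<rho> + r2, y + Z 0, u)) r1 Y w"
proof -
  note [measurable] = apathD(1,2)[OF p] apathD(1,2)[OF q]
  \<comment> \<open>The run of the second path while the first one rests at \<open>- Y 0\<close>. It
    depends on the first path only through the start \<open>Y 0\<close> and therefore enters the
    start term.\<close>
  let ?G = "\<lambda>t. k (r1 + r2, - Y 0 + Z t, v t) * win (t - r2) r2"
  have "(\<integral>\<^sup>+t. k (r1 + r2, concat_path r1 Y Z t, concat_slope r1 w v t) * win (t - (r1 + r2)) (r1 + r2) \<partial>lborel)
    = (\<integral>\<^sup>+t. k (r1 + r2, Y t + Z 0, w t) * win (t - r1) r1 + ?G (- (2 * r1) + t) \<partial>lborel)"
  proof (rule nn_integral_cong_AE, rule eventually_mono[OF AE_lborel_singleton[of "2 * r1"]])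
    fix t assume t: "t \<noteq> 2 * r1"
    show "k (r1 + r2, concat_path r1 Y Z t, concat_slope r1 w v t) * win (t - (r1 + r2)) (r1 + r2)
      = k (r1 + r2, Y t + Z 0, w t) * win (t - r1) r1 + ?G (- (2 * r1) + t)"
    proof (cases "t < 2 * r1")
      case True
      have "win (t - (r1 + r2)) (r1 + r2) = win (t - r1) r1" "win (- (2 * r1) + t - r2) r2 = 0"
        using True r by (auto simp: win_def)
      then show ?thesis using True by (simp add: concat_path_def concat_slope_def)
    next
      case False
      have "win (t - (r1 + r2)) (r1 + r2) = win (- (2 * r1) + t - r2) r2" "win (t - r1) r1 = 0"
        using False t r by (auto simp: win_def)
      then show ?thesis using False t apathD(3)[OF p] by (simp add: concat_path_def concat_slope_def)
    qed
  qed
  also have "\<dots> = (\<integral>\<^sup>+t. k (r1 + r2, Y t + Z 0, w t) * win (t - r1) r1 \<partial>lborel) + (\<integral>\<^sup>+t. ?G (- (2 * r1) + t) \<partial>lborel)"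
    by (rule nn_integral_add) measurable
  also have "(\<integral>\<^sup>+t. ?G (- (2 * r1) + t) \<partial>lborel) = (\<integral>\<^sup>+t. ?G t \<partial>lborel)"
    by (rule nn_integral_shift) measurable
  finally show ?thesis using r by (simp add: path_sum_def concat_path_def add_ac)
qed

text \<open>Averaging over the first path leaves a functional of the second. The start and the whole
  run of the first factor see only \<open>Z 0\<close> and form the new start term; the run of the
  second factor, averaged over the resting point of the first, forms the new occupation
  term.\<close>

lemma mean_sum_concat1:
  assumes [measurable]: "c \<in> borel_measurable borel" "k \<in> borel_measurable borel"
    "Z \<in> borel_measurable borel" "v \<in> borel_measurable borel"
  shows "mean_sum a (\<lambda>(\<rho>, y). c (\<rho> + r2, y + Z 0) + (\<integral>\<^sup>+t. k (\<rho> + r2, - y + Z t, v t) * win (t - r2) r2 \<partial>lborel))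
      (\<lambda>(\<rho>, y, u). k (\<rho> + r2, y + Z 0, u))
    = path_sum (\<lambda>(\<sigma>, y). (\<integral>\<^sup>+x. c (\<bar>fst x\<bar> + \<sigma>, snd x + y) \<partial>pos_law a)
              + ennreal (2 * real (hdim a)) * (\<integral>\<^sup>+r. \<integral>\<^sup>+x. \<integral>\<^sup>+u. k (r + \<sigma>, snd x + y, u) * win (fst x) r \<partial>slope_law a \<partial>pos_law a \<partial>lborel))
          (\<lambda>(\<sigma>, y, u). \<integral>\<^sup>+x. k (\<bar>fst x\<bar> + \<sigma>, - snd x + y, u) \<partial>pos_law a) r2 Z v"
proof -
  interpret A: sigma_finite_measure "pos_law a" by (rule sigma_finite_pos_law)
  have "(\<integral>\<^sup>+x. c (\<bar>fst x\<bar> + r2, snd x + Z 0) + (\<integral>\<^sup>+t. k (\<bar>fst x\<bar> + r2, - snd x + Z t, v t) * win (t - r2) r2 \<partial>lborel) \<partial>pos_law a)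
     = (\<integral>\<^sup>+x. c (\<bar>fst x\<bar> + r2, snd x + Z 0) \<partial>pos_law a) + (\<integral>\<^sup>+x. \<integral>\<^sup>+t. k (\<bar>fst x\<bar> + r2, - snd x + Z t, v t) * win (t - r2) r2 \<partial>lborel \<partial>pos_law a)"
    by (rule nn_integral_add) measurable
  also have "(\<integral>\<^sup>+x. \<integral>\<^sup>+t. k (\<bar>fst x\<bar> + r2, - snd x + Z t, v t) * win (t - r2) r2 \<partial>lborel \<partial>pos_law a)
     = (\<integral>\<^sup>+t. \<integral>\<^sup>+x. k (\<bar>fst x\<bar> + r2, - snd x + Z t, v t) * win (t - r2) r2 \<partial>pos_law a \<partial>lborel)"
    by (intro nn_integral_Tonelli sigma_finite_pos_law sigma_finite_lborel) measurable
  also have "\<dots> = (\<integral>\<^sup>+t. (\<integral>\<^sup>+x. k (\<bar>fst x\<bar> + r2, - snd x + Z t, v t) \<partial>pos_law a) * win (t - r2) r2 \<partial>lborel)"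
    by (intro nn_integral_cong nn_integral_multc) measurable
  finally show ?thesis by (simp add: mean_sum_def path_sum_def occ_sum_def add_ac)
qed

text \<open>The mixture in \<open>slope_law_LOne\<close> splits the occupation term according to
  which factor is moving, with weights \<open>2 * hdim a\<close> and
  \<open>2 * hdim b\<close>.\<close>

lemma mean_sum_LOne:
  assumes [measurable]: "c \<in> borel_measurable borel" "k \<in> borel_measurable borel"
  shows "mean_sum (LOne a b) c k = (\<integral>\<^sup>+x. \<integral>\<^sup>+y. c (\<bar>fst x\<bar> + \<bar>fst y\<bar>, snd x + snd y) \<partial>pos_law b \<partial>pos_law a)
    + (ennreal (2 * real (hdim a)) * (\<integral>\<^sup>+r. \<integral>\<^sup>+x. \<integral>\<^sup>+y. \<integral>\<^sup>+u. k (r, snd x + snd y, u) * win (\<bar>fst x\<bar> + \<bar>fst y\<bar>) r \<partial>slope_law a \<partial>pos_law b \<partial>pos_law a \<partial>lborel)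
    + ennreal (2 * real (hdim b)) * (\<integral>\<^sup>+r. \<integral>\<^sup>+x. \<integral>\<^sup>+y. \<integral>\<^sup>+u. k (r, snd x + snd y, u) * win (\<bar>fst x\<bar> + \<bar>fst y\<bar>) r \<partial>slope_law b \<partial>pos_law b \<partial>pos_law a \<partial>lborel))"
proof -
  interpret A: sigma_finite_measure "pos_law a" by (rule sigma_finite_pos_law)
  interpret B: sigma_finite_measure "pos_law b" by (rule sigma_finite_pos_law)
  interpret NA: sigma_finite_measure "slope_law a" by (rule sigma_finite_slope_law)
  interpret NB: sigma_finite_measure "slope_law b" by (rule sigma_finite_slope_law)
  interpret N: sigma_finite_measure "slope_law (LOne a b)" by (rule sigma_finite_slope_law)
  let ?f = "\<lambda>r x y u. k (r, snd x + snd y, u) * win (\<bar>fst x\<bar> + \<bar>fst y\<bar>) r"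
  have c: "(\<integral>\<^sup>+x. c (\<bar>fst x\<bar>, snd x) \<partial>pos_law (LOne a b)) = (\<integral>\<^sup>+x. \<integral>\<^sup>+y. c (\<bar>fst x\<bar> + \<bar>fst y\<bar>, snd x + snd y) \<partial>pos_law b \<partial>pos_law a)"
    unfolding pos_law.simps
    by (subst nn_integral_push_pair[OF strip_finite_pos_law strip_finite_pos_law sum_pair_measurable]) (simp_all add: sum_pair_def)
  have "occ_sum (LOne a b) k = (\<integral>\<^sup>+r. \<integral>\<^sup>+x. \<integral>\<^sup>+y. \<integral>\<^sup>+u. ?f r x y u \<partial>slope_law (LOne a b) \<partial>pos_law b \<partial>pos_law a \<partial>lborel)"
    unfolding occ_sum_def pos_law.simps
    by (subst nn_integral_push_pair[OF strip_finite_pos_law strip_finite_pos_law sum_pair_measurable]) (simp_all add: sum_pair_def)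
  then have "ennreal (2 * real (hdim (LOne a b))) * occ_sum (LOne a b) k
    = (\<integral>\<^sup>+r. \<integral>\<^sup>+x. \<integral>\<^sup>+y. ennreal (2 * real (hdim (LOne a b))) * (\<integral>\<^sup>+u. ?f r x y u \<partial>slope_law (LOne a b)) \<partial>pos_law b \<partial>pos_law a \<partial>lborel)"
    by (simp add: nn_integral_cmult)
  also have "\<dots> = (\<integral>\<^sup>+r. \<integral>\<^sup>+x. \<integral>\<^sup>+y. ennreal (2 * real (hdim a)) * (\<integral>\<^sup>+u. ?f r x y u \<partial>slope_law a) + ennreal (2 * real (hdim b)) * (\<integral>\<^sup>+u. ?f r x y u \<partial>slope_law b) \<partial>pos_law b \<partial>pos_law a \<partial>lborel)"
  proof (intro nn_integral_cong)
    fix r x y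
    have e: "ennreal (2 * real m) = 2 * ennreal (real m)" for m by (simp add: ennreal_mult)
    have "(\<lambda>u. ?f r x y u) \<in> borel_measurable borel" by measurable
    from slope_law_LOne[OF this, of a b]
    show "ennreal (2 * real (hdim (LOne a b))) * (\<integral>\<^sup>+u. ?f r x y u \<partial>slope_law (LOne a b))
      = ennreal (2 * real (hdim a)) * (\<integral>\<^sup>+u. ?f r x y u \<partial>slope_law a) + ennreal (2 * real (hdim b)) * (\<integral>\<^sup>+u. ?f r x y u \<partial>slope_law b)"
      unfolding e hdim.simps by (simp only: mult.assoc distrib_left)
  qed
  also have "\<dots> = ennreal (2 * real (hdim a)) * (\<integral>\<^sup>+r. \<integral>\<^sup>+x. \<integral>\<^sup>+y. \<integral>\<^sup>+u. ?f r x y u \<partial>slope_law a \<partial>pos_law b \<partial>pos_law a \<partial>lborel)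
     + ennreal (2 * real (hdim b)) * (\<integral>\<^sup>+r. \<integral>\<^sup>+x. \<integral>\<^sup>+y. \<integral>\<^sup>+u. ?f r x y u \<partial>slope_law b \<partial>pos_law b \<partial>pos_law a \<partial>lborel)"
    by (simp add: nn_integral_add nn_integral_cmult)
  finally show ?thesis by (simp only: mean_sum_def c)
qed

text \<open>The start and the two runs match the three terms of \<open>mean_sum_LOne\<close>.
  Shifting the size by the norm of the resting factor turns the window of one factor into the window
  of the sum of norms, and the minus sign of the resting point disappears by
  \<open>pos_law_neg\<close>.\<close>

lemma mean_sum_concat2:
  assumes [measurable]: "c \<in> borel_measurable borel" "k \<in> borel_measurable borel"
  shows "mean_sum b (\<lambda>(\<sigma>, y). (\<integral>\<^sup>+x. c (\<bar>fst x\<bar> + \<sigma>, snd x + y) \<partial>pos_law a)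
              + ennreal (2 * real (hdim a)) * (\<integral>\<^sup>+r. \<integral>\<^sup>+x. \<integral>\<^sup>+u. k (r + \<sigma>, snd x + y, u) * win (fst x) r \<partial>slope_law a \<partial>pos_law a \<partial>lborel))
          (\<lambda>(\<sigma>, y, u). \<integral>\<^sup>+x. k (\<bar>fst x\<bar> + \<sigma>, - snd x + y, u) \<partial>pos_law a)
    = mean_sum (LOne a b) c k"
proof -
  interpret A: sigma_finite_measure "pos_law a" by (rule sigma_finite_pos_law)
  interpret B: sigma_finite_measure "pos_law b" by (rule sigma_finite_pos_law)
  interpret NA: sigma_finite_measure "slope_law a" by (rule sigma_finite_slope_law)
  interpret NB: sigma_finite_measure "slope_law b" by (rule sigma_finite_slope_law)
  let ?f = "\<lambda>r x y u. k (r, snd x + snd y, u) * win (\<bar>fst x\<bar> + \<bar>fst y\<bar>) r"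
  let ?R = "\<lambda>y. \<integral>\<^sup>+r. \<integral>\<^sup>+x. \<integral>\<^sup>+u. k (r + \<bar>fst y\<bar>, snd x + snd y, u) * win (fst x) r \<partial>slope_law a \<partial>pos_law a \<partial>lborel"
  have 1: "(\<integral>\<^sup>+y. (\<integral>\<^sup>+x. c (\<bar>fst x\<bar> + \<bar>fst y\<bar>, snd x + snd y) \<partial>pos_law a) + ennreal (2 * real (hdim a)) * ?R y \<partial>pos_law b)
    = (\<integral>\<^sup>+x. \<integral>\<^sup>+y. c (\<bar>fst x\<bar> + \<bar>fst y\<bar>, snd x + snd y) \<partial>pos_law b \<partial>pos_law a) + ennreal (2 * real (hdim a)) * (\<integral>\<^sup>+y. ?R y \<partial>pos_law b)"
  proof -
    have "(\<integral>\<^sup>+y. \<integral>\<^sup>+x. c (\<bar>fst x\<bar> + \<bar>fst y\<bar>, snd x + snd y) \<partial>pos_law a \<partial>pos_law b) = (\<integral>\<^sup>+x. \<integral>\<^sup>+y. c (\<bar>fst x\<bar> + \<bar>fst y\<bar>, snd x + snd y) \<partial>pos_law b \<partial>pos_law a)"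
      by (intro nn_integral_Tonelli sigma_finite_pos_law) measurable
    then show ?thesis by (simp add: nn_integral_add nn_integral_cmult)
  qed
  have R: "?R y = (\<integral>\<^sup>+r. \<integral>\<^sup>+x. \<integral>\<^sup>+u. ?f r x y u \<partial>slope_law a \<partial>pos_law a \<partial>lborel)" for y
  proof -
    have "(\<integral>\<^sup>+r. \<integral>\<^sup>+x. \<integral>\<^sup>+u. ?f (\<bar>fst y\<bar> + r) x y u \<partial>slope_law a \<partial>pos_law a \<partial>lborel) = (\<integral>\<^sup>+r. \<integral>\<^sup>+x. \<integral>\<^sup>+u. ?f r x y u \<partial>slope_law a \<partial>pos_law a \<partial>lborel)"
      by (rule nn_integral_shift) measurable
    moreover have "win (\<bar>x\<bar> + \<bar>fst y\<bar>) (\<bar>fst y\<bar> + r) = win x r" for x r by (auto simp: win_def)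
    ultimately show ?thesis by (simp add: add.commute)
  qed
  have 2: "(\<integral>\<^sup>+y. ?R y \<partial>pos_law b) = (\<integral>\<^sup>+r. \<integral>\<^sup>+x. \<integral>\<^sup>+y. \<integral>\<^sup>+u. ?f r x y u \<partial>slope_law a \<partial>pos_law b \<partial>pos_law a \<partial>lborel)"
  proof -
    have "(\<integral>\<^sup>+y. ?R y \<partial>pos_law b) = (\<integral>\<^sup>+r. \<integral>\<^sup>+y. \<integral>\<^sup>+x. \<integral>\<^sup>+u. ?f r x y u \<partial>slope_law a \<partial>pos_law a \<partial>pos_law b \<partial>lborel)"
      unfolding R by (intro nn_integral_Tonelli sigma_finite_pos_law sigma_finite_lborel) measurable
    also have "\<dots> = (\<integral>\<^sup>+r. \<integral>\<^sup>+x. \<integral>\<^sup>+y. \<integral>\<^sup>+u. ?f r x y u \<partial>slope_law a \<partial>pos_law b \<partial>pos_law a \<partial>lborel)"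
      by (intro nn_integral_cong nn_integral_Tonelli sigma_finite_pos_law sigma_finite_lborel) measurable
    finally show ?thesis .
  qed
  let ?g = "\<lambda>r x y u. k (\<bar>fst x\<bar> + r, - snd x + snd y, u) * win (fst y) r"
  have 3: "occ_sum b (\<lambda>(\<sigma>, y, u). \<integral>\<^sup>+x. k (\<bar>fst x\<bar> + \<sigma>, - snd x + y, u) \<partial>pos_law a)
    = (\<integral>\<^sup>+r. \<integral>\<^sup>+x. \<integral>\<^sup>+y. \<integral>\<^sup>+u. ?f r x y u \<partial>slope_law b \<partial>pos_law b \<partial>pos_law a \<partial>lborel)"
  proof -
    have "occ_sum b (\<lambda>(\<sigma>, y, u). \<integral>\<^sup>+x. k (\<bar>fst x\<bar> + \<sigma>, - snd x + y, u) \<partial>pos_law a)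
      = (\<integral>\<^sup>+r. \<integral>\<^sup>+y. \<integral>\<^sup>+u. \<integral>\<^sup>+x. ?g r x y u \<partial>pos_law a \<partial>slope_law b \<partial>pos_law b \<partial>lborel)"
      by (simp add: occ_sum_def nn_integral_multc)
    also have "\<dots> = (\<integral>\<^sup>+r. \<integral>\<^sup>+y. \<integral>\<^sup>+x. \<integral>\<^sup>+u. ?g r x y u \<partial>slope_law b \<partial>pos_law a \<partial>pos_law b \<partial>lborel)"
      by (intro nn_integral_cong nn_integral_Tonelli sigma_finite_pos_law sigma_finite_slope_law) measurable
    also have "\<dots> = (\<integral>\<^sup>+r. \<integral>\<^sup>+x. \<integral>\<^sup>+y. \<integral>\<^sup>+u. ?g r x y u \<partial>slope_law b \<partial>pos_law b \<partial>pos_law a \<partial>lborel)"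
      by (intro nn_integral_cong nn_integral_Tonelli sigma_finite_pos_law sigma_finite_slope_law) measurable
    also have "\<dots> = (\<integral>\<^sup>+x. \<integral>\<^sup>+r. \<integral>\<^sup>+y. \<integral>\<^sup>+u. ?g r x y u \<partial>slope_law b \<partial>pos_law b \<partial>lborel \<partial>pos_law a)"
      by (intro nn_integral_Tonelli sigma_finite_pos_law sigma_finite_lborel) measurable
    also have "\<dots> = (\<integral>\<^sup>+x. \<integral>\<^sup>+r. \<integral>\<^sup>+y. \<integral>\<^sup>+u. ?f r (fst x, - snd x) y u \<partial>slope_law b \<partial>pos_law b \<partial>lborel \<partial>pos_law a)"
    proof (rule nn_integral_cong)
      fix x :: "real \<times> real"
      have "(\<integral>\<^sup>+r. \<integral>\<^sup>+y. \<integral>\<^sup>+u. ?f (\<bar>fst x\<bar> + r) (fst x, - snd x) y u \<partial>slope_law b \<partial>pos_law b \<partial>lborel) = (\<integral>\<^sup>+r. \<integral>\<^sup>+y. \<integral>\<^sup>+u. ?f r (fst x, - snd x) y u \<partial>slope_law b \<partial>pos_law b \<partial>lborel)"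
        by (rule nn_integral_shift) measurable
      moreover have "win (\<bar>fst x\<bar> + \<bar>y\<bar>) (\<bar>fst x\<bar> + r) = win y r" for y r by (auto simp: win_def)
      ultimately show "(\<integral>\<^sup>+r. \<integral>\<^sup>+y. \<integral>\<^sup>+u. ?g r x y u \<partial>slope_law b \<partial>pos_law b \<partial>lborel) = (\<integral>\<^sup>+r. \<integral>\<^sup>+y. \<integral>\<^sup>+u. ?f r (fst x, - snd x) y u \<partial>slope_law b \<partial>pos_law b \<partial>lborel)"
        by simp
    qed
    also have "\<dots> = (\<integral>\<^sup>+x. \<integral>\<^sup>+r. \<integral>\<^sup>+y. \<integral>\<^sup>+u. ?f r x y u \<partial>slope_law b \<partial>pos_law b \<partial>lborel \<partial>pos_law a)"
      using quasi_invD[OF pos_law_neg, of "\<lambda>x. \<integral>\<^sup>+r. \<integral>\<^sup>+y. \<integral>\<^sup>+u. ?f r x y u \<partial>slope_law b \<partial>pos_law b \<partial>lborel" a] by simp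
    also have "\<dots> = (\<integral>\<^sup>+r. \<integral>\<^sup>+x. \<integral>\<^sup>+y. \<integral>\<^sup>+u. ?f r x y u \<partial>slope_law b \<partial>pos_law b \<partial>pos_law a \<partial>lborel)"
      by (intro nn_integral_Tonelli sigma_finite_pos_law sigma_finite_lborel) measurable
    finally show ?thesis .
  qed
  show ?thesis
    unfolding mean_sum_LOne[OF assms] mean_sum_def[of b] 3 split_conv 1 2 by (simp only: add.assoc)
qed

text \<open>Dominance on concatenations is dominance in the first path for every fixed second path.
  Traceability of \<open>a\<close> integrates the first path out, and what remains is a dominance in
  the second path, to which traceability of \<open>b\<close> applies.\<close>

lemma traceable_LOne:
  assumes a: "traceable a" and b: "traceable b" shows "traceable (LOne a b)"
  unfolding traceable_def
proof (intro ballI impI)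
  fix c d :: "real \<times> real \<Rightarrow> ennreal" and k h :: "real \<times> real \<times> real \<Rightarrow> ennreal"
  assume m[measurable]: "c \<in> borel_measurable borel" "k \<in> borel_measurable borel" "d \<in> borel_measurable borel" "h \<in> borel_measurable borel"
    and dom: "path_dominated c k d h"
  interpret A: sigma_finite_measure "pos_law a" by (rule sigma_finite_pos_law)
  interpret NA: sigma_finite_measure "slope_law a" by (rule sigma_finite_slope_law)
  let ?c2 = "\<lambda>c k (\<sigma>, y). (\<integral>\<^sup>+x. c (\<bar>fst x\<bar> + \<sigma>, snd x + y) \<partial>pos_law a)
              + ennreal (2 * real (hdim a)) * (\<integral>\<^sup>+r. \<integral>\<^sup>+x. \<integral>\<^sup>+u. k (r + \<sigma>, snd x + y, u) * win (fst x) r \<partial>slope_law a \<partial>pos_law a \<partial>lborel)"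
  let ?k2 = "\<lambda>k (\<sigma>, y, u). \<integral>\<^sup>+x. k (\<bar>fst x\<bar> + \<sigma>, - snd x + y, u) \<partial>pos_law a"
  have "path_dominated (?c2 c k) (?k2 k) (?c2 d h) (?k2 h)"
    unfolding path_dominated_def
  proof (intro allI impI)
    fix r2 Z v assume r2: "r2 > 0" and q: "apath r2 Z v"
    note Z[measurable] = apathD(1,2)[OF q]
    let ?c1 = "\<lambda>c k (\<rho>, y). c (\<rho> + r2, y + Z 0) + (\<integral>\<^sup>+t. k (\<rho> + r2, - y + Z t, v t) * win (t - r2) r2 \<partial>lborel)"
    let ?k1 = "\<lambda>k (\<rho>, y, u). k (\<rho> + r2, y + Z 0, u)"
    have "path_dominated (?c1 c k) (?k1 k) (?c1 d h) (?k1 h)"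
      unfolding path_dominated_def
    proof (intro allI impI)
      fix r1 Y w assume r1: "r1 > 0" and p: "apath r1 Y w"
      show "path_sum (?c1 c k) (?k1 k) r1 Y w \<le> path_sum (?c1 d h) (?k1 h) r1 Y w"
        unfolding path_sum_concat[OF p q r1 r2 m(2), symmetric] path_sum_concat[OF p q r1 r2 m(4), symmetric]
        using dom apath_concat[OF p q r1 r2] r1 r2 unfolding path_dominated_def by auto
    qed
    moreover have "?c1 c k \<in> borel_measurable borel" "?k1 k \<in> borel_measurable borel" "?c1 d h \<in> borel_measurable borel" "?k1 h \<in> borel_measurable borel"
      by measurable
    ultimately have "mean_sum a (?c1 c k) (?k1 k) \<le> mean_sum a (?c1 d h) (?k1 h)"
      using a unfolding traceable_def by blast
    then show "path_sum (?c2 c k) (?k2 k) r2 Z v \<le> path_sum (?c2 d h) (?k2 h) r2 Z v"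
      unfolding mean_sum_concat1[OF m(1,2) Z] mean_sum_concat1[OF m(3,4) Z] .
  qed
  moreover have "?c2 c k \<in> borel_measurable borel" "?k2 k \<in> borel_measurable borel" "?c2 d h \<in> borel_measurable borel" "?k2 h \<in> borel_measurable borel"
    by measurable
  ultimately have "mean_sum b (?c2 c k) (?k2 k) \<le> mean_sum b (?c2 d h) (?k2 h)"
    using b unfolding traceable_def by blast
  then show "mean_sum (LOne a b) c k \<le> mean_sum (LOne a b) d h"
    unfolding mean_sum_concat2[OF m(1,2)] mean_sum_concat2[OF m(3,4)] .
qed

section \<open>The product: simultaneous motion with a random phase\<close>

lemma nn_integral_rotate:
  fixes L :: "real \<Rightarrow> ennreal"
  assumes [measurable]: "L \<in> borel_measurable borel" and t: "0 \<le> t" "t \<le> 2 * r"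
  shows "(\<integral>\<^sup>+c. (if t + c \<le> 2 * r then L (t + c) else L (t + c - 2 * r)) * win (c - r) r \<partial>lborel)
    = (\<integral>\<^sup>+c. L c * win (c - r) r \<partial>lborel)"
proof -
  have "(\<integral>\<^sup>+c. (if t + c \<le> 2 * r then L (t + c) else L (t + c - 2 * r)) * win (c - r) r \<partial>lborel)
    = (\<integral>\<^sup>+c. L (t + c) * indicator {t..2 * r} (t + c) + L ((t - 2 * r) + c) * indicator {0<..t} ((t - 2 * r) + c) \<partial>lborel)"
    using t by (intro nn_integral_cong) (auto simp: win_def indicator_def abs_le_iff algebra_simps)
  also have "\<dots> = (\<integral>\<^sup>+c. L (t + c) * indicator {t..2 * r} (t + c) \<partial>lborel) + (\<integral>\<^sup>+c. L ((t - 2 * r) + c) * indicator {0<..t} ((t - 2 * r) + c) \<partial>lborel)"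
    by (rule nn_integral_add) measurable
  also have "(\<integral>\<^sup>+c. L (t + c) * indicator {t..2 * r} (t + c) \<partial>lborel) = (\<integral>\<^sup>+c. L c * indicator {t..2 * r} c \<partial>lborel)"
    by (rule nn_integral_shift[of "\<lambda>c. L c * indicator {t..2 * r} c"]) measurable
  also have "(\<integral>\<^sup>+c. L ((t - 2 * r) + c) * indicator {0<..t} ((t - 2 * r) + c) \<partial>lborel) = (\<integral>\<^sup>+c. L c * indicator {0<..t} c \<partial>lborel)"
    by (rule nn_integral_shift[of "\<lambda>c. L c * indicator {0<..t} c"]) measurable
  also have "(\<integral>\<^sup>+c. L c * indicator {t..2 * r} c \<partial>lborel) + (\<integral>\<^sup>+c. L c * indicator {0<..t} c \<partial>lborel)
    = (\<integral>\<^sup>+c. L c * indicator {t..2 * r} c + L c * indicator {0<..t} c \<partial>lborel)"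
    by (rule nn_integral_add[symmetric]) measurable
  also have "\<dots> = (\<integral>\<^sup>+c. L c * win (c - r) r \<partial>lborel)"
  proof (rule nn_integral_cong_AE)
    have "AE c in lborel. c \<noteq> t \<and> c \<noteq> 0" using AE_lborel_singleton[of t] AE_lborel_singleton[of "0::real"] by eventually_elim auto
    then show "AE c in lborel. L c * indicator {t..2 * r} c + L c * indicator {0<..t} c = L c * win (c - r) r"
      by eventually_elim (use t in \<open>auto simp: win_def indicator_def abs_le_iff\<close>)
  qed
  finally show ?thesis .
qed

text \<open>Symmetrising over \<open>\<plusminus>\<close> makes the anti-periodic continuation of the second path genuinely periodic.\<close>

lemma path_sum_shift_average:
  assumes p: "apath r Y w" and q: "apath r Z v"
    and [measurable]: "c \<in> borel_measurable borel" "k \<in> borel_measurable borel"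
  shows "(\<integral>\<^sup>+\<tau>. (path_sum c k r (\<lambda>t. Y t + ashift r \<tau> Z t) (\<lambda>t. w t + ashift r \<tau> v t)
      + path_sum c k r (\<lambda>t. Y t + - ashift r \<tau> Z t) (\<lambda>t. w t + - ashift r \<tau> v t)) * win (\<tau> - r) r \<partial>lborel)
    = (\<integral>\<^sup>+\<tau>. (c (r, Y 0 + Z \<tau>) + c (r, Y 0 - Z \<tau>)
        + (\<integral>\<^sup>+t. (k (r, Y t + Z \<tau>, w t + v \<tau>) + k (r, Y t - Z \<tau>, w t - v \<tau>)) * win (t - r) r \<partial>lborel)) * win (\<tau> - r) r \<partial>lborel)"
proof -
  note [measurable] = apathD(1,2)[OF p] apathD(1,2)[OF q]
  let ?F = "\<lambda>t \<tau>. k (r, Y t + ashift r \<tau> Z t, w t + ashift r \<tau> v t) + k (r, Y t - ashift r \<tau> Z t, w t - ashift r \<tau> v t)"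
  let ?G = "\<lambda>t \<tau>. k (r, Y t + Z \<tau>, w t + v \<tau>) + k (r, Y t - Z \<tau>, w t - v \<tau>)"
  let ?C = "\<lambda>\<tau>. c (r, Y 0 + Z \<tau>) + c (r, Y 0 - Z \<tau>)"
  \<comment> \<open>For fixed \<open>t\<close>, rotating \<open>\<tau>\<close> by \<open>t\<close>
    uncouples the two paths: afterwards their times are independent, each uniform over its own
    period.\<close>
  have rot: "(\<integral>\<^sup>+\<tau>. ?F t \<tau> * win (\<tau> - r) r \<partial>lborel) * win (t - r) r = (\<integral>\<^sup>+\<tau>. ?G t \<tau> * win (\<tau> - r) r \<partial>lborel) * win (t - r) r" for t
  proof (cases "0 \<le> t \<and> t \<le> 2 * r")
    case True
    have "?F t \<tau> = (if t + \<tau> \<le> 2 * r then ?G t (t + \<tau>) else ?G t (t + \<tau> - 2 * r))" for \<tau>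
      by (auto simp: ashift_def add.commute)
    then show ?thesis using nn_integral_rotate[of "?G t" t r] True by simp
  next
    case False
    then have "win (t - r) r = 0" by (auto simp: win_def)
    then show ?thesis by simp
  qed
  have "(\<integral>\<^sup>+\<tau>. (path_sum c k r (\<lambda>t. Y t + ashift r \<tau> Z t) (\<lambda>t. w t + ashift r \<tau> v t)
      + path_sum c k r (\<lambda>t. Y t + - ashift r \<tau> Z t) (\<lambda>t. w t + - ashift r \<tau> v t)) * win (\<tau> - r) r \<partial>lborel)
    = (\<integral>\<^sup>+\<tau>. ?C \<tau> * win (\<tau> - r) r + (\<integral>\<^sup>+t. ?F t \<tau> * win (t - r) r * win (\<tau> - r) r \<partial>lborel) \<partial>lborel)"
  proof (rule nn_integral_cong)
    fix \<tau>
    show "(path_sum c k r (\<lambda>t. Y t + ashift r \<tau> Z t) (\<lambda>t. w t + ashift r \<tau> v t)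
      + path_sum c k r (\<lambda>t. Y t + - ashift r \<tau> Z t) (\<lambda>t. w t + - ashift r \<tau> v t)) * win (\<tau> - r) r
      = ?C \<tau> * win (\<tau> - r) r + (\<integral>\<^sup>+t. ?F t \<tau> * win (t - r) r * win (\<tau> - r) r \<partial>lborel)"
    proof (cases "0 \<le> \<tau> \<and> \<tau> \<le> 2 * r")
      case True
      then have "ashift r \<tau> Z 0 = Z \<tau>" by (simp add: ashift_def)
      then show ?thesis by (simp add: path_sum_def nn_integral_multc nn_integral_add distrib_right add_ac)
    next
      case False
      then have "win (\<tau> - r) r = 0" by (auto simp: win_def)
      then show ?thesis by simp
    qed
  qed
  also have "\<dots> = (\<integral>\<^sup>+\<tau>. ?C \<tau> * win (\<tau> - r) r \<partial>lborel) + (\<integral>\<^sup>+\<tau>. \<integral>\<^sup>+t. ?F t \<tau> * win (t - r) r * win (\<tau> - r) r \<partial>lborel \<partial>lborel)"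
    by (rule nn_integral_add) measurable
  also have "(\<integral>\<^sup>+\<tau>. \<integral>\<^sup>+t. ?F t \<tau> * win (t - r) r * win (\<tau> - r) r \<partial>lborel \<partial>lborel) = (\<integral>\<^sup>+t. \<integral>\<^sup>+\<tau>. ?F t \<tau> * win (t - r) r * win (\<tau> - r) r \<partial>lborel \<partial>lborel)"
    by (intro nn_integral_Tonelli sigma_finite_lborel) measurable
  also have "\<dots> = (\<integral>\<^sup>+t. (\<integral>\<^sup>+\<tau>. ?F t \<tau> * win (\<tau> - r) r \<partial>lborel) * win (t - r) r \<partial>lborel)"
    by (subst nn_integral_multc[symmetric], measurable) (simp add: mult_ac)
  also have "\<dots> = (\<integral>\<^sup>+t. (\<integral>\<^sup>+\<tau>. ?G t \<tau> * win (\<tau> - r) r \<partial>lborel) * win (t - r) r \<partial>lborel)"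
    unfolding rot ..
  also have "\<dots> = (\<integral>\<^sup>+t. \<integral>\<^sup>+\<tau>. ?G t \<tau> * win (t - r) r * win (\<tau> - r) r \<partial>lborel \<partial>lborel)"
    by (subst nn_integral_multc[symmetric], measurable) (simp add: mult_ac)
  also have "\<dots> = (\<integral>\<^sup>+\<tau>. \<integral>\<^sup>+t. ?G t \<tau> * win (t - r) r * win (\<tau> - r) r \<partial>lborel \<partial>lborel)"
    by (intro nn_integral_Tonelli sigma_finite_lborel) measurable
  also have "\<dots> = (\<integral>\<^sup>+\<tau>. (\<integral>\<^sup>+t. ?G t \<tau> * win (t - r) r \<partial>lborel) * win (\<tau> - r) r \<partial>lborel)"
    by (intro nn_integral_cong nn_integral_multc) measurable
  also have "(\<integral>\<^sup>+\<tau>. ?C \<tau> * win (\<tau> - r) r \<partial>lborel) + \<dots> = (\<integral>\<^sup>+\<tau>. (?C \<tau> + (\<integral>\<^sup>+t. ?G t \<tau> * win (t - r) r \<partial>lborel)) * win (\<tau> - r) r \<partial>lborel)"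
    unfolding distrib_right by (rule nn_integral_add[symmetric]) measurable
  finally show ?thesis .
qed

lemma start_slope_neg:
  assumes [measurable]: "f \<in> borel_measurable borel"
  shows "(\<integral>\<^sup>+x. \<integral>\<^sup>+w. f (fst x, - snd x, - w) \<partial>slope_law T \<partial>pos_law T) = (\<integral>\<^sup>+x. \<integral>\<^sup>+w. f (fst x, snd x, w) \<partial>slope_law T \<partial>pos_law T)"
proof -
  interpret N: sigma_finite_measure "slope_law T" by (rule sigma_finite_slope_law)
  have "(\<integral>\<^sup>+w. f (fst x, - snd x, - w) \<partial>slope_law T) = (\<integral>\<^sup>+w. f (fst x, - snd x, w) \<partial>slope_law T)" for x
    by (rule slope_law_neg[of "\<lambda>w. f (fst x, - snd x, w)"]) measurable
  then show ?thesis
    using quasi_invD[OF pos_law_neg, of "\<lambda>x. \<integral>\<^sup>+w. f (fst x, snd x, w) \<partial>slope_law T" T] by simp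
qed

text \<open>Starts at which the first factor has norm \<open>r\<close> and the second, of norm at
  most \<open>r\<close>, has been integrated out. The companion \<open>max_occ\<close> also averages
  over the slope of the second factor, independently of its position.\<close>

definition max_start :: "real htree \<Rightarrow> (real \<times> real \<Rightarrow> ennreal) \<Rightarrow> real \<times> real \<Rightarrow> ennreal" where
  "max_start b c = (\<lambda>(r, y). \<integral>\<^sup>+z. c (r, y + snd z) * win (fst z) r \<partial>pos_law b)"

definition max_occ :: "real htree \<Rightarrow> (real \<times> real \<times> real \<Rightarrow> ennreal) \<Rightarrow> real \<times> real \<times> real \<Rightarrow> ennreal" where
  "max_occ b k = (\<lambda>(r, y, u). \<integral>\<^sup>+z. \<integral>\<^sup>+v. k (r, y + snd z, u + v) * win (fst z) r \<partial>slope_law b \<partial>pos_law b)"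

lemma max_start_measurable [measurable]: "c \<in> borel_measurable borel \<Longrightarrow> max_start b c \<in> borel_measurable borel"
proof -
  assume [measurable]: "c \<in> borel_measurable borel"
  interpret B: sigma_finite_measure "pos_law b" by (rule sigma_finite_pos_law)
  show ?thesis unfolding max_start_def by measurable
qed

lemma max_occ_measurable [measurable]: "k \<in> borel_measurable borel \<Longrightarrow> max_occ b k \<in> borel_measurable borel"
proof -
  assume [measurable]: "k \<in> borel_measurable borel"
  interpret B: sigma_finite_measure "pos_law b" by (rule sigma_finite_pos_law)
  interpret N: sigma_finite_measure "slope_law b" by (rule sigma_finite_slope_law)
  show ?thesis unfolding max_occ_def by measurable
qed

text \<open>The symmetrised functional is averaged over the second factor. By
  \<open>start_slope_neg\<close> both signs contribute equally, hence the factor 2.\<close>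

lemma path_sum_max:
  assumes p: "apath r Y w" and [measurable]: "c \<in> borel_measurable borel" "k \<in> borel_measurable borel"
  shows "(\<integral>\<^sup>+z. \<integral>\<^sup>+v. (c (r, Y 0 + snd z) + c (r, Y 0 - snd z)
        + (\<integral>\<^sup>+t. (k (r, Y t + snd z, w t + v) + k (r, Y t - snd z, w t - v)) * win (t - r) r \<partial>lborel)) * win (fst z) r \<partial>slope_law b \<partial>pos_law b)
    = 2 * path_sum (max_start b c) (max_occ b k) r Y w"
proof -
  interpret B: sigma_finite_measure "pos_law b" by (rule sigma_finite_pos_law)
  interpret N: prob_space "slope_law b" by (rule prob_space_slope_law)
  note [measurable] = apathD(1,2)[OF p]
  have one: "emeasure (slope_law b) UNIV = 1" using N.emeasure_space_1 by simp
  let ?C1 = "\<integral>\<^sup>+z. c (r, Y 0 + snd z) * win (fst z) r \<partial>pos_law b"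
  let ?C2 = "\<integral>\<^sup>+z. c (r, Y 0 - snd z) * win (fst z) r \<partial>pos_law b"
  let ?K1 = "\<lambda>t. \<integral>\<^sup>+z. \<integral>\<^sup>+v. k (r, Y t + snd z, w t + v) * win (fst z) r \<partial>slope_law b \<partial>pos_law b"
  let ?K2 = "\<lambda>t. \<integral>\<^sup>+z. \<integral>\<^sup>+v. k (r, Y t - snd z, w t - v) * win (fst z) r \<partial>slope_law b \<partial>pos_law b"
  have C2: "?C2 = ?C1"
    using start_slope_neg[of "\<lambda>p. c (r, Y 0 + fst (snd p)) * win (fst p) r" b] by (simp add: one)
  have K2: "?K2 t = ?K1 t" for t
    using start_slope_neg[of "\<lambda>p. k (r, Y t + fst (snd p), w t + snd (snd p)) * win (fst p) r" b] by simp
  have "(\<integral>\<^sup>+z. \<integral>\<^sup>+v. (c (r, Y 0 + snd z) + c (r, Y 0 - snd z)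
        + (\<integral>\<^sup>+t. (k (r, Y t + snd z, w t + v) + k (r, Y t - snd z, w t - v)) * win (t - r) r \<partial>lborel)) * win (fst z) r \<partial>slope_law b \<partial>pos_law b)
    = (\<integral>\<^sup>+z. c (r, Y 0 + snd z) * win (fst z) r + c (r, Y 0 - snd z) * win (fst z) r
      + (\<integral>\<^sup>+v. (\<integral>\<^sup>+t. (k (r, Y t + snd z, w t + v) + k (r, Y t - snd z, w t - v)) * win (t - r) r \<partial>lborel) * win (fst z) r \<partial>slope_law b) \<partial>pos_law b)"
    unfolding distrib_right by (simp add: nn_integral_add one)
  also have "\<dots> = ?C1 + ?C2 + (\<integral>\<^sup>+z. \<integral>\<^sup>+v. (\<integral>\<^sup>+t. (k (r, Y t + snd z, w t + v) + k (r, Y t - snd z, w t - v)) * win (t - r) r \<partial>lborel) * win (fst z) r \<partial>slope_law b \<partial>pos_law b)"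
    by (simp add: nn_integral_add)
  also have "(\<integral>\<^sup>+z. \<integral>\<^sup>+v. (\<integral>\<^sup>+t. (k (r, Y t + snd z, w t + v) + k (r, Y t - snd z, w t - v)) * win (t - r) r \<partial>lborel) * win (fst z) r \<partial>slope_law b \<partial>pos_law b)
    = (\<integral>\<^sup>+z. \<integral>\<^sup>+v. \<integral>\<^sup>+t. (k (r, Y t + snd z, w t + v) + k (r, Y t - snd z, w t - v)) * win (t - r) r * win (fst z) r \<partial>lborel \<partial>slope_law b \<partial>pos_law b)"
    by (simp add: nn_integral_multc)
  also have "\<dots> = (\<integral>\<^sup>+z. \<integral>\<^sup>+t. \<integral>\<^sup>+v. (k (r, Y t + snd z, w t + v) + k (r, Y t - snd z, w t - v)) * win (t - r) r * win (fst z) r \<partial>slope_law b \<partial>lborel \<partial>pos_law b)"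
    by (intro nn_integral_cong nn_integral_Tonelli sigma_finite_slope_law sigma_finite_lborel) measurable
  also have "\<dots> = (\<integral>\<^sup>+t. \<integral>\<^sup>+z. \<integral>\<^sup>+v. (k (r, Y t + snd z, w t + v) + k (r, Y t - snd z, w t - v)) * win (t - r) r * win (fst z) r \<partial>slope_law b \<partial>pos_law b \<partial>lborel)"
    by (intro nn_integral_Tonelli sigma_finite_pos_law sigma_finite_lborel) measurable
  also have "\<dots> = (\<integral>\<^sup>+t. (?K1 t + ?K2 t) * win (t - r) r \<partial>lborel)"
  proof (rule nn_integral_cong)
    fix t
    have "(\<integral>\<^sup>+z. \<integral>\<^sup>+v. (k (r, Y t + snd z, w t + v) + k (r, Y t - snd z, w t - v)) * win (t - r) r * win (fst z) r \<partial>slope_law b \<partial>pos_law b)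
      = (\<integral>\<^sup>+z. \<integral>\<^sup>+v. (k (r, Y t + snd z, w t + v) * win (fst z) r + k (r, Y t - snd z, w t - v) * win (fst z) r) * win (t - r) r \<partial>slope_law b \<partial>pos_law b)"
      by (simp only: distrib_left distrib_right mult_ac)
    also have "\<dots> = (?K1 t + ?K2 t) * win (t - r) r"
      by (simp add: nn_integral_multc nn_integral_add)
    finally show "(\<integral>\<^sup>+z. \<integral>\<^sup>+v. (k (r, Y t + snd z, w t + v) + k (r, Y t - snd z, w t - v)) * win (t - r) r * win (fst z) r \<partial>slope_law b \<partial>pos_law b)
      = (?K1 t + ?K2 t) * win (t - r) r" .
  qed
  also have "\<dots> = 2 * (\<integral>\<^sup>+t. ?K1 t * win (t - r) r \<partial>lborel)"
    unfolding K2 by (subst nn_integral_cmult[symmetric], measurable) (simp add: mult_2 distrib_right)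
  finally show ?thesis
    unfolding C2 by (simp add: path_sum_def max_start_def max_occ_def mult_2 add_ac)
qed

text \<open>This is the contribution of starts at which \<open>a\<close> has the larger norm
  \<open>r\<close>. Fix the path in \<open>a\<close>. Adding to it a path of \<open>b\<close> of the
  same size, shifted by any phase and with either sign, gives an antiperiodic path, to which the
  dominance applies. Averaging over the phase leaves an occupation functional of the path in
  \<open>b\<close>, and \<open>traceable_fixed_size\<close> replaces it by the ball of radius
  \<open>r\<close>.\<close>

lemma traceable_LInf_half:
  assumes a: "traceable a" and b: "traceable b"
    and m[measurable]: "c \<in> borel_measurable borel" "k \<in> borel_measurable borel" "d \<in> borel_measurable borel" "h \<in> borel_measurable borel"
    and dom: "path_dominated c k d h"
  shows "mean_sum a (max_start b c) (max_occ b k) \<le> mean_sum a (max_start b d) (max_occ b h)"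
proof -
  have "path_dominated (max_start b c) (max_occ b k) (max_start b d) (max_occ b h)"
    unfolding path_dominated_def
  proof (intro allI impI)
    fix r Y w assume r: "r > 0" and p: "apath r Y w"
    note [measurable] = apathD(1,2)[OF p]
    \<comment> \<open>Seen as an occupation integrand for the second path: the phase plays the role
      of its running time.\<close>
    let ?k = "\<lambda>c k (z, v). c (r, Y 0 + z) + c (r, Y 0 - z)
        + (\<integral>\<^sup>+t. (k (r, Y t + z, w t + v) + k (r, Y t - z, w t - v)) * win (t - r) r \<partial>lborel)"
    have km: "?k c k \<in> borel_measurable borel" "?k d h \<in> borel_measurable borel" by measurable
    have "(\<integral>\<^sup>+z. \<integral>\<^sup>+v. ?k c k (snd z, v) * win (fst z) r \<partial>slope_law b \<partial>pos_law b)
      \<le> (\<integral>\<^sup>+z. \<integral>\<^sup>+v. ?k d h (snd z, v) * win (fst z) r \<partial>slope_law b \<partial>pos_law b)"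
    proof (rule traceable_fixed_size[OF b r km])
      fix Z v assume q: "apath r Z v"
      show "(\<integral>\<^sup>+t. ?k c k (Z t, v t) * win (t - r) r \<partial>lborel) \<le> (\<integral>\<^sup>+t. ?k d h (Z t, v t) * win (t - r) r \<partial>lborel)"
        unfolding split_conv path_sum_shift_average[OF p q m(1,2), symmetric] path_sum_shift_average[OF p q m(3,4), symmetric]
      proof (rule nn_integral_mono)
        fix \<tau>
        show "(path_sum c k r (\<lambda>t. Y t + ashift r \<tau> Z t) (\<lambda>t. w t + ashift r \<tau> v t)
          + path_sum c k r (\<lambda>t. Y t + - ashift r \<tau> Z t) (\<lambda>t. w t + - ashift r \<tau> v t)) * win (\<tau> - r) r
          \<le> (path_sum d h r (\<lambda>t. Y t + ashift r \<tau> Z t) (\<lambda>t. w t + ashift r \<tau> v t)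
          + path_sum d h r (\<lambda>t. Y t + - ashift r \<tau> Z t) (\<lambda>t. w t + - ashift r \<tau> v t)) * win (\<tau> - r) r"
        proof (cases "0 \<le> \<tau> \<and> \<tau> \<le> 2 * r")
          case True
          have s: "apath r (ashift r \<tau> Z) (ashift r \<tau> v)" using apath_shift[OF q] True by auto
          show ?thesis
            using dom r apath_add[OF p s] apath_add[OF p apath_neg[OF s]] unfolding path_dominated_def
            by (intro mult_right_mono add_mono) auto
        next
          case False
          then have "win (\<tau> - r) r = 0" by (auto simp: win_def)
          then show ?thesis by simp
        qed
      qed
    qed
    then have "2 * path_sum (max_start b c) (max_occ b k) r Y w \<le> 2 * path_sum (max_start b d) (max_occ b h) r Y w"
      unfolding split_conv path_sum_max[OF p m(1,2)] path_sum_max[OF p m(3,4)] .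
    then show "path_sum (max_start b c) (max_occ b k) r Y w \<le> path_sum (max_start b d) (max_occ b h) r Y w"
      by (subst (asm) ennreal_mult_le_mult_iff) auto
  qed
  then show ?thesis using a m max_start_measurable max_occ_measurable unfolding traceable_def by blast
qed

text \<open>The start term is split by which factor attains the maximum, ties being null sets. The
  occupation term is the same in both halves, and the weights \<open>2 * hdim a\<close> and
  \<open>2 * hdim b\<close> add up to the full weight.\<close>

lemma mean_sum_LInf:
  assumes [measurable]: "c \<in> borel_measurable borel" "k \<in> borel_measurable borel"
  shows "mean_sum (LInf a b) c k = mean_sum a (max_start b c) (max_occ b k) + mean_sum b (max_start a c) (max_occ a k)"
proof -
  interpret A: sigma_finite_measure "pos_law a" by (rule sigma_finite_pos_law)
  interpret B: sigma_finite_measure "pos_law b" by (rule sigma_finite_pos_law)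
  interpret NA: sigma_finite_measure "slope_law a" by (rule sigma_finite_slope_law)
  interpret NB: sigma_finite_measure "slope_law b" by (rule sigma_finite_slope_law)
  interpret N: sigma_finite_measure "slope_law (LInf a b)" by (rule sigma_finite_slope_law)
  have c: "(\<integral>\<^sup>+x. c (\<bar>fst x\<bar>, snd x) \<partial>pos_law (LInf a b))
    = (\<integral>\<^sup>+x. max_start b c (\<bar>fst x\<bar>, snd x) \<partial>pos_law a) + (\<integral>\<^sup>+y. max_start a c (\<bar>fst y\<bar>, snd y) \<partial>pos_law b)"
  proof -
    have "(\<integral>\<^sup>+x. c (\<bar>fst x\<bar>, snd x) \<partial>pos_law (LInf a b)) = (\<integral>\<^sup>+x. \<integral>\<^sup>+y. c (max \<bar>fst x\<bar> \<bar>fst y\<bar>, snd x + snd y) \<partial>pos_law b \<partial>pos_law a)"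
      unfolding pos_law.simps
      by (subst nn_integral_push_pair[OF strip_finite_pos_law strip_finite_pos_law max_pair_measurable]) (simp_all add: max_pair_def)
    also have "\<dots> = (\<integral>\<^sup>+x. \<integral>\<^sup>+y. c (\<bar>fst x\<bar>, snd x + snd y) * win (fst y) \<bar>fst x\<bar> + c (\<bar>fst y\<bar>, snd y + snd x) * win (fst x) \<bar>fst y\<bar> \<partial>pos_law b \<partial>pos_law a)"
      by (intro nn_integral_cong nn_integral_cong_AE eventually_mono[OF pos_law_null])
         (auto simp: win_def max_def add.commute)
    also have "\<dots> = (\<integral>\<^sup>+x. \<integral>\<^sup>+y. c (\<bar>fst x\<bar>, snd x + snd y) * win (fst y) \<bar>fst x\<bar> \<partial>pos_law b \<partial>pos_law a)
      + (\<integral>\<^sup>+x. \<integral>\<^sup>+y. c (\<bar>fst y\<bar>, snd y + snd x) * win (fst x) \<bar>fst y\<bar> \<partial>pos_law b \<partial>pos_law a)"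
      by (simp add: nn_integral_add)
    also have "(\<integral>\<^sup>+x. \<integral>\<^sup>+y. c (\<bar>fst y\<bar>, snd y + snd x) * win (fst x) \<bar>fst y\<bar> \<partial>pos_law b \<partial>pos_law a) = (\<integral>\<^sup>+y. \<integral>\<^sup>+x. c (\<bar>fst y\<bar>, snd y + snd x) * win (fst x) \<bar>fst y\<bar> \<partial>pos_law a \<partial>pos_law b)"
      by (intro nn_integral_Tonelli sigma_finite_pos_law) measurable
    finally show ?thesis by (simp add: max_start_def)
  qed
  let ?f = "\<lambda>r x y u v. k (r, snd x + snd y, u + v) * win (fst x) r * win (fst y) r"
  have "occ_sum (LInf a b) k = (\<integral>\<^sup>+r. \<integral>\<^sup>+x. \<integral>\<^sup>+y. \<integral>\<^sup>+u. k (r, snd x + snd y, u) * win (max \<bar>fst x\<bar> \<bar>fst y\<bar>) r \<partial>slope_law (LInf a b) \<partial>pos_law b \<partial>pos_law a \<partial>lborel)"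
    unfolding occ_sum_def pos_law.simps
    by (subst nn_integral_push_pair[OF strip_finite_pos_law strip_finite_pos_law max_pair_measurable]) (simp_all add: max_pair_def)
  also have "\<dots> = (\<integral>\<^sup>+r. \<integral>\<^sup>+x. \<integral>\<^sup>+y. \<integral>\<^sup>+u. \<integral>\<^sup>+v. ?f r x y u v \<partial>slope_law b \<partial>slope_law a \<partial>pos_law b \<partial>pos_law a \<partial>lborel)"
  proof (intro nn_integral_cong)
    fix r :: real and x y :: "real \<times> real"
    have l: "win (max \<bar>fst x\<bar> \<bar>fst y\<bar>) r = win (fst x) r * win (fst y) r" by (simp add: win_def)
    show "(\<integral>\<^sup>+u. k (r, snd x + snd y, u) * win (max \<bar>fst x\<bar> \<bar>fst y\<bar>) r \<partial>slope_law (LInf a b)) = (\<integral>\<^sup>+u. \<integral>\<^sup>+v. ?f r x y u v \<partial>slope_law b \<partial>slope_law a)"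
      unfolding l by (subst slope_law_LInf) (simp_all add: mult.assoc)
  qed
  finally have O: "occ_sum (LInf a b) k = (\<integral>\<^sup>+r. \<integral>\<^sup>+x. \<integral>\<^sup>+y. \<integral>\<^sup>+u. \<integral>\<^sup>+v. ?f r x y u v \<partial>slope_law b \<partial>slope_law a \<partial>pos_law b \<partial>pos_law a \<partial>lborel)" .
  have O1: "occ_sum a (max_occ b k) = occ_sum (LInf a b) k"
  proof -
    have "occ_sum a (max_occ b k) = (\<integral>\<^sup>+r. \<integral>\<^sup>+x. \<integral>\<^sup>+u. \<integral>\<^sup>+y. \<integral>\<^sup>+v. ?f r x y u v \<partial>slope_law b \<partial>pos_law b \<partial>slope_law a \<partial>pos_law a \<partial>lborel)"
      by (simp add: occ_sum_def max_occ_def flip: nn_integral_multc) (simp add: mult_ac)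
    also have "\<dots> = occ_sum (LInf a b) k"
      unfolding O by (intro nn_integral_cong nn_integral_Tonelli sigma_finite_pos_law sigma_finite_slope_law) measurable
    finally show ?thesis .
  qed
  have O2: "occ_sum b (max_occ a k) = occ_sum (LInf a b) k"
  proof -
    have "occ_sum b (max_occ a k) = (\<integral>\<^sup>+r. \<integral>\<^sup>+y. \<integral>\<^sup>+v. \<integral>\<^sup>+x. \<integral>\<^sup>+u. ?f r x y u v \<partial>slope_law a \<partial>pos_law a \<partial>slope_law b \<partial>pos_law b \<partial>lborel)"
      by (simp add: occ_sum_def max_occ_def flip: nn_integral_multc) (simp add: mult_ac add_ac)
    also have "\<dots> = (\<integral>\<^sup>+r. \<integral>\<^sup>+y. \<integral>\<^sup>+x. \<integral>\<^sup>+v. \<integral>\<^sup>+u. ?f r x y u v \<partial>slope_law a \<partial>slope_law b \<partial>pos_law a \<partial>pos_law b \<partial>lborel)"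
      by (intro nn_integral_cong nn_integral_Tonelli sigma_finite_pos_law sigma_finite_slope_law) measurable
    also have "\<dots> = (\<integral>\<^sup>+r. \<integral>\<^sup>+x. \<integral>\<^sup>+y. \<integral>\<^sup>+v. \<integral>\<^sup>+u. ?f r x y u v \<partial>slope_law a \<partial>slope_law b \<partial>pos_law b \<partial>pos_law a \<partial>lborel)"
      by (intro nn_integral_cong nn_integral_Tonelli sigma_finite_pos_law sigma_finite_slope_law) measurable
    also have "\<dots> = occ_sum (LInf a b) k"
      unfolding O by (intro nn_integral_cong nn_integral_Tonelli sigma_finite_pos_law sigma_finite_slope_law) measurable
    finally show ?thesis .
  qed
  have e: "ennreal (2 * real (hdim (LInf a b))) = ennreal (2 * real (hdim a)) + ennreal (2 * real (hdim b))"
    by (simp flip: ennreal_plus)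
  show ?thesis unfolding mean_sum_def c O1 O2 e by (simp only: distrib_right add_ac)
qed

lemma traceable_LInf:
  assumes a: "traceable a" and b: "traceable b" shows "traceable (LInf a b)"
  unfolding traceable_def
proof (intro ballI impI)
  fix c d :: "real \<times> real \<Rightarrow> ennreal" and k h :: "real \<times> real \<times> real \<Rightarrow> ennreal"
  assume m: "c \<in> borel_measurable borel" "k \<in> borel_measurable borel" "d \<in> borel_measurable borel" "h \<in> borel_measurable borel"
    and dom: "path_dominated c k d h"
  show "mean_sum (LInf a b) c k \<le> mean_sum (LInf a b) d h"
    unfolding mean_sum_LInf[OF m(1,2)] mean_sum_LInf[OF m(3,4)]
    by (intro add_mono traceable_LInf_half a b m dom)
qed

lemma traceable: "traceable T"
  by (induction T) (auto intro: traceable_Seg traceable_LInf traceable_LOne)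

section \<open>Zero crossings and the slab inequality\<close>

lemma has_integral_abs_le_nn_integral:
  fixes w :: "real \<Rightarrow> real"
  assumes w: "(w has_integral I) {s..t}" and m[measurable]: "w \<in> borel_measurable borel" and C: "\<And>x. \<bar>w x\<bar> \<le> C"
  shows "ennreal I \<le> (\<integral>\<^sup>+x. ennreal \<bar>w x\<bar> * indicator {s<..<t} x \<partial>lborel)"
proof -
  have int: "integrable lborel (\<lambda>x. indicat_real {s..t} x *\<^sub>R w x)"
    by (rule integrableI_bounded_set_indicator[where B=C]) (use C in \<open>auto simp: emeasure_lborel_Icc_eq\<close>)
  have "I = (LINT x|lborel. indicat_real {s..t} x *\<^sub>R w x)"
    using set_borel_integral_eq_integral(2)[of "{s..t}" w] int integral_unique[OF w]
    by (simp add: set_integrable_def set_lebesgue_integral_def)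
  then have "ennreal I \<le> ennreal (norm (LINT x|lborel. indicat_real {s..t} x *\<^sub>R w x))"
    by (intro ennreal_leI) auto
  also have "\<dots> \<le> (\<integral>\<^sup>+x. norm (indicat_real {s..t} x *\<^sub>R w x) \<partial>lborel)"
    by (rule integral_norm_bound_ennreal[OF int])
  also have "\<dots> = (\<integral>\<^sup>+x. ennreal \<bar>w x\<bar> * indicator {s<..<t} x \<partial>lborel)"
  proof (rule nn_integral_cong_AE)
    have "AE c in lborel. c \<noteq> t \<and> c \<noteq> s" using AE_lborel_singleton[of t] AE_lborel_singleton[of s] by eventually_elim auto
    then show "AE x in lborel. ennreal (norm (indicat_real {s..t} x *\<^sub>R w x)) = ennreal \<bar>w x\<bar> * indicator {s<..<t} x"
      by eventually_elim (auto simp: indicator_def)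
  qed
  finally show ?thesis .
qed

lemma apath_continuous:
  assumes p: "apath r Y w" and r: "r > 0" shows "continuous_on {0..2 * r} Y"
proof -
  have i: "w integrable_on {0..2 * r}" using apathD(4)[OF p, of 0 "2 * r"] r by (auto simp: integrable_on_def)
  have "continuous_on {0..2 * r} (\<lambda>x. Y 0 + integral {0..x} w)"
    by (intro continuous_intros indefinite_integral_continuous_1 i)
  moreover have "Y 0 + integral {0..x} w = Y x" if "x \<in> {0..2 * r}" for x
    using integral_unique[OF apathD(4)[OF p, of 0 x]] that by simp
  ultimately show ?thesis by (rule continuous_on_eq)
qed

text \<open>From the last time at or below \<open>a\<close> before the first arrival at
  \<open>b\<close>, the path stays between the two levels, and the integral of its speed there is at
  least the displacement \<open>b - a\<close>.\<close>

lemma apath_crossing: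
  assumes p: "apath r Y w" and r: "r > 0" and st: "0 \<le> s" "s \<le> t" "t \<le> 2 * r"
    and Y: "Y s \<le> a" "b \<le> Y t"
  shows "ennreal (b - a) \<le> (\<integral>\<^sup>+x. ennreal \<bar>w x\<bar> * indicator {x. a \<le> Y x \<and> Y x \<le> b} x * indicator {s<..<t} x \<partial>lborel)"
proof (cases "a < b")
  case False
  then show ?thesis by (simp add: ennreal_neg)
next
  case True
  have cont: "continuous_on {s..t} Y" using apath_continuous[OF p r] by (rule continuous_on_subset) (use st in auto)
  define S where "S = {x \<in> {s..t}. b \<le> Y x}"
  have "closed S" unfolding S_def
    by (intro continuous_on_closed_Collect_le continuous_on_const cont closed_atLeastAtMost)
  moreover have S: "t \<in> S" "bdd_below S" "S \<noteq> {}" using st Y by (auto simp: S_def)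
  ultimately have tS: "Inf S \<in> S" by (intro closed_contains_Inf)
  define t' where "t' = Inf S"
  have t': "s \<le> t'" "t' \<le> t" "b \<le> Y t'" using tS by (auto simp: S_def t'_def)
  have lt: "Y x < b" if "s \<le> x" "x < t'" for x
    using that cInf_lower[of x S] S t' by (force simp: S_def t'_def)
  have cont': "continuous_on {s..t'} Y" using cont by (rule continuous_on_subset) (use t' in auto)
  define R where "R = {x \<in> {s..t'}. Y x \<le> a}"
  have "closed R" unfolding R_def
    by (intro continuous_on_closed_Collect_le continuous_on_const cont' closed_atLeastAtMost)
  moreover have R: "s \<in> R" "bdd_above R" "R \<noteq> {}" using t' Y by (auto simp: R_def)
  ultimately have sR: "Sup R \<in> R" by (intro closed_contains_Sup)
  define s' where "s' = Sup R"
  have s': "s \<le> s'" "s' \<le> t'" "Y s' \<le> a" using sR by (auto simp: R_def s'_def)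
  have gt: "a < Y x" if "s' < x" "x \<le> t'" for x
    using that cSup_upper[of x R] R s' by (force simp: R_def s'_def)
  obtain C where C: "\<And>x. \<bar>w x\<bar> \<le> C" using p unfolding apath_def by blast
  have "ennreal (b - a) \<le> ennreal (Y t' - Y s')" using t' s' by (intro ennreal_leI) simp
  also have "\<dots> \<le> (\<integral>\<^sup>+x. ennreal \<bar>w x\<bar> * indicator {s'<..<t'} x \<partial>lborel)"
    by (rule has_integral_abs_le_nn_integral[OF apathD(4)[OF p] apathD(2)[OF p] C]) (use s' t' st in auto)
  also have "\<dots> \<le> (\<integral>\<^sup>+x. ennreal \<bar>w x\<bar> * indicator {x. a \<le> Y x \<and> Y x \<le> b} x * indicator {s<..<t} x \<partial>lborel)"
    using lt gt s' t' by (intro nn_integral_mono) (auto simp: indicator_def less_imp_le)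
  finally show ?thesis .
qed

text \<open>The quantitative form of the change of sign: a path that reaches
  \<open>\<epsilon>\<close> and ends at \<open>- Y 0\<close> must traverse the window with total
  variation \<open>2 * \<epsilon>\<close>.\<close>

lemma apath_total_crossing:
  assumes p: "apath r Y w" and r: "r > 0" and e: "\<epsilon> > 0" and t0: "0 \<le> t0" "t0 \<le> 2 * r" and Y: "\<epsilon> \<le> Y t0"
  shows "ennreal (2 * \<epsilon>) \<le> (\<integral>\<^sup>+t. ennreal \<bar>w t\<bar> * win (Y t) \<epsilon> * win (t - r) r \<partial>lborel)"
proof -
  note [measurable] = apathD(1,2)[OF p]
  \<comment> \<open>The start clamped to the window. The rise from \<open>c\<close> to
    \<open>\<epsilon>\<close> and the subsequent fall from \<open>\<epsilon>\<close> to
    \<open>- c\<close> contribute \<open>\<epsilon> - c\<close> and \<open>\<epsilon> + c\<close>, a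
    sum that does not depend on the start.\<close>
  define c where "c = max (- \<epsilon>) (min \<epsilon> (Y 0))"
  have c: "- \<epsilon> \<le> c" "c \<le> \<epsilon>" using e by (auto simp: c_def)
  have 1: "ennreal (\<epsilon> - c) \<le> (\<integral>\<^sup>+x. ennreal \<bar>w x\<bar> * indicator {x. c \<le> Y x \<and> Y x \<le> \<epsilon>} x * indicator {0<..<t0} x \<partial>lborel)"
  proof (cases "Y 0 \<le> \<epsilon>")
    case True
    then have "Y 0 \<le> c" by (simp add: c_def)
    then show ?thesis using apath_crossing[OF p r, of 0 t0 c \<epsilon>] t0 Y by simp
  next
    case False
    then show ?thesis using e by (simp add: c_def)
  qed
  have 2: "ennreal (c + \<epsilon>) \<le> (\<integral>\<^sup>+x. ennreal \<bar>w x\<bar> * indicator {x. - \<epsilon> \<le> - Y x \<and> - Y x \<le> c} x * indicator {t0<..<2 * r} x \<partial>lborel)"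
  proof (cases "- \<epsilon> \<le> Y 0")
    case True
    then have "c \<le> - Y (2 * r)" using apathD(3)[OF p] by (simp add: c_def)
    then show ?thesis using apath_crossing[OF apath_neg[OF p] r, of t0 "2 * r" "- \<epsilon>" c] t0 Y by simp
  next
    case False
    then show ?thesis using e by (simp add: c_def)
  qed
  have "ennreal (2 * \<epsilon>) = ennreal (\<epsilon> - c) + ennreal (c + \<epsilon>)" using c by (simp flip: ennreal_plus)
  also have "\<dots> \<le> (\<integral>\<^sup>+x. ennreal \<bar>w x\<bar> * indicator {x. c \<le> Y x \<and> Y x \<le> \<epsilon>} x * indicator {0<..<t0} x \<partial>lborel)
    + (\<integral>\<^sup>+x. ennreal \<bar>w x\<bar> * indicator {x. - \<epsilon> \<le> - Y x \<and> - Y x \<le> c} x * indicator {t0<..<2 * r} x \<partial>lborel)"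
    by (intro add_mono 1 2)
  also have "\<dots> = (\<integral>\<^sup>+x. ennreal \<bar>w x\<bar> * indicator {x. c \<le> Y x \<and> Y x \<le> \<epsilon>} x * indicator {0<..<t0} x
     + ennreal \<bar>w x\<bar> * indicator {x. - \<epsilon> \<le> - Y x \<and> - Y x \<le> c} x * indicator {t0<..<2 * r} x \<partial>lborel)"
    by (rule nn_integral_add[symmetric]) measurable
  also have "\<dots> \<le> (\<integral>\<^sup>+t. ennreal \<bar>w t\<bar> * win (Y t) \<epsilon> * win (t - r) r \<partial>lborel)"
    using c t0 by (intro nn_integral_mono) (auto simp: indicator_def win_def abs_le_iff)
  finally show ?thesis .
qed

text \<open>The time spent at distance at least \<open>\<epsilon>\<close> from 0 is at most
  \<open>2 * r\<close>, and if such a time exists the crossing integral is at least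
  \<open>2 * \<epsilon>\<close>. A path that never leaves the window makes the left side 0.\<close>

lemma apath_window:
  assumes p: "apath r Y w" and r: "r > 0" and e: "\<epsilon> > 0"
  shows "(\<integral>\<^sup>+t. ennreal \<epsilon> * (if \<epsilon> \<le> \<bar>Y t\<bar> then 1 else 0) * win (t - r) r \<partial>lborel)
    \<le> ennreal r * (\<integral>\<^sup>+t. ennreal \<bar>w t\<bar> * win (Y t) \<epsilon> * win (t - r) r \<partial>lborel)"
proof (cases "\<exists>t0. 0 \<le> t0 \<and> t0 \<le> 2 * r \<and> \<epsilon> \<le> \<bar>Y t0\<bar>")
  case True
  then obtain t0 where t0: "0 \<le> t0" "t0 \<le> 2 * r" "\<epsilon> \<le> \<bar>Y t0\<bar>" by blast
  have "ennreal (2 * \<epsilon>) \<le> (\<integral>\<^sup>+t. ennreal \<bar>w t\<bar> * win (Y t) \<epsilon> * win (t - r) r \<partial>lborel)"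
  proof (cases "\<epsilon> \<le> Y t0")
    case True
    then show ?thesis using apath_total_crossing[OF p r e t0(1,2)] by simp
  next
    case False
    then have "\<epsilon> \<le> - Y t0" using t0 by simp
    then show ?thesis using apath_total_crossing[OF apath_neg[OF p] r e t0(1,2)] by (simp add: win_def)
  qed
  then have "ennreal r * ennreal (2 * \<epsilon>) \<le> ennreal r * (\<integral>\<^sup>+t. ennreal \<bar>w t\<bar> * win (Y t) \<epsilon> * win (t - r) r \<partial>lborel)"
    by (rule mult_left_mono) simp
  moreover have "(\<integral>\<^sup>+t. ennreal \<epsilon> * (if \<epsilon> \<le> \<bar>Y t\<bar> then 1 else 0) * win (t - r) r \<partial>lborel) \<le> (\<integral>\<^sup>+t. ennreal \<epsilon> * indicator {0..2 * r} t \<partial>lborel)"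
    by (intro nn_integral_mono) (auto simp: win_def indicator_def)
  moreover have "\<dots> = ennreal r * ennreal (2 * \<epsilon>)"
    using r e by (simp add: nn_integral_cmult_indicator mult_ac flip: ennreal_mult)
  ultimately show ?thesis by (simp only: order_trans)
next
  case False
  have z: "ennreal \<epsilon> * (if \<epsilon> \<le> \<bar>Y t\<bar> then 1 else 0) * win (t - r) r = 0" for t
    using False by (auto simp: win_def)
  show ?thesis unfolding z by simp
qed

text \<open>This is \<open>2 f(0) E\<bar>\<langle>z, \<nabla>M\<rangle>\<bar> \<ge> 1\<close> before
  passage to the limit: divided by \<open>2 * \<epsilon>\<close> and the volume, the slab integral
  approximates \<open>f(0)\<close>. The summand \<open>\<epsilon>\<close> pays for the points inside
  the slab, which the crossing estimate does not count, and disappears as \<open>\<epsilon>\<close>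
  tends to 0.\<close>

lemma slab_inequality:
  assumes e: "\<epsilon> > 0"
  shows "ennreal \<epsilon> * emeasure (pos_law T) {x. \<bar>fst x\<bar> \<le> 1}
    \<le> (\<integral>\<^sup>+x. win (snd x) \<epsilon> * win (fst x) 1 \<partial>pos_law T) * (ennreal \<epsilon> + (\<integral>\<^sup>+w. ennreal \<bar>w\<bar> \<partial>slope_law T))"
proof -
  interpret N: prob_space "slope_law T" by (rule prob_space_slope_law)
  have one: "emeasure (slope_law T) UNIV = 1" using N.emeasure_space_1 by simp
  let ?E = "\<integral>\<^sup>+w. ennreal \<bar>w\<bar> \<partial>slope_law T"
  let ?k = "\<lambda>(y, w::real). ennreal \<epsilon> * (if \<epsilon> \<le> \<bar>y\<bar> then 1 else 0) :: ennreal"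
  let ?h = "\<lambda>(y, w). ennreal \<bar>w\<bar> * win y \<epsilon>"
  have "(\<integral>\<^sup>+x. \<integral>\<^sup>+w. ?k (snd x, w) * win (fst x) 1 \<partial>slope_law T \<partial>pos_law T) \<le> (\<integral>\<^sup>+x. \<integral>\<^sup>+w. ?h (snd x, w) * win (fst x) 1 \<partial>slope_law T \<partial>pos_law T)"
  proof (rule traceable_fixed_size[OF traceable])
    show "?k \<in> borel_measurable borel" "?h \<in> borel_measurable borel" by measurable
    fix Y w assume "apath 1 Y w"
    from apath_window[OF this _ e]
    show "(\<integral>\<^sup>+t. ?k (Y t, w t) * win (t - 1) 1 \<partial>lborel) \<le> (\<integral>\<^sup>+t. ?h (Y t, w t) * win (t - 1) 1 \<partial>lborel)" by simp
  qed simp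
  also have "(\<integral>\<^sup>+x. \<integral>\<^sup>+w. ?h (snd x, w) * win (fst x) 1 \<partial>slope_law T \<partial>pos_law T) = (\<integral>\<^sup>+x. (win (snd x) \<epsilon> * win (fst x) 1) * ?E \<partial>pos_law T)"
  proof (rule nn_integral_cong)
    fix x :: "real \<times> real"
    have "(\<integral>\<^sup>+w. ?h (snd x, w) * win (fst x) 1 \<partial>slope_law T) = (\<integral>\<^sup>+w. (win (snd x) \<epsilon> * win (fst x) 1) * ennreal \<bar>w\<bar> \<partial>slope_law T)"
      by (simp add: mult_ac)
    also have "\<dots> = (win (snd x) \<epsilon> * win (fst x) 1) * ?E" by (rule nn_integral_cmult) measurable
    finally show "(\<integral>\<^sup>+w. ?h (snd x, w) * win (fst x) 1 \<partial>slope_law T) = (win (snd x) \<epsilon> * win (fst x) 1) * ?E" .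
  qed
  also have "\<dots> = (\<integral>\<^sup>+x. win (snd x) \<epsilon> * win (fst x) 1 \<partial>pos_law T) * ?E" by (rule nn_integral_multc) measurable
  finally have far: "(\<integral>\<^sup>+x. ennreal \<epsilon> * (if \<epsilon> \<le> \<bar>snd x\<bar> then 1 else 0) * win (fst x) 1 \<partial>pos_law T) \<le> (\<integral>\<^sup>+x. win (snd x) \<epsilon> * win (fst x) 1 \<partial>pos_law T) * ?E"
    by (simp add: one)
  have "ennreal \<epsilon> * emeasure (pos_law T) {x. \<bar>fst x\<bar> \<le> 1} = (\<integral>\<^sup>+x. ennreal \<epsilon> * indicator {x. \<bar>fst x\<bar> \<le> 1} x \<partial>pos_law T)"
    by (rule nn_integral_cmult_indicator[symmetric]) (simp add: strip_finite_sets[OF strip_finite_pos_law])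
  also have "\<dots> \<le> (\<integral>\<^sup>+x. ennreal \<epsilon> * (win (snd x) \<epsilon> * win (fst x) 1) + ennreal \<epsilon> * (if \<epsilon> \<le> \<bar>snd x\<bar> then 1 else 0) * win (fst x) 1 \<partial>pos_law T)"
    by (intro nn_integral_mono) (auto simp: indicator_def win_def)
  also have "\<dots> = (\<integral>\<^sup>+x. ennreal \<epsilon> * (win (snd x) \<epsilon> * win (fst x) 1) \<partial>pos_law T) + (\<integral>\<^sup>+x. ennreal \<epsilon> * (if \<epsilon> \<le> \<bar>snd x\<bar> then 1 else 0) * win (fst x) 1 \<partial>pos_law T)"
    by (rule nn_integral_add) measurable
  also have "(\<integral>\<^sup>+x. ennreal \<epsilon> * (win (snd x) \<epsilon> * win (fst x) 1) \<partial>pos_law T) = ennreal \<epsilon> * (\<integral>\<^sup>+x. win (snd x) \<epsilon> * win (fst x) 1 \<partial>pos_law T)"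
    by (rule nn_integral_cmult) measurable
  also have "\<dots> + (\<integral>\<^sup>+x. ennreal \<epsilon> * (if \<epsilon> \<le> \<bar>snd x\<bar> then 1 else 0) * win (fst x) 1 \<partial>pos_law T)
    \<le> ennreal \<epsilon> * (\<integral>\<^sup>+x. win (snd x) \<epsilon> * win (fst x) 1 \<partial>pos_law T) + (\<integral>\<^sup>+x. win (snd x) \<epsilon> * win (fst x) 1 \<partial>pos_law T) * ?E"
    by (rule add_left_mono[OF far])
  finally show ?thesis by (simp only: distrib_left distrib_right mult.commute)
qed

section \<open>Lebesgue measure on subspaces\<close>

text \<open>The construction of \<open>subspace_lborel\<close> for an arbitrary set of directions,
  so that orthonormal bases and the unnormalised leaves of a tree are treated alike.\<close>

definition span_leb :: "'a::euclidean_space set \<Rightarrow> 'a measure" where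
  "span_leb E = distr (\<Pi>\<^sub>M e\<in>E. lborel) borel (\<lambda>c. \<Sum>e\<in>E. c e *\<^sub>R e)"

lemma sets_span_leb [measurable_cong, simp]: "sets (span_leb E) = sets borel"
  by (simp add: span_leb_def)

lemma space_span_leb [simp]: "space (span_leb E) = UNIV"
  by (simp add: span_leb_def)

interpretation lborel_product: product_sigma_finite "\<lambda>_ :: 'a. lborel :: real measure"
  by standard

lemma lincomb_measurable [measurable]:
  "(\<lambda>c. \<Sum>e\<in>E. c e *\<^sub>R e) \<in> (\<Pi>\<^sub>M e\<in>E. lborel) \<rightarrow>\<^sub>M (borel :: 'a::euclidean_space measure)"
proof (rule borel_measurable_sum)
  fix i :: 'a assume "i \<in> E"
  then have "(\<lambda>c. c i) \<in> (\<Pi>\<^sub>M e\<in>E. lborel) \<rightarrow>\<^sub>M (lborel :: real measure)"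
    by (rule measurable_component_singleton)
  then have "(\<lambda>c. c i) \<in> borel_measurable (\<Pi>\<^sub>M e\<in>E. lborel :: real measure)"
    by (simp only: measurable_lborel1)
  then show "(\<lambda>c. c i *\<^sub>R i) \<in> borel_measurable (\<Pi>\<^sub>M e\<in>E. lborel :: real measure)"
    by (rule borel_measurable_scaleR[OF _ measurable_const]) simp
qed

lemma nn_integral_span_leb:
  assumes "f \<in> borel_measurable borel"
  shows "(\<integral>\<^sup>+x. f x \<partial>span_leb E) = (\<integral>\<^sup>+c. f (\<Sum>e\<in>E. c e *\<^sub>R e) \<partial>(\<Pi>\<^sub>M e\<in>E. lborel))"
  unfolding span_leb_def by (rule nn_integral_distr) (use assms in auto)

lemma nn_integral_span_leb_cong:
  assumes "f \<in> borel_measurable borel" "g \<in> borel_measurable borel" "\<And>x. x \<in> span E \<Longrightarrow> f x = g x"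
  shows "(\<integral>\<^sup>+x. f x \<partial>span_leb E) = (\<integral>\<^sup>+x. g x \<partial>span_leb E)"
  unfolding nn_integral_span_leb[OF assms(1)] nn_integral_span_leb[OF assms(2)]
  by (intro nn_integral_cong assms(3) span_sum span_scale span_base)

lemma borel_measurable_span_leb_integral [measurable (raw)]:
  assumes E: "finite E" and f[measurable]: "case_prod f \<in> borel_measurable (M \<Otimes>\<^sub>M borel)"
  shows "(\<lambda>x. \<integral>\<^sup>+y. f x y \<partial>span_leb E) \<in> borel_measurable M"
proof -
  interpret P: sigma_finite_measure "\<Pi>\<^sub>M e\<in>E. lborel :: real measure" by (rule lborel_product.sigma_finite[OF E])
  have m: "(\<lambda>x. \<integral>\<^sup>+c. f x (\<Sum>e\<in>E. c e *\<^sub>R e) \<partial>(\<Pi>\<^sub>M e\<in>E. lborel)) \<in> borel_measurable M"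
    by measurable
  have eq: "(\<integral>\<^sup>+y. f x y \<partial>span_leb E) = (\<integral>\<^sup>+c. f x (\<Sum>e\<in>E. c e *\<^sub>R e) \<partial>(\<Pi>\<^sub>M e\<in>E. lborel))" if x: "x \<in> space M" for x
  proof (rule nn_integral_span_leb)
    show "f x \<in> borel_measurable borel" using measurable_Pair2[OF f x] by simp
  qed
  show ?thesis by (rule measurable_cong[THEN iffD2, OF eq m])
qed

lemma nn_integral_span_leb_Tonelli:
  assumes E: "finite E" and M: "sigma_finite_measure M" and f[measurable]: "(\<lambda>(x, y). f x y) \<in> borel_measurable (M \<Otimes>\<^sub>M borel)"
  shows "(\<integral>\<^sup>+x. \<integral>\<^sup>+y. f x y \<partial>span_leb E \<partial>M) = (\<integral>\<^sup>+y. \<integral>\<^sup>+x. f x y \<partial>M \<partial>span_leb E)"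
proof -
  interpret M: sigma_finite_measure M by fact
  have fs: "(\<lambda>(x, y). f y x) \<in> borel_measurable (borel \<Otimes>\<^sub>M M)" by measurable
  have m: "(\<lambda>y. \<integral>\<^sup>+x. f x y \<partial>M) \<in> borel_measurable borel"
    using M.borel_measurable_nn_integral[OF fs] by simp
  have "(\<integral>\<^sup>+x. \<integral>\<^sup>+y. f x y \<partial>span_leb E \<partial>M) = (\<integral>\<^sup>+x. \<integral>\<^sup>+c. f x (\<Sum>e\<in>E. c e *\<^sub>R e) \<partial>(\<Pi>\<^sub>M e\<in>E. lborel) \<partial>M)"
    by (intro nn_integral_cong nn_integral_span_leb) measurable
  also have "\<dots> = (\<integral>\<^sup>+c. \<integral>\<^sup>+x. f x (\<Sum>e\<in>E. c e *\<^sub>R e) \<partial>M \<partial>(\<Pi>\<^sub>M e\<in>E. lborel))"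
    by (intro nn_integral_Tonelli M lborel_product.sigma_finite[OF E]) measurable
  also have "\<dots> = (\<integral>\<^sup>+y. \<integral>\<^sup>+x. f x y \<partial>M \<partial>span_leb E)"
    by (rule nn_integral_span_leb[OF m, symmetric])
  finally show ?thesis .
qed

lemma nn_integral_span_leb_Un:
  fixes f :: "'a::euclidean_space \<Rightarrow> ennreal"
  assumes E: "finite E" "finite F" "E \<inter> F = {}" and f[measurable]: "f \<in> borel_measurable borel"
  shows "(\<integral>\<^sup>+x. f x \<partial>span_leb (E \<union> F)) = (\<integral>\<^sup>+x. \<integral>\<^sup>+y. f (x + y) \<partial>span_leb F \<partial>span_leb E)"
proof -
  have s: "(\<Sum>e\<in>E \<union> F. merge E F (x, y) e *\<^sub>R e) = (\<Sum>e\<in>E. x e *\<^sub>R e) + (\<Sum>e\<in>F. y e *\<^sub>R e)" for x y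
    using E by (subst sum.union_disjoint) (auto intro!: arg_cong2[where f="(+)"] sum.cong simp: merge_def)
  have "(\<integral>\<^sup>+x. f x \<partial>span_leb (E \<union> F)) = (\<integral>\<^sup>+x. \<integral>\<^sup>+y. f ((\<Sum>e\<in>E. x e *\<^sub>R e) + (\<Sum>e\<in>F. y e *\<^sub>R e)) \<partial>(\<Pi>\<^sub>M e\<in>F. lborel) \<partial>(\<Pi>\<^sub>M e\<in>E. lborel))"
    unfolding nn_integral_span_leb[OF f]
    by (subst lborel_product.product_nn_integral_fold[OF E(3,1,2)]) (simp_all add: s)
  also have "\<dots> = (\<integral>\<^sup>+x. \<integral>\<^sup>+y. f ((\<Sum>e\<in>E. x e *\<^sub>R e) + y) \<partial>span_leb F \<partial>(\<Pi>\<^sub>M e\<in>E. lborel))"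
    by (intro nn_integral_cong nn_integral_span_leb[symmetric]) measurable
  also have "\<dots> = (\<integral>\<^sup>+x. \<integral>\<^sup>+y. f (x + y) \<partial>span_leb F \<partial>span_leb E)"
    by (rule nn_integral_span_leb[symmetric], rule borel_measurable_span_leb_integral[OF E(2)]) measurable
  finally show ?thesis .
qed

lemma nn_integral_span_leb_singleton:
  assumes f[measurable]: "f \<in> borel_measurable borel"
  shows "(\<integral>\<^sup>+x. f x \<partial>span_leb {e}) = (\<integral>\<^sup>+t. f (t *\<^sub>R e) \<partial>lborel)"
  unfolding nn_integral_span_leb[OF f]
  using lborel_product.product_nn_integral_singleton[of "\<lambda>t. f (t *\<^sub>R e)" e] by simp

lemma nn_integral_span_leb_insert:
  assumes E: "finite E" "e \<notin> E" and f[measurable]: "f \<in> borel_measurable borel"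
  shows "(\<integral>\<^sup>+x. f x \<partial>span_leb (insert e E)) = (\<integral>\<^sup>+t. \<integral>\<^sup>+y. f (t *\<^sub>R e + y) \<partial>span_leb E \<partial>lborel)"
proof -
  have "(\<integral>\<^sup>+x. f x \<partial>span_leb (insert e E)) = (\<integral>\<^sup>+x. \<integral>\<^sup>+y. f (x + y) \<partial>span_leb E \<partial>span_leb {e})"
    using nn_integral_span_leb_Un[of "{e}" E f] E by simp
  also have "\<dots> = (\<integral>\<^sup>+t. \<integral>\<^sup>+y. f (t *\<^sub>R e + y) \<partial>span_leb E \<partial>lborel)"
    by (rule nn_integral_span_leb_singleton, rule borel_measurable_span_leb_integral[OF E(1)]) measurable
  finally show ?thesis .
qed

lemma nn_integral_span_leb_empty:
  assumes "f \<in> borel_measurable borel"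
  shows "(\<integral>\<^sup>+x. f x \<partial>span_leb {}) = f 0"
  unfolding nn_integral_span_leb[OF assms] sum.empty by (rule lborel_product.nn_integral_empty) simp

lemma nn_integral_span_leb_scale:
  assumes E: "finite E" and r: "r > 0" and f: "f \<in> borel_measurable borel"
  shows "(\<integral>\<^sup>+x. f x \<partial>span_leb E) = ennreal (r ^ card E) * (\<integral>\<^sup>+x. f (r *\<^sub>R x) \<partial>span_leb E)"
  using E f
proof (induction E arbitrary: f)
  case empty
  then show ?case using measurable_compose[OF borel_measurable_scaleR[OF measurable_const measurable_ident]]
    by (subst (1 2) nn_integral_span_leb_empty) (auto intro: measurable_compose[OF _ empty])
next
  case (insert e E)
  note [measurable] = insert.prems
  have "(\<integral>\<^sup>+x. f x \<partial>span_leb (insert e E)) = (\<integral>\<^sup>+t. \<integral>\<^sup>+y. f (t *\<^sub>R e + y) \<partial>span_leb E \<partial>lborel)"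
    by (rule nn_integral_span_leb_insert[OF insert.hyps insert.prems])
  also have "\<dots> = ennreal r * (\<integral>\<^sup>+t. \<integral>\<^sup>+y. f ((r * t) *\<^sub>R e + y) \<partial>span_leb E \<partial>lborel)"
    using nn_integral_real_affine[of "\<lambda>t. \<integral>\<^sup>+y. f (t *\<^sub>R e + y) \<partial>span_leb E" r 0] r
      borel_measurable_span_leb_integral[OF insert.hyps(1), of "\<lambda>t y. f (t *\<^sub>R e + y)" borel] by simp
  also have "(\<lambda>t. \<integral>\<^sup>+y. f ((r * t) *\<^sub>R e + y) \<partial>span_leb E) = (\<lambda>t. ennreal (r ^ card E) * (\<integral>\<^sup>+y. f ((r * t) *\<^sub>R e + r *\<^sub>R y) \<partial>span_leb E))"
  proof
    fix t
    show "(\<integral>\<^sup>+y. f ((r * t) *\<^sub>R e + y) \<partial>span_leb E) = ennreal (r ^ card E) * (\<integral>\<^sup>+y. f ((r * t) *\<^sub>R e + r *\<^sub>R y) \<partial>span_leb E)"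
      by (rule insert.IH) measurable
  qed
  also have "(\<integral>\<^sup>+t. ennreal (r ^ card E) * (\<integral>\<^sup>+y. f ((r * t) *\<^sub>R e + r *\<^sub>R y) \<partial>span_leb E) \<partial>lborel)
    = ennreal (r ^ card E) * (\<integral>\<^sup>+t. \<integral>\<^sup>+y. f ((r * t) *\<^sub>R e + r *\<^sub>R y) \<partial>span_leb E \<partial>lborel)"
    by (rule nn_integral_cmult, rule borel_measurable_span_leb_integral[OF insert.hyps(1)]) measurable
  also have "(\<integral>\<^sup>+t. \<integral>\<^sup>+y. f ((r * t) *\<^sub>R e + r *\<^sub>R y) \<partial>span_leb E \<partial>lborel) = (\<integral>\<^sup>+x. f (r *\<^sub>R x) \<partial>span_leb (insert e E))"
    by (subst nn_integral_span_leb_insert[OF insert.hyps]) (auto simp: scaleR_add_right)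
  finally show ?case using insert.hyps r by (simp add: ennreal_mult mult.assoc)
qed

lemma nn_integral_span_leb_translate:
  assumes E: "finite E" and h: "h \<in> span E" and f: "f \<in> borel_measurable borel"
  shows "(\<integral>\<^sup>+x. f (x + h) \<partial>span_leb E) = (\<integral>\<^sup>+x. f x \<partial>span_leb E)"
  using E f h
proof (induction E arbitrary: f h)
  case empty
  then show ?case by simp
next
  case (insert e E)
  note [measurable] = insert.prems(1)
  obtain k where k: "h - k *\<^sub>R e \<in> span E" using insert.prems(2) by (auto simp: span_insert)
  have "(\<integral>\<^sup>+x. f (x + h) \<partial>span_leb (insert e E)) = (\<integral>\<^sup>+t. \<integral>\<^sup>+y. f ((k + t) *\<^sub>R e + (y + (h - k *\<^sub>R e))) \<partial>span_leb E \<partial>lborel)"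
    by (subst nn_integral_span_leb_insert[OF insert.hyps]) (auto simp: algebra_simps)
  also have "\<dots> = (\<integral>\<^sup>+t. \<integral>\<^sup>+y. f ((k + t) *\<^sub>R e + y) \<partial>span_leb E \<partial>lborel)"
    by (intro nn_integral_cong insert.IH[OF _ k]) measurable
  also have "\<dots> = (\<integral>\<^sup>+t. \<integral>\<^sup>+y. f (t *\<^sub>R e + y) \<partial>span_leb E \<partial>lborel)"
    by (rule nn_integral_shift[of "\<lambda>t. \<integral>\<^sup>+y. f (t *\<^sub>R e + y) \<partial>span_leb E"], rule borel_measurable_span_leb_integral[OF insert.hyps(1)]) measurable
  finally show ?case by (simp add: nn_integral_span_leb_insert[OF insert.hyps insert.prems(1)])
qed

text \<open>Lengthening a direction by the factor \<open>s e\<close> divides its coordinate by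
  \<open>s e\<close>. Injectivity ensures that no two rescaled directions merge.\<close>

lemma nn_integral_span_leb_rescale:
  assumes E: "finite E" and s: "\<And>e. e \<in> E \<Longrightarrow> s e > 0" and inj: "inj_on (\<lambda>e. s e *\<^sub>R e) E" and f: "f \<in> borel_measurable borel"
  shows "(\<integral>\<^sup>+x. f x \<partial>span_leb E) = ennreal (\<Prod>e\<in>E. s e) * (\<integral>\<^sup>+x. f x \<partial>span_leb ((\<lambda>e. s e *\<^sub>R e) ` E))"
  using E s inj f
proof (induction E arbitrary: f)
  case empty
  then show ?case by simp
next
  case (insert e E)
  note [measurable] = insert.prems(3)
  let ?g = "\<lambda>e. s e *\<^sub>R e"
  have fin: "finite (?g ` E)" "?g e \<notin> ?g ` E" using insert.hyps insert.prems(2) by (auto simp: inj_on_def)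
  have "(\<integral>\<^sup>+x. f x \<partial>span_leb (insert e E)) = (\<integral>\<^sup>+t. \<integral>\<^sup>+y. f (t *\<^sub>R e + y) \<partial>span_leb E \<partial>lborel)"
    by (rule nn_integral_span_leb_insert[OF insert.hyps insert.prems(3)])
  also have "\<dots> = (\<integral>\<^sup>+t. ennreal (\<Prod>e\<in>E. s e) * (\<integral>\<^sup>+y. f (t *\<^sub>R e + y) \<partial>span_leb (?g ` E)) \<partial>lborel)"
    using insert.prems by (intro nn_integral_cong insert.IH) (auto simp: inj_on_def)
  also have "\<dots> = ennreal (\<Prod>e\<in>E. s e) * (\<integral>\<^sup>+t. \<integral>\<^sup>+y. f (t *\<^sub>R e + y) \<partial>span_leb (?g ` E) \<partial>lborel)"
    by (rule nn_integral_cmult, rule borel_measurable_span_leb_integral[OF fin(1)]) measurable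
  also have "(\<integral>\<^sup>+t. \<integral>\<^sup>+y. f (t *\<^sub>R e + y) \<partial>span_leb (?g ` E) \<partial>lborel) = ennreal (s e) * (\<integral>\<^sup>+t. \<integral>\<^sup>+y. f (t *\<^sub>R ?g e + y) \<partial>span_leb (?g ` E) \<partial>lborel)"
    using nn_integral_real_affine[of "\<lambda>t. \<integral>\<^sup>+y. f (t *\<^sub>R e + y) \<partial>span_leb (?g ` E)" "s e" 0] insert.prems(1)[of e]
      borel_measurable_span_leb_integral[OF fin(1), of "\<lambda>t y. f (t *\<^sub>R e + y)" borel] by (simp add: mult.commute)
  also have "(\<integral>\<^sup>+t. \<integral>\<^sup>+y. f (t *\<^sub>R ?g e + y) \<partial>span_leb (?g ` E) \<partial>lborel) = (\<integral>\<^sup>+x. f x \<partial>span_leb (insert (?g e) (?g ` E)))"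
    by (rule nn_integral_span_leb_insert[OF fin insert.prems(3), symmetric])
  finally show ?case using insert.hyps insert.prems(1)
    by (simp add: ennreal_mult prod_nonneg less_imp_le mult_ac)
qed

text \<open>By Pythagoras the integral of a radial function depends only on the number of
  orthonormal directions. This fixes the normalisation when two orthonormal bases are compared,
  before rotation invariance is available.\<close>

lemma nn_integral_span_leb_radial:
  fixes E F :: "'a::euclidean_space set"
  assumes "finite E" "pairwise orthogonal E" "\<And>e. e \<in> E \<Longrightarrow> norm e = 1"
    and "finite F" "pairwise orthogonal F" "\<And>e. e \<in> F \<Longrightarrow> norm e = 1"
    and "card E = card F" "h \<in> borel_measurable borel"
  shows "(\<integral>\<^sup>+x. h ((norm x)\<^sup>2) \<partial>span_leb E) = (\<integral>\<^sup>+x. h ((norm x)\<^sup>2 :: real) \<partial>span_leb F)"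
  using assms
proof (induction E arbitrary: F h)
  case empty
  then show ?case by simp
next
  case (insert e E)
  note [measurable] = insert.prems(7)
  have step: "(\<integral>\<^sup>+x. h ((norm x)\<^sup>2) \<partial>span_leb (insert e E)) = (\<integral>\<^sup>+t. \<integral>\<^sup>+y. h (t\<^sup>2 + (norm y)\<^sup>2) \<partial>span_leb E \<partial>lborel)"
    if E: "finite E" "e \<notin> E" and o: "pairwise orthogonal (insert e E)" and n: "norm e = 1" for e :: 'a and E
  proof -
    have "(\<integral>\<^sup>+x. h ((norm x)\<^sup>2) \<partial>span_leb (insert e E)) = (\<integral>\<^sup>+t. \<integral>\<^sup>+y. h ((norm (t *\<^sub>R e + y))\<^sup>2) \<partial>span_leb E \<partial>lborel)"
      by (rule nn_integral_span_leb_insert[OF E]) measurable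
    also have "\<dots> = (\<integral>\<^sup>+t. \<integral>\<^sup>+y. h (t\<^sup>2 + (norm y)\<^sup>2) \<partial>span_leb E \<partial>lborel)"
    proof (rule nn_integral_cong, rule nn_integral_span_leb_cong)
      fix t :: real and y assume y: "y \<in> span E"
      have "orthogonal e x" if "x \<in> E" for x using o E that by (auto simp: pairwise_insert)
      then have "orthogonal e y" using y by (meson orthogonal_to_span)
      then have "orthogonal (t *\<^sub>R e) y" by (simp add: orthogonal_def)
      then show "h ((norm (t *\<^sub>R e + y))\<^sup>2) = h (t\<^sup>2 + (norm y)\<^sup>2)"
        using n by (simp add: norm_add_Pythagorean)
    qed measurable
    finally show ?thesis .
  qed
  have "card F = Suc (card E)" using insert.prems(6) insert.hyps by simp
  then obtain f G where F: "F = insert f G" "f \<notin> G" "card G = card E" by (auto simp: card_Suc_eq)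
  have G: "finite G" using insert.prems(3) F(1) by simp
  have "(\<integral>\<^sup>+x. h ((norm x)\<^sup>2) \<partial>span_leb (insert e E)) = (\<integral>\<^sup>+t. \<integral>\<^sup>+y. h (t\<^sup>2 + (norm y)\<^sup>2) \<partial>span_leb E \<partial>lborel)"
    by (rule step[OF insert.hyps]) (use insert.prems in auto)
  also have "\<dots> = (\<integral>\<^sup>+t. \<integral>\<^sup>+y. h (t\<^sup>2 + (norm y)\<^sup>2) \<partial>span_leb G \<partial>lborel)"
    by (intro nn_integral_cong insert.IH[of G "\<lambda>s. h (t\<^sup>2 + s)" for t]) (use insert.prems F G in \<open>auto simp: pairwise_insert\<close>)
  also have "\<dots> = (\<integral>\<^sup>+x. h ((norm x)\<^sup>2) \<partial>span_leb F)"
    unfolding F(1) by (rule step[OF G F(2), symmetric]) (use insert.prems F in auto)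
  finally show ?case .
qed

lemma span_leb_Basis: "span_leb Basis = lborel"
  by (simp add: span_leb_def lborel_eq[symmetric])

lemma emeasure_unit_ball_bounds:
  "0 < emeasure lborel (ball (0::'a::euclidean_space) 1)" "emeasure lborel (ball (0::'a) 1) < \<infinity>"
  using emeasure_ball[of 1 "0::'a"] unit_ball_vol_pos[of "real DIM('a)"] by auto

text \<open>Uniqueness of Haar measure: the product \<open>(\<integral> f d\<mu>) (\<integral> g d\<lambda>)\<close> is symmetric in
  translation invariant \<open>\<mu>\<close>, \<open>\<lambda>\<close> for even \<open>g\<close>; take \<open>g\<close> the indicator of the unit ball.\<close>

lemma nn_integral_span_leb_orthonormal_basis:
  fixes E :: "'a::euclidean_space set"
  assumes E: "finite E" "pairwise orthogonal E" "\<And>e. e \<in> E \<Longrightarrow> norm e = 1" "span E = UNIV"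
    and f[measurable]: "f \<in> borel_measurable borel"
  shows "(\<integral>\<^sup>+x. f x \<partial>span_leb E) = (\<integral>\<^sup>+x. f x \<partial>lborel)"
proof -
  \<comment> \<open>The test function is written through the squared norm so that
    \<open>nn_integral_span_leb_radial\<close> gives it the same integral \<open>G\<close> for both
    measures.\<close>
  define h :: "real \<Rightarrow> ennreal" where "h s = (if s < 1 then 1 else 0)" for s
  have [measurable]: "h \<in> borel_measurable borel" unfolding h_def by measurable
  define g :: "'a \<Rightarrow> ennreal" where "g x = h ((norm x)\<^sup>2)" for x
  have g: "g = indicator (ball 0 1)"
    by (auto simp: g_def h_def indicator_def fun_eq_iff abs_square_less_1)
  have [measurable]: "g \<in> borel_measurable borel" unfolding g_def by measurable
  have ind: "independent E"
    using E(2) E(3)[of 0] by (intro pairwise_orthogonal_independent) auto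
  have card: "card E = card (Basis :: 'a set)"
    using dim_eq_card[OF _ ind, of UNIV] E(4) by simp
  define G where "G = (\<integral>\<^sup>+x. g x \<partial>lborel)"
  have G: "G \<noteq> 0" "G < \<infinity>" unfolding G_def g using emeasure_unit_ball_bounds[where 'a='a] by auto
  have G': "(\<integral>\<^sup>+x. g x \<partial>span_leb E) = G"
    unfolding G_def g_def span_leb_Basis[symmetric]
    by (rule nn_integral_span_leb_radial) (use E card in \<open>auto simp: pairwise_def orthogonal_def inner_Basis\<close>)
  have tr: "(\<integral>\<^sup>+x. u (x + v) \<partial>span_leb E) = (\<integral>\<^sup>+x. u x \<partial>span_leb E)" if "u \<in> borel_measurable borel" for u v
    by (rule nn_integral_span_leb_translate[OF E(1) _ that]) (simp add: E(4))
  have trl: "(\<integral>\<^sup>+x. u (x + v) \<partial>lborel) = (\<integral>\<^sup>+x. u x \<partial>(lborel :: 'a measure))" if "u \<in> borel_measurable borel" for u v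
    using nn_integral_span_leb_translate[of Basis v u] that by (simp add: span_leb_Basis)
  have "G * (\<integral>\<^sup>+x. f x \<partial>span_leb E) = (\<integral>\<^sup>+y. g y * (\<integral>\<^sup>+x. f x \<partial>span_leb E) \<partial>lborel)"
    unfolding G_def by (rule nn_integral_multc[symmetric]) measurable
  also have "\<dots> = (\<integral>\<^sup>+y. \<integral>\<^sup>+x. g y * f (x + y) \<partial>span_leb E \<partial>lborel)"
  proof (rule nn_integral_cong)
    fix y :: 'a
    have "(\<integral>\<^sup>+x. g y * f (x + y) \<partial>span_leb E) = g y * (\<integral>\<^sup>+x. f (x + y) \<partial>span_leb E)"
      by (rule nn_integral_cmult) measurable
    then show "g y * (\<integral>\<^sup>+x. f x \<partial>span_leb E) = (\<integral>\<^sup>+x. g y * f (x + y) \<partial>span_leb E)"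
      by (simp add: tr)
  qed
  also have "\<dots> = (\<integral>\<^sup>+x. \<integral>\<^sup>+y. g y * f (x + y) \<partial>lborel \<partial>span_leb E)"
    by (rule nn_integral_span_leb_Tonelli[OF E(1) sigma_finite_lborel]) measurable
  also have "\<dots> = (\<integral>\<^sup>+x. \<integral>\<^sup>+y. g (x - y) * f y \<partial>lborel \<partial>span_leb E)"
  proof (rule nn_integral_cong)
    fix x :: 'a
    have "g (x - (y + x)) = g y" for y by (simp add: g_def)
    moreover have "(\<lambda>y. g (x - y) * f y) \<in> borel_measurable borel" by measurable
    ultimately show "(\<integral>\<^sup>+y. g y * f (x + y) \<partial>lborel) = (\<integral>\<^sup>+y. g (x - y) * f y \<partial>lborel)"
      using trl[of "\<lambda>y. g (x - y) * f y" x] by (simp add: add.commute)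
  qed
  also have "\<dots> = (\<integral>\<^sup>+y. \<integral>\<^sup>+x. g (x - y) * f y \<partial>span_leb E \<partial>lborel)"
    by (rule nn_integral_span_leb_Tonelli[OF E(1) sigma_finite_lborel, symmetric]) measurable
  also have "\<dots> = (\<integral>\<^sup>+y. G * f y \<partial>lborel)"
  proof (rule nn_integral_cong)
    fix y :: 'a
    have "(\<integral>\<^sup>+x. g (x - y) * f y \<partial>span_leb E) = (\<integral>\<^sup>+x. g (x - y) \<partial>span_leb E) * f y"
      by (rule nn_integral_multc) measurable
    then show "(\<integral>\<^sup>+x. g (x - y) * f y \<partial>span_leb E) = G * f y" using tr[of g "- y"] G' by simp
  qed
  also have "\<dots> = G * (\<integral>\<^sup>+y. f y \<partial>lborel)" by (rule nn_integral_cmult) measurable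
  finally show ?thesis using ennreal_cancel_left[OF _ G] by blast
qed

section \<open>Norm trees in Euclidean space\<close>

text \<open>A leaf \<open>v\<close> stands for the segment from \<open>- v\<close> to
  \<open>v\<close>; all leaves are nonzero and mutually orthogonal.\<close>

primrec orth_tree :: "'a::euclidean_space htree \<Rightarrow> bool" where
  "orth_tree (Seg v) \<longleftrightarrow> v \<noteq> 0"
| "orth_tree (LInf a b) \<longleftrightarrow> orth_tree a \<and> orth_tree b \<and> (\<forall>v\<in>set_htree a. \<forall>w\<in>set_htree b. v \<bullet> w = 0)"
| "orth_tree (LOne a b) \<longleftrightarrow> orth_tree a \<and> orth_tree b \<and> (\<forall>v\<in>set_htree a. \<forall>w\<in>set_htree b. v \<bullet> w = 0)"

text \<open>Inverting a leaf to \<open>v /\<^sub>R (v \<bullet> v)\<close>, which is meant for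
  \<open>v \<noteq> 0\<close>, makes its \<open>tnorm\<close> equal to
  \<open>\<bar>x \<bullet> v\<bar>\<close>, the support function of the segment; interchanging the
  nodes then dualises max and sum.\<close>

primrec dual_tree :: "'a::euclidean_space htree \<Rightarrow> 'a htree" where
  "dual_tree (Seg v) = Seg (v /\<^sub>R (v \<bullet> v))"
| "dual_tree (LInf a b) = LOne (dual_tree a) (dual_tree b)"
| "dual_tree (LOne a b) = LInf (dual_tree a) (dual_tree b)"

text \<open>On the span of the leaves this is the gauge of the polytope. Elsewhere it is the gauge
  composed with the orthogonal projection to that span, so the norms of the factors can be evaluated
  at any vector of the ambient space.\<close>

primrec tnorm :: "'a::euclidean_space htree \<Rightarrow> 'a \<Rightarrow> real" where
  "tnorm (Seg v) x = \<bar>x \<bullet> v\<bar> / (v \<bullet> v)"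
| "tnorm (LInf a b) x = max (tnorm a x) (tnorm b x)"
| "tnorm (LOne a b) x = tnorm a x + tnorm b x"

text \<open>A measurable selection of the derivative of \<^term>\<open>tnorm (dual_tree T)\<close> in direction \<open>z\<close>.\<close>

primrec gslope :: "'a::euclidean_space htree \<Rightarrow> 'a \<Rightarrow> 'a \<Rightarrow> real" where
  "gslope (Seg v) z p = sgn (p \<bullet> v) * (v \<bullet> z)"
| "gslope (LInf a b) z p = gslope a z p + gslope b z p"
| "gslope (LOne a b) z p = (if tnorm (dual_tree b) p \<le> tnorm (dual_tree a) p then gslope a z p else gslope b z p)"

text \<open>The Jacobian of leaf coordinates: \<open>span_leb (set_htree T)\<close> has this
  constant density with respect to Lebesgue measure once the leaves span the space, see
  \<open>span_leb_tree\<close>.\<close>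

primrec tree_scale :: "'a::euclidean_space htree \<Rightarrow> real" where
  "tree_scale (Seg v) = 1 / norm v"
| "tree_scale (LInf a b) = tree_scale a * tree_scale b"
| "tree_scale (LOne a b) = tree_scale a * tree_scale b"

lemma dual_dual_tree [simp]: "dual_tree (dual_tree T) = T"
proof (induction T)
  case (Seg v)
  show ?case by (cases "v = 0") auto
qed auto

lemma set_dual_tree: "set_htree (dual_tree T) = (\<lambda>v. v /\<^sub>R (v \<bullet> v)) ` set_htree T"
  by (induction T) auto

lemma orth_dual_tree: "orth_tree T \<Longrightarrow> orth_tree (dual_tree T)"
  by (induction T) (auto simp: set_dual_tree)

lemma finite_set_htree: "finite (set_htree T)"
  by (induction T) auto

lemma orth_tree_nonzero: "orth_tree T \<Longrightarrow> v \<in> set_htree T \<Longrightarrow> v \<noteq> 0"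
  by (induction T) auto

lemma orth_tree_pairwise: "orth_tree T \<Longrightarrow> pairwise orthogonal (set_htree T)"
proof (induction T)
  case (LInf a b) then show ?case by (auto simp: pairwise_def orthogonal_def) (metis inner_commute)
next
  case (LOne a b) then show ?case by (auto simp: pairwise_def orthogonal_def) (metis inner_commute)
qed (auto simp: pairwise_def)

lemma orth_tree_disjoint:
  assumes "orth_tree a" "\<forall>v\<in>set_htree a. \<forall>w\<in>set_htree b. v \<bullet> w = 0"
  shows "set_htree a \<inter> set_htree b = {}"
proof -
  have False if "v \<in> set_htree a" "v \<in> set_htree b" for v
    using assms(2) that orth_tree_nonzero[OF assms(1) that(1)] by force
  then show ?thesis by blast
qed

lemma card_set_htree: "orth_tree T \<Longrightarrow> card (set_htree T) = hdim T"
proof (induction T)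
  case (LInf a b)
  then show ?case using orth_tree_disjoint[of a b] by (simp add: card_Un_disjoint finite_set_htree)
next
  case (LOne a b)
  then show ?case using orth_tree_disjoint[of a b] by (simp add: card_Un_disjoint finite_set_htree)
qed simp

lemma tree_scale_prod: "orth_tree T \<Longrightarrow> (\<Prod>v\<in>set_htree T. 1 / norm v) = tree_scale T"
proof (induction T)
  case (LInf a b)
  then show ?case using orth_tree_disjoint[of a b]
    by (simp add: prod.union_disjoint finite_set_htree del: prod_dividef)
next
  case (LOne a b)
  then show ?case using orth_tree_disjoint[of a b]
    by (simp add: prod.union_disjoint finite_set_htree del: prod_dividef)
qed simp

lemma tree_scale_pos: "orth_tree T \<Longrightarrow> tree_scale T > 0"
  by (induction T) auto

text \<open>A leaf and its inverse have reciprocal lengths. This is why the lengths of the segments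
  drop out of the final volume product.\<close>

lemma tree_scale_dual: "orth_tree T \<Longrightarrow> tree_scale T * tree_scale (dual_tree T) = 1"
proof (induction T)
  case (Seg v)
  have "\<bar>v \<bullet> v\<bar> = norm v * norm v" by (simp add: dot_square_norm power2_eq_square)
  then show ?case using Seg by (simp add: field_simps)
next
  case (LInf a b)
  have "tree_scale a * tree_scale b * (tree_scale (dual_tree a) * tree_scale (dual_tree b))
    = (tree_scale a * tree_scale (dual_tree a)) * (tree_scale b * tree_scale (dual_tree b))"
    by (simp only: mult_ac)
  also have "\<dots> = 1" using LInf by simp
  finally show ?case by (simp only: dual_tree.simps tree_scale.simps)
next
  case (LOne a b)
  have "tree_scale a * tree_scale b * (tree_scale (dual_tree a) * tree_scale (dual_tree b))
    = (tree_scale a * tree_scale (dual_tree a)) * (tree_scale b * tree_scale (dual_tree b))"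
    by (simp only: mult_ac)
  also have "\<dots> = 1" using LOne by simp
  finally show ?case by (simp only: dual_tree.simps tree_scale.simps)
qed

lemma tnorm_nonneg: "tnorm T x \<ge> 0"
  by (induction T) (auto simp: le_max_iff_disj)

lemma tnorm_scale: "tnorm T (r *\<^sub>R x) = \<bar>r\<bar> * tnorm T x"
  by (induction T) (auto simp: abs_mult distrib_left max_mult_distrib_left)

lemma tnorm_triangle: "tnorm T (x + y) \<le> tnorm T x + tnorm T y"
proof (induction T)
  case (Seg v)
  show ?case by (simp add: inner_add_left add_divide_distrib[symmetric] divide_right_mono)
qed auto

lemma tnorm_continuous: "continuous_on UNIV (tnorm T)"
proof (induction T)
  case (Seg v)
  show ?case by (cases "v = 0") (auto intro!: continuous_intros)
qed (auto intro!: continuous_intros)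

lemma tnorm_measurable [measurable]: "tnorm T \<in> borel_measurable borel"
  by (intro borel_measurable_continuous_onI tnorm_continuous)

lemma gslope_measurable [measurable]: "gslope T z \<in> borel_measurable borel"
  by (induction T) (auto intro!: measurable_If)

lemma tnorm_add_orth: "(\<And>v. v \<in> set_htree T \<Longrightarrow> y \<bullet> v = 0) \<Longrightarrow> tnorm T (x + y) = tnorm T x"
  by (induction T) (auto simp: inner_add_left)

lemma gslope_add_orth: "(\<And>v. v \<in> set_htree T \<Longrightarrow> y \<bullet> v = 0) \<Longrightarrow> gslope T z (x + y) = gslope T z x"
proof (induction T)
  case (LOne a b)
  have "tnorm (dual_tree a) (x + y) = tnorm (dual_tree a) x" "tnorm (dual_tree b) (x + y) = tnorm (dual_tree b) x"
    using LOne.prems by (auto intro!: tnorm_add_orth simp: set_dual_tree)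
  then show ?case using LOne by simp
qed (auto simp: inner_add_left)

section \<open>The abstract laws as laws of norms, positions and slopes in Euclidean space\<close>

lemma span_orth:
  assumes "y \<in> span F" "\<And>w. w \<in> F \<Longrightarrow> v \<bullet> w = 0" shows "y \<bullet> v = 0"
  using orthogonal_to_span[OF assms(1), of v] assms(2) by (auto simp: orthogonal_def inner_commute)

lemma tnorm_abs: "\<bar>tnorm T x\<bar> = tnorm T x"
  by (simp add: tnorm_nonneg)

lemma span_orth_dual:
  assumes "y \<in> span (set_htree (dual_tree b))" "\<And>w. w \<in> set_htree b \<Longrightarrow> v \<bullet> w = 0" shows "y \<bullet> v = 0"
  by (rule span_orth[OF assms(1)]) (auto simp: set_dual_tree assms(2))

text \<open>Carries one step of the recursion: when the statistic \<open>G\<close> of an orthogonal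
  sum is computed by \<open>op\<close> from statistics of the summands, its law is the
  \<open>push_pair\<close> of their laws.\<close>

lemma nn_integral_span_leb_push_pair:
  assumes E: "finite E" "finite F" "E \<inter> F = {}" and A: "strip_finite A" and B: "strip_finite B"
    and op: "(\<lambda>(p, q). op p q) \<in> borel \<Otimes>\<^sub>M borel \<rightarrow>\<^sub>M borel"
    and m: "G \<in> borel \<rightarrow>\<^sub>M borel" "GE \<in> borel \<rightarrow>\<^sub>M borel" "GF \<in> borel \<rightarrow>\<^sub>M borel"
    and hE: "\<And>g. g \<in> borel_measurable borel \<Longrightarrow> (\<integral>\<^sup>+x. g (GE x) \<partial>span_leb E) = (\<integral>\<^sup>+p. g p \<partial>A)"
    and hF: "\<And>g. g \<in> borel_measurable borel \<Longrightarrow> (\<integral>\<^sup>+x. g (GF x) \<partial>span_leb F) = (\<integral>\<^sup>+p. g p \<partial>B)"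
    and G: "\<And>x y. x \<in> span E \<Longrightarrow> y \<in> span F \<Longrightarrow> G (x + y) = op (GE x) (GF y)"
    and f: "f \<in> borel_measurable borel"
  shows "(\<integral>\<^sup>+x. f (G x) \<partial>span_leb (E \<union> F)) = (\<integral>\<^sup>+p. f p \<partial>push_pair op A B)"
proof -
  interpret B: sigma_finite_measure B by (rule strip_finite_sigma[OF B])
  have mm: "(\<lambda>x. f (op (u x) (w x))) \<in> borel_measurable M" if "u \<in> borel_measurable M" "w \<in> borel_measurable M" for u w and M :: "'z measure"
    using measurable_compose[OF measurable_compose[OF measurable_Pair[OF that] op] f] by simp
  have fG: "(\<lambda>x. f (G x)) \<in> borel_measurable borel" by (rule measurable_compose[OF m(1) f])
  have m1: "case_prod (\<lambda>x y. f (G (x + y))) \<in> borel_measurable (borel \<Otimes>\<^sub>M borel)"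
    unfolding split_beta' by (rule measurable_compose[OF _ fG]) measurable
  have m2: "case_prod (\<lambda>x y. f (op (GE x) (GF y))) \<in> borel_measurable (borel \<Otimes>\<^sub>M borel)"
    unfolding split_beta'
    by (rule mm) (rule measurable_compose[OF measurable_fst m(2)] measurable_compose[OF measurable_snd m(3)])+
  have "(\<integral>\<^sup>+x. f (G x) \<partial>span_leb (E \<union> F)) = (\<integral>\<^sup>+x. \<integral>\<^sup>+y. f (G (x + y)) \<partial>span_leb F \<partial>span_leb E)"
    by (rule nn_integral_span_leb_Un[OF E fG])
  also have "\<dots> = (\<integral>\<^sup>+x. \<integral>\<^sup>+y. f (op (GE x) (GF y)) \<partial>span_leb F \<partial>span_leb E)"
  proof (rule nn_integral_span_leb_cong)
    show "(\<lambda>x. \<integral>\<^sup>+y. f (G (x + y)) \<partial>span_leb F) \<in> borel_measurable borel"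
      by (rule borel_measurable_span_leb_integral[OF E(2) m1])
    show "(\<lambda>x. \<integral>\<^sup>+y. f (op (GE x) (GF y)) \<partial>span_leb F) \<in> borel_measurable borel"
      by (rule borel_measurable_span_leb_integral[OF E(2) m2])
    fix x assume x: "x \<in> span E"
    show "(\<integral>\<^sup>+y. f (G (x + y)) \<partial>span_leb F) = (\<integral>\<^sup>+y. f (op (GE x) (GF y)) \<partial>span_leb F)"
    proof (rule nn_integral_span_leb_cong)
      show "(\<lambda>y. f (G (x + y))) \<in> borel_measurable borel"
        by (rule measurable_compose[OF _ fG]) measurable
      show "(\<lambda>y. f (op (GE x) (GF y))) \<in> borel_measurable borel"
        by (rule mm[OF measurable_const m(3)]) simp
    qed (simp add: G[OF x])
  qed
  also have "\<dots> = (\<integral>\<^sup>+x. \<integral>\<^sup>+q. f (op (GE x) q) \<partial>B \<partial>span_leb E)"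
    by (rule nn_integral_cong, rule hF, rule mm) auto
  also have "\<dots> = (\<integral>\<^sup>+p. \<integral>\<^sup>+q. f (op p q) \<partial>B \<partial>A)"
  proof (rule hE, rule B.borel_measurable_nn_integral)
    have "(\<lambda>(p, q). f (op p q)) \<in> borel_measurable (borel \<Otimes>\<^sub>M borel)"
      unfolding split_beta' by (rule mm[OF measurable_fst measurable_snd])
    then show "(\<lambda>(p, q). f (op p q)) \<in> borel_measurable (borel \<Otimes>\<^sub>M B)"
      by (simp only: measurable_cong_sets[OF sets_pair_measure_cong[OF refl strip_finite_sets[OF B]] refl])
  qed
  also have "\<dots> = (\<integral>\<^sup>+p. f p \<partial>push_pair op A B)"
    by (rule nn_integral_push_pair[OF A B op f, symmetric])
  finally show ?thesis .
qed

lemma pos_law_tree: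
  assumes "orth_tree T" and "f \<in> borel_measurable borel"
  shows "(\<integral>\<^sup>+x. f (tnorm T x, x \<bullet> z) \<partial>span_leb (set_htree T)) = (\<integral>\<^sup>+p. f p \<partial>pos_law (map_htree (\<lambda>v. v \<bullet> z) T))"
  using assms
proof (induction T arbitrary: f)
  case (Seg v)
  note [measurable] = Seg.prems(2)
  have "(\<integral>\<^sup>+x. f (tnorm (Seg v) x, x \<bullet> z) \<partial>span_leb (set_htree (Seg v))) = (\<integral>\<^sup>+t. f (\<bar>t\<bar>, t * (v \<bullet> z)) \<partial>lborel)"
    unfolding htree.set by (subst nn_integral_span_leb_singleton) (use Seg.prems(1) in \<open>auto simp: abs_mult\<close>)
  then show ?case by (simp add: nn_integral_distr)
next
  case (LInf a b)
  have o: "orth_tree a" "orth_tree b" and vw: "\<And>v w. v \<in> set_htree a \<Longrightarrow> w \<in> set_htree b \<Longrightarrow> v \<bullet> w = 0"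
    using LInf.prems(1) by auto
  have wv: "\<And>v w. v \<in> set_htree b \<Longrightarrow> w \<in> set_htree a \<Longrightarrow> v \<bullet> w = 0"
    by (subst inner_commute, rule vw)
  show ?case unfolding htree.set htree.map pos_law.simps
  proof (rule nn_integral_span_leb_push_pair[where GE="\<lambda>x. (tnorm a x, x \<bullet> z)" and GF="\<lambda>x. (tnorm b x, x \<bullet> z)"])
    show "set_htree a \<inter> set_htree b = {}" using LInf.prems(1) orth_tree_disjoint[of a b] by auto
    fix x y assume x: "x \<in> span (set_htree a)" and y: "y \<in> span (set_htree b)"
    have "tnorm a (x + y) = tnorm a x" using vw by (intro tnorm_add_orth span_orth[OF y]) auto
    moreover have "tnorm b (y + x) = tnorm b y" using wv by (intro tnorm_add_orth span_orth[OF x]) auto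
    ultimately show "(tnorm (LInf a b) (x + y), (x + y) \<bullet> z) = max_pair (tnorm a x, x \<bullet> z) (tnorm b y, y \<bullet> z)"
      by (simp add: max_pair_def tnorm_abs inner_add_left add.commute)
  next
    show "(\<lambda>x. (tnorm (LInf a b) x, x \<bullet> z)) \<in> borel_measurable borel" "(\<lambda>x. (tnorm a x, x \<bullet> z)) \<in> borel_measurable borel"
      "(\<lambda>x. (tnorm b x, x \<bullet> z)) \<in> borel_measurable borel" by (measurable, measurable, measurable)
  qed (use LInf.IH o LInf.prems(2) in \<open>auto intro!: finite_set_htree strip_finite_pos_law max_pair_measurable\<close>)
next
  case (LOne a b)
  have o: "orth_tree a" "orth_tree b" and vw: "\<And>v w. v \<in> set_htree a \<Longrightarrow> w \<in> set_htree b \<Longrightarrow> v \<bullet> w = 0"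
    using LOne.prems(1) by auto
  have wv: "\<And>v w. v \<in> set_htree b \<Longrightarrow> w \<in> set_htree a \<Longrightarrow> v \<bullet> w = 0"
    by (subst inner_commute, rule vw)
  show ?case unfolding htree.set htree.map pos_law.simps
  proof (rule nn_integral_span_leb_push_pair[where GE="\<lambda>x. (tnorm a x, x \<bullet> z)" and GF="\<lambda>x. (tnorm b x, x \<bullet> z)"])
    show "set_htree a \<inter> set_htree b = {}" using LOne.prems(1) orth_tree_disjoint[of a b] by auto
    fix x y assume x: "x \<in> span (set_htree a)" and y: "y \<in> span (set_htree b)"
    have "tnorm a (x + y) = tnorm a x" using vw by (intro tnorm_add_orth span_orth[OF y]) auto
    moreover have "tnorm b (y + x) = tnorm b y" using wv by (intro tnorm_add_orth span_orth[OF x]) auto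
    ultimately show "(tnorm (LOne a b) (x + y), (x + y) \<bullet> z) = sum_pair (tnorm a x, x \<bullet> z) (tnorm b y, y \<bullet> z)"
      by (simp add: sum_pair_def tnorm_abs inner_add_left add.commute)
  next
    show "(\<lambda>x. (tnorm (LOne a b) x, x \<bullet> z)) \<in> borel_measurable borel" "(\<lambda>x. (tnorm a x, x \<bullet> z)) \<in> borel_measurable borel"
      "(\<lambda>x. (tnorm b x, x \<bullet> z)) \<in> borel_measurable borel" by (measurable, measurable, measurable)
  qed (use LOne.IH o LOne.prems(2) in \<open>auto intro!: finite_set_htree strip_finite_pos_law sum_pair_measurable\<close>)
qed

text \<open>At an \<open>LOne\<close> node the dual norm is a maximum. The tie rule of
  \<open>sel_pair\<close> is that of \<open>gslope\<close>, so the statistics agree at every point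
  and no exceptional set arises.\<close>

lemma grad_law_tree:
  assumes "orth_tree T" and "f \<in> borel_measurable borel"
  shows "(\<integral>\<^sup>+x. f (tnorm (dual_tree T) x, gslope T z x) \<partial>span_leb (set_htree (dual_tree T))) = (\<integral>\<^sup>+p. f p \<partial>grad_law (map_htree (\<lambda>v. v \<bullet> z) T))"
  using assms
proof (induction T arbitrary: f)
  case (Seg v)
  note [measurable] = Seg.prems(2)
  have v: "v \<bullet> v > 0" using Seg.prems(1) by simp
  have "(\<integral>\<^sup>+x. f (tnorm (dual_tree (Seg v)) x, gslope (Seg v) z x) \<partial>span_leb (set_htree (dual_tree (Seg v)))) = (\<integral>\<^sup>+t. f (\<bar>t\<bar>, sgn t * (v \<bullet> z)) \<partial>lborel)"
    unfolding htree.set dual_tree.simps by (subst nn_integral_span_leb_singleton) (use v in \<open>auto simp: abs_mult mult.assoc\<close>)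
  then show ?case by (simp add: nn_integral_distr)
next
  case (LInf a b)
  have o: "orth_tree a" "orth_tree b" and vw: "\<And>v w. v \<in> set_htree a \<Longrightarrow> w \<in> set_htree b \<Longrightarrow> v \<bullet> w = 0"
    using LInf.prems(1) by auto
  have wv: "\<And>v w. v \<in> set_htree b \<Longrightarrow> w \<in> set_htree a \<Longrightarrow> v \<bullet> w = 0"
    by (subst inner_commute, rule vw)
  show ?case unfolding dual_tree.simps htree.set htree.map grad_law.simps
  proof (rule nn_integral_span_leb_push_pair[where GE="\<lambda>x. (tnorm (dual_tree a) x, gslope a z x)" and GF="\<lambda>x. (tnorm (dual_tree b) x, gslope b z x)"])
    show "set_htree (dual_tree a) \<inter> set_htree (dual_tree b) = {}"
      using orth_dual_tree[OF LInf.prems(1)] orth_tree_disjoint[of "dual_tree a" "dual_tree b"] by auto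
    fix x y assume x: "x \<in> span (set_htree (dual_tree a))" and y: "y \<in> span (set_htree (dual_tree b))"
    have oy: "y \<bullet> v = 0" if "v \<in> set_htree a" for v using vw that by (intro span_orth_dual[OF y]) auto
    have ox: "x \<bullet> w = 0" if "w \<in> set_htree b" for w using wv that by (intro span_orth_dual[OF x]) auto
    have "tnorm (dual_tree a) (x + y) = tnorm (dual_tree a) x" "tnorm (dual_tree b) (y + x) = tnorm (dual_tree b) y"
      by (auto intro!: tnorm_add_orth simp: set_dual_tree ox oy)
    moreover have "gslope a z (x + y) = gslope a z x" "gslope b z (y + x) = gslope b z y"
      by (auto intro!: gslope_add_orth simp: ox oy)
    ultimately show "(tnorm (LOne (dual_tree a) (dual_tree b)) (x + y), gslope (LInf a b) z (x + y)) = sum_pair (tnorm (dual_tree a) x, gslope a z x) (tnorm (dual_tree b) y, gslope b z y)"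
      by (simp add: sum_pair_def tnorm_abs add.commute max_def)
  next
    show "(\<lambda>x. (tnorm (LOne (dual_tree a) (dual_tree b)) x, gslope (LInf a b) z x)) \<in> borel_measurable borel"
      "(\<lambda>x. (tnorm (dual_tree a) x, gslope a z x)) \<in> borel_measurable borel"
      "(\<lambda>x. (tnorm (dual_tree b) x, gslope b z x)) \<in> borel_measurable borel" by (measurable, measurable, measurable)
  qed (use LInf.IH o LInf.prems(2) in \<open>auto intro!: finite_set_htree strip_finite_grad_law sum_pair_measurable\<close>)
next
  case (LOne a b)
  have o: "orth_tree a" "orth_tree b" and vw: "\<And>v w. v \<in> set_htree a \<Longrightarrow> w \<in> set_htree b \<Longrightarrow> v \<bullet> w = 0"
    using LOne.prems(1) by auto
  have wv: "\<And>v w. v \<in> set_htree b \<Longrightarrow> w \<in> set_htree a \<Longrightarrow> v \<bullet> w = 0"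
    by (subst inner_commute, rule vw)
  show ?case unfolding dual_tree.simps htree.set htree.map grad_law.simps
  proof (rule nn_integral_span_leb_push_pair[where GE="\<lambda>x. (tnorm (dual_tree a) x, gslope a z x)" and GF="\<lambda>x. (tnorm (dual_tree b) x, gslope b z x)"])
    show "set_htree (dual_tree a) \<inter> set_htree (dual_tree b) = {}"
      using orth_dual_tree[OF LOne.prems(1)] orth_tree_disjoint[of "dual_tree a" "dual_tree b"] by auto
    fix x y assume x: "x \<in> span (set_htree (dual_tree a))" and y: "y \<in> span (set_htree (dual_tree b))"
    have oy: "y \<bullet> v = 0" if "v \<in> set_htree a" for v using vw that by (intro span_orth_dual[OF y]) auto
    have ox: "x \<bullet> w = 0" if "w \<in> set_htree b" for w using wv that by (intro span_orth_dual[OF x]) auto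
    have "tnorm (dual_tree a) (x + y) = tnorm (dual_tree a) x" "tnorm (dual_tree b) (y + x) = tnorm (dual_tree b) y"
      by (auto intro!: tnorm_add_orth simp: set_dual_tree ox oy)
    moreover have "gslope a z (x + y) = gslope a z x" "gslope b z (y + x) = gslope b z y"
      by (auto intro!: gslope_add_orth simp: ox oy)
    ultimately show "(tnorm (LInf (dual_tree a) (dual_tree b)) (x + y), gslope (LOne a b) z (x + y)) = sel_pair (tnorm (dual_tree a) x, gslope a z x) (tnorm (dual_tree b) y, gslope b z y)"
      by (simp add: sel_pair_def tnorm_abs add.commute max_def)
  next
    show "(\<lambda>x. (tnorm (LInf (dual_tree a) (dual_tree b)) x, gslope (LOne a b) z x)) \<in> borel_measurable borel"
      "(\<lambda>x. (tnorm (dual_tree a) x, gslope a z x)) \<in> borel_measurable borel"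
      "(\<lambda>x. (tnorm (dual_tree b) x, gslope b z x)) \<in> borel_measurable borel" by (measurable, measurable, measurable)
  qed (use LOne.IH o LOne.prems(2) in \<open>auto intro!: finite_set_htree strip_finite_grad_law sel_pair_measurable\<close>)
qed

text \<open>Both operations preserve the subgradient inequality: inequalities for summands add, and
  a maximum is bounded below by the branch that attains it at \<open>p\<close>.\<close>

lemma gslope_subgradient:
  assumes "\<epsilon> \<ge> 0" shows "tnorm (dual_tree T) p + \<epsilon> * gslope T z p \<le> tnorm (dual_tree T) (p + \<epsilon> *\<^sub>R z)"
proof (induction T)
  case (Seg v)
  have e: "tnorm (dual_tree (Seg v)) x = \<bar>x \<bullet> v\<bar>" for x by (cases "v = 0") (auto simp: abs_mult)
  have key: "sgn a * (a + b) \<le> \<bar>a + b\<bar>" for a b :: real by (auto simp: sgn_if)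
  have "tnorm (dual_tree (Seg v)) p + \<epsilon> * gslope (Seg v) z p = sgn (p \<bullet> v) * (p \<bullet> v + \<epsilon> * (z \<bullet> v))"
    unfolding e by (simp add: distrib_left inner_commute[of v z] sgn_if)
  also have "\<dots> \<le> \<bar>p \<bullet> v + \<epsilon> * (z \<bullet> v)\<bar>" by (rule key)
  finally show ?case unfolding e by (simp only: inner_add_left inner_scaleR_left)
next
  case (LInf a b)
  have "\<epsilon> * (s + t) = \<epsilon> * s + \<epsilon> * t" for s t by (rule distrib_left)
  with LInf show ?case by simp
next
  case (LOne a b)
  then show ?case by (auto simp: max_def)
qed

lemma gslope_bounded: "\<exists>C. \<forall>p. \<bar>gslope T z p\<bar> \<le> C"
proof (induction T)
  case (Seg v)
  show ?case by (rule exI[of _ "\<bar>v \<bullet> z\<bar>"]) (auto simp: abs_mult sgn_if)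
next
  case (LInf a b)
  then obtain C D where CD: "\<And>p. \<bar>gslope a z p\<bar> \<le> C" "\<And>p. \<bar>gslope b z p\<bar> \<le> D" by blast
  have "\<bar>gslope (LInf a b) z p\<bar> \<le> C + D" for p
    using CD(1)[of p] CD(2)[of p] unfolding gslope.simps by linarith
  then show ?case by blast
next
  case (LOne a b)
  then obtain C D where CD: "\<And>p. \<bar>gslope a z p\<bar> \<le> C" "\<And>p. \<bar>gslope b z p\<bar> \<le> D" by blast
  have "\<bar>gslope (LOne a b) z p\<bar> \<le> max C D" for p
    using CD(1)[of p] CD(2)[of p] by (simp add: le_max_iff_disj)
  then show ?case by blast
qed

text \<open>The Hoelder inequality between a norm and its dual. The vector \<open>x\<close> is
  confined to the span of the leaves because \<open>tnorm\<close> does not see its component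
  orthogonal to them.\<close>

lemma inner_le_tnorm:
  assumes "orth_tree T" "x \<in> span (set_htree T)"
  shows "x \<bullet> p \<le> tnorm T x * tnorm (dual_tree T) p"
  using assms
proof (induction T arbitrary: x)
  case (Seg v)
  then obtain t where x: "x = t *\<^sub>R v" by (auto simp: span_singleton)
  have "x \<bullet> p \<le> \<bar>t\<bar> * \<bar>p \<bullet> v\<bar>" by (simp add: x inner_commute abs_mult[symmetric])
  also have "\<dots> = tnorm (Seg v) x * tnorm (dual_tree (Seg v)) p" using Seg by (simp add: x abs_mult)
  finally show ?case .
next
  case (LInf a b)
  have o: "orth_tree a" "orth_tree b" and vw: "\<And>v w. v \<in> set_htree a \<Longrightarrow> w \<in> set_htree b \<Longrightarrow> v \<bullet> w = 0"
    using LInf.prems(1) by auto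
  have wv: "\<And>v w. v \<in> set_htree b \<Longrightarrow> w \<in> set_htree a \<Longrightarrow> v \<bullet> w = 0"
    by (subst inner_commute, rule vw)
  obtain y z where yz: "x = y + z" "y \<in> span (set_htree a)" "z \<in> span (set_htree b)"
    using LInf.prems(2) by (auto simp: span_Un)
  have n: "tnorm a x = tnorm a y" "tnorm b (z + y) = tnorm b z"
    unfolding yz(1) using vw wv by (auto intro!: tnorm_add_orth span_orth[OF yz(3)] span_orth[OF yz(2)])
  have "x \<bullet> p \<le> tnorm a y * tnorm (dual_tree a) p + tnorm b z * tnorm (dual_tree b) p"
    using LInf.IH o yz by (simp add: inner_add_left add_mono)
  also have "\<dots> \<le> max (tnorm a y) (tnorm b z) * tnorm (dual_tree a) p + max (tnorm a y) (tnorm b z) * tnorm (dual_tree b) p"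
    by (intro add_mono mult_right_mono tnorm_nonneg) auto
  finally show ?case using n yz by (simp add: distrib_left add.commute)
next
  case (LOne a b)
  have o: "orth_tree a" "orth_tree b" and vw: "\<And>v w. v \<in> set_htree a \<Longrightarrow> w \<in> set_htree b \<Longrightarrow> v \<bullet> w = 0"
    using LOne.prems(1) by auto
  have wv: "\<And>v w. v \<in> set_htree b \<Longrightarrow> w \<in> set_htree a \<Longrightarrow> v \<bullet> w = 0"
    by (subst inner_commute, rule vw)
  obtain y z where yz: "x = y + z" "y \<in> span (set_htree a)" "z \<in> span (set_htree b)"
    using LOne.prems(2) by (auto simp: span_Un)
  have n: "tnorm a x = tnorm a y" "tnorm b (z + y) = tnorm b z"
    unfolding yz(1) using vw wv by (auto intro!: tnorm_add_orth span_orth[OF yz(3)] span_orth[OF yz(2)])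
  have "x \<bullet> p \<le> tnorm a y * tnorm (dual_tree a) p + tnorm b z * tnorm (dual_tree b) p"
    using LOne.IH o yz by (simp add: inner_add_left add_mono)
  also have "\<dots> \<le> tnorm a y * max (tnorm (dual_tree a) p) (tnorm (dual_tree b) p) + tnorm b z * max (tnorm (dual_tree a) p) (tnorm (dual_tree b) p)"
    by (intro add_mono mult_left_mono tnorm_nonneg) auto
  finally show ?case using n yz by (simp add: distrib_right add.commute)
qed

text \<open>Normalising the leaves gives an orthonormal basis, whose measure is Lebesgue measure;
  the factors \<open>1 / norm v\<close> multiply to \<open>tree_scale\<close>.\<close>

lemma span_leb_tree:
  assumes o: "orth_tree T" and sp: "span (set_htree T) = UNIV" and f: "f \<in> borel_measurable borel"
  shows "(\<integral>\<^sup>+x. f x \<partial>span_leb (set_htree T)) = ennreal (tree_scale T) * (\<integral>\<^sup>+x. f x \<partial>lborel)"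
proof -
  let ?s = "\<lambda>v. 1 / norm v" and ?E = "set_htree T"
  have nz: "v \<noteq> 0" if "v \<in> ?E" for v using orth_tree_nonzero[OF o that] .
  have pw: "pairwise orthogonal ?E" by (rule orth_tree_pairwise[OF o])
  have inj: "inj_on (\<lambda>v. ?s v *\<^sub>R v) ?E"
  proof (rule inj_onI)
    fix v w assume vw: "v \<in> ?E" "w \<in> ?E" and eq: "?s v *\<^sub>R v = ?s w *\<^sub>R w"
    show "v = w"
    proof (rule ccontr)
      assume "v \<noteq> w"
      then have "v \<bullet> w = 0" using pw vw by (auto simp: pairwise_def orthogonal_def)
      then have "(?s v *\<^sub>R v) \<bullet> (?s w *\<^sub>R w) = 0" by simp
      then have "(?s v *\<^sub>R v) \<bullet> (?s v *\<^sub>R v) = 0" by (simp only: eq)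
      then have "?s v *\<^sub>R v = 0" by (simp only: inner_eq_zero_iff)
      then show False using nz[OF vw(1)] by simp
    qed
  qed
  let ?F = "(\<lambda>v. ?s v *\<^sub>R v) ` ?E"
  have spF: "span ?F = UNIV"
  proof -
    have "v \<in> span ?F" if "v \<in> ?E" for v
    proof -
      have "norm v *\<^sub>R (?s v *\<^sub>R v) \<in> span ?F" using that by (intro span_scale span_base) auto
      then show ?thesis using nz[OF that] by simp
    qed
    then have "span ?E \<subseteq> span ?F" by (intro span_minimal) auto
    then show ?thesis using sp by auto
  qed
  have pwF: "pairwise orthogonal ?F"
  proof (rule pairwiseI)
    fix x y assume "x \<in> ?F" "y \<in> ?F" "x \<noteq> y"
    then obtain v w where vw: "v \<in> ?E" "w \<in> ?E" "x = ?s v *\<^sub>R v" "y = ?s w *\<^sub>R w" "v \<noteq> w" by blast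
    then have "v \<bullet> w = 0" using pw by (auto simp: pairwise_def orthogonal_def)
    then show "orthogonal x y" by (simp add: vw(3,4) orthogonal_def)
  qed
  have nF: "norm e = 1" if e: "e \<in> ?F" for e
  proof -
    obtain v where "v \<in> ?E" "e = ?s v *\<^sub>R v" using e by blast
    then show ?thesis using nz by simp
  qed
  have F: "(\<integral>\<^sup>+x. f x \<partial>span_leb ?F) = (\<integral>\<^sup>+x. f x \<partial>lborel)"
    by (rule nn_integral_span_leb_orthonormal_basis[OF finite_imageI[OF finite_set_htree] pwF nF spF f])
  have r: "(\<integral>\<^sup>+x. f x \<partial>span_leb ?E) = ennreal (\<Prod>v\<in>?E. ?s v) * (\<integral>\<^sup>+x. f x \<partial>span_leb ?F)"
    by (rule nn_integral_span_leb_rescale[OF finite_set_htree _ inj f]) (use nz in simp)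
  show ?thesis unfolding r tree_scale_prod[OF o] F ..
qed

lemma tnorm_le_norm: "\<exists>C. \<forall>x. tnorm T x \<le> C * norm x"
proof (induction T)
  case (Seg v)
  have "tnorm (Seg v) x \<le> (norm v / (v \<bullet> v)) * norm x" for x
    using Cauchy_Schwarz_ineq2[of x v] by (simp add: divide_right_mono mult.commute)
  then show ?case by blast
next
  case (LInf a b)
  then obtain C D where CD: "\<And>x. tnorm a x \<le> C * norm x" "\<And>x. tnorm b x \<le> D * norm x" by blast
  have "tnorm (LInf a b) x \<le> max C D * norm x" for x
    using order_trans[OF CD(1)[of x] mult_right_mono[of C "max C D" "norm x"]]
      order_trans[OF CD(2)[of x] mult_right_mono[of D "max C D" "norm x"]] by simp
  then show ?case by blast
next
  case (LOne a b)
  then obtain C D where CD: "\<And>x. tnorm a x \<le> C * norm x" "\<And>x. tnorm b x \<le> D * norm x" by blast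
  have "tnorm (LOne a b) x \<le> (C + D) * norm x" for x
    using CD[of x] by (simp add: distrib_right)
  then show ?case by blast
qed

text \<open>Apply the duality inequality to the pair \<open>x\<close>, \<open>x\<close>, and bound
  the dual norm by a multiple of the Euclidean one.\<close>

lemma norm_le_tnorm:
  assumes "orth_tree T" "span (set_htree T) = UNIV"
  shows "\<exists>C. \<forall>x. norm x \<le> C * tnorm T x"
proof -
  obtain C where C: "\<And>x. tnorm (dual_tree T) x \<le> C * norm x" using tnorm_le_norm by blast
  have "norm x \<le> C * tnorm T x" for x
  proof (cases "x = 0")
    case True
    have "tnorm T 0 = 0" using tnorm_scale[of T 0 0] by simp
    with True show ?thesis by simp
  next
    case False
    have "norm x * norm x = x \<bullet> x" by (simp add: dot_square_norm power2_eq_square)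
    also have "\<dots> \<le> tnorm T x * tnorm (dual_tree T) x"
      by (rule inner_le_tnorm) (use assms in auto)
    also have "\<dots> \<le> tnorm T x * (C * norm x)" by (intro mult_left_mono C tnorm_nonneg)
    finally have "norm x * norm x \<le> (C * tnorm T x) * norm x" by (simp add: mult_ac)
    then show ?thesis using False by (simp add: mult_le_cancel_right)
  qed
  then show ?thesis by blast
qed

lemma compact_tnorm_ball:
  assumes "orth_tree T" "span (set_htree T) = UNIV"
  shows "compact {x. tnorm T x \<le> r}"
proof -
  obtain C where C: "\<And>x. norm x \<le> C * tnorm T x" using norm_le_tnorm[OF assms] by blast
  have "norm x \<le> \<bar>C\<bar> * \<bar>r\<bar>" if "tnorm T x \<le> r" for x
  proof -
    have "norm x \<le> \<bar>C\<bar> * tnorm T x" using C[of x] tnorm_nonneg[of T x] mult_right_mono[of C "\<bar>C\<bar>" "tnorm T x"] by linarith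
    also have "\<dots> \<le> \<bar>C\<bar> * \<bar>r\<bar>" using that by (intro mult_left_mono) auto
    finally show ?thesis .
  qed
  then have "bounded {x. tnorm T x \<le> r}" by (auto simp: bounded_iff)
  moreover have "closed {x. tnorm T x \<le> r}"
    by (intro closed_Collect_le tnorm_continuous continuous_on_const)
  ultimately show ?thesis by (simp add: compact_eq_bounded_closed)
qed

lemma span_dual_tree:
  assumes "orth_tree T" shows "span (set_htree (dual_tree T)) = span (set_htree T)"
proof -
  have *: "span (set_htree (dual_tree S)) \<subseteq> span (set_htree S)" for S :: "'a htree"
    by (intro span_minimal) (auto simp: set_dual_tree intro: span_scale span_base)
  show ?thesis using *[of T] *[of "dual_tree T"] by auto
qed

section \<open>Hyperplane sections and projections\<close>

text \<open>Volumes are taken in the hyperplane orthogonal to \<open>u\<close>, and \<open>z\<close>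
  is the direction of projection. As \<open>z\<close> may be oblique to \<open>u\<close>, one frame
  serves sections, with \<open>z\<close> parallel to \<open>u\<close>, and arbitrary linear
  projections.\<close>

locale hyperplane_frame =
  fixes T :: "'a::euclidean_space htree" and u z :: 'a and E :: "'a set"
  assumes orth: "orth_tree T" and full: "span (set_htree T) = UNIV"
    and zu: "z \<bullet> u = 1"
    and E: "finite E" "pairwise orthogonal E" "\<And>e. e \<in> E \<Longrightarrow> norm e = 1" "span E = {x. x \<bullet> u = 0}"
begin

definition "\<nu> = u /\<^sub>R norm u"

lemma u_nz: "u \<noteq> 0" and norm_u: "norm u > 0"
  using zu by auto

lemma \<nu>_notin: "\<nu> \<notin> E"
proof
  assume "\<nu> \<in> E"
  then have "\<nu> \<in> span E" by (rule span_base)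
  then show False using u_nz by (simp add: E(4) \<nu>_def)
qed

lemma E_perp: "e \<in> E \<Longrightarrow> e \<bullet> u = 0"
  using span_base[of e E] E(4) by auto

lemma frame_span: "span (insert \<nu> E) = UNIV"
proof -
  have "x \<in> span (insert \<nu> E)" for x
  proof -
    have "x - ((x \<bullet> u) / norm u) *\<^sub>R \<nu> \<in> span E"
      using u_nz by (simp add: E(4) \<nu>_def inner_diff_left dot_square_norm power2_eq_square)
    then show ?thesis unfolding span_insert by blast
  qed
  then show ?thesis by auto
qed

lemma frame_orth: "pairwise orthogonal (insert \<nu> E)"
  using E(2) E_perp by (auto simp: pairwise_insert orthogonal_def \<nu>_def inner_commute)

lemma frame_norm: "e \<in> insert \<nu> E \<Longrightarrow> norm e = 1"
  using E(3) u_nz by (auto simp: \<nu>_def)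

lemma card_frame: "card E + 1 = DIM('a)"
proof -
  have "independent (insert \<nu> E)"
    using frame_orth frame_norm[of 0] by (intro pairwise_orthogonal_independent) auto
  then have "card (insert \<nu> E) = DIM('a)"
    using dim_eq_card[of "insert \<nu> E" UNIV] frame_span by simp
  then show ?thesis using \<nu>_notin E(1) by simp
qed

lemma card_frame_hdim: "card E + 1 = hdim T"
proof -
  have "independent (set_htree T)"
    using orth_tree_pairwise[OF orth] orth_tree_nonzero[OF orth] by (intro pairwise_orthogonal_independent) auto
  then have "card (set_htree T) = DIM('a)"
    using dim_eq_card[of "set_htree T" UNIV] full by simp
  then show ?thesis using card_frame card_set_htree[OF orth] by simp
qed

lemma lborel_split:
  assumes f: "f \<in> borel_measurable borel"
  shows "(\<integral>\<^sup>+x. f x \<partial>lborel) = (\<integral>\<^sup>+t. \<integral>\<^sup>+y. f (t *\<^sub>R \<nu> + y) \<partial>span_leb E \<partial>lborel)"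
proof -
  have "(\<integral>\<^sup>+x. f x \<partial>lborel) = (\<integral>\<^sup>+x. f x \<partial>span_leb (insert \<nu> E))"
    by (rule nn_integral_span_leb_orthonormal_basis[OF finite.insertI[OF E(1)] frame_orth frame_norm frame_span f, symmetric])
  also have "\<dots> = (\<integral>\<^sup>+t. \<integral>\<^sup>+y. f (t *\<^sub>R \<nu> + y) \<partial>span_leb E \<partial>lborel)"
    by (rule nn_integral_span_leb_insert[OF E(1) \<nu>_notin f])
  finally show ?thesis .
qed

text \<open>The map \<open>y - (y \<bullet> z) *\<^sub>R u\<close> lifts \<open>y\<close> along
  \<open>u\<close> to the hyperplane orthogonal to \<open>z\<close>. Within the hyperplane of the
  frame, \<open>slice\<close> is thus the orthogonal projection of the central section of the ball
  orthogonal to \<open>z\<close>. It pairs with \<open>shadow 1\<close>, since \<open>proj p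
  \<bullet> y = p \<bullet> (y - (y \<bullet> z) *\<^sub>R u)\<close>.\<close>

definition "slice = {y. tnorm T (y - (y \<bullet> z) *\<^sub>R u) \<le> 1}"
definition "proj p = p - (p \<bullet> u) *\<^sub>R z"
definition "shadow r = proj ` {p. tnorm (dual_tree T) p \<le> r}"

lemma span_leb_slice_scale:
  assumes R: "R > 0"
  shows "(\<integral>\<^sup>+y. win (tnorm T (y - (y \<bullet> z) *\<^sub>R u)) R \<partial>span_leb E) = ennreal (R ^ card E) * emeasure (span_leb E) slice"
proof -
  have s: "slice \<in> sets borel"
    unfolding slice_def by measurable
  have "tnorm T (R *\<^sub>R y - (R * (y \<bullet> z)) *\<^sub>R u) = R * tnorm T (y - (y \<bullet> z) *\<^sub>R u)" for y
  proof -
    have "R *\<^sub>R y - (R * (y \<bullet> z)) *\<^sub>R u = R *\<^sub>R (y - (y \<bullet> z) *\<^sub>R u)" by (simp add: scaleR_diff_right)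
    then show ?thesis using R tnorm_scale[of T R] by simp
  qed
  then have e: "win (tnorm T (R *\<^sub>R y - ((R *\<^sub>R y) \<bullet> z) *\<^sub>R u)) R = indicator slice y" for y
    using R by (simp add: win_def slice_def indicator_def tnorm_abs abs_mult)
  have "(\<integral>\<^sup>+y. win (tnorm T (y - (y \<bullet> z) *\<^sub>R u)) R \<partial>span_leb E)
    = ennreal (R ^ card E) * (\<integral>\<^sup>+y. win (tnorm T (R *\<^sub>R y - ((R *\<^sub>R y) \<bullet> z) *\<^sub>R u)) R \<partial>span_leb E)"
    by (rule nn_integral_span_leb_scale[OF E(1) R]) measurable
  then show ?thesis unfolding e using s by simp
qed

text \<open>Fubini along \<open>u\<close>: every section of the slab parallel to the central one is
  compared with the central one. The error factor
  \<open>(1 + \<epsilon> * tnorm T u) ^ card E\<close> tends to 1, so continuity of the section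
  volume is not called upon.\<close>

lemma slab_volume:
  assumes \<epsilon>: "\<epsilon> > 0"
  shows "(\<integral>\<^sup>+x. win (x \<bullet> z) \<epsilon> * win (tnorm T x) 1 \<partial>lborel)
    \<le> ennreal (norm u * (2 * \<epsilon>) * (1 + \<epsilon> * tnorm T u) ^ card E) * emeasure (span_leb E) slice"
proof -
  let ?F = "\<lambda>x. win (x \<bullet> z) \<epsilon> * win (tnorm T x) 1"
  let ?P = "\<lambda>y. y - (y \<bullet> z) *\<^sub>R u"
  let ?R = "1 + \<epsilon> * tnorm T u"
  have R: "?R > 0" using \<epsilon> tnorm_nonneg[of T u] by (simp add: add_pos_nonneg)
  have "(\<integral>\<^sup>+x. ?F x \<partial>lborel) = (\<integral>\<^sup>+t. \<integral>\<^sup>+y. ?F (t *\<^sub>R \<nu> + y) \<partial>span_leb E \<partial>lborel)"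
    by (rule lborel_split) measurable
  also have "\<dots> = (\<integral>\<^sup>+y. \<integral>\<^sup>+t. ?F (t *\<^sub>R \<nu> + y) \<partial>lborel \<partial>span_leb E)"
    by (rule nn_integral_span_leb_Tonelli[OF E(1) sigma_finite_lborel]) measurable
  \<comment> \<open>The new variable \<open>s\<close> is the height \<open>x \<bullet> z\<close>;
    along \<open>\<nu>\<close> the old one is \<open>norm u * (s - y \<bullet> z)\<close>, whence
    the Jacobian \<open>norm u\<close>.\<close>
  also have "\<dots> = (\<integral>\<^sup>+y. \<integral>\<^sup>+s. ennreal (norm u) * (win s \<epsilon> * win (tnorm T (?P y + s *\<^sub>R u)) 1) \<partial>lborel \<partial>span_leb E)"
  proof (rule nn_integral_cong)
    fix y
    have "(\<integral>\<^sup>+t. ?F (t *\<^sub>R \<nu> + y) \<partial>lborel) = ennreal (norm u) * (\<integral>\<^sup>+s. ?F ((- norm u * (y \<bullet> z) + norm u * s) *\<^sub>R \<nu> + y) \<partial>lborel)"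
      using nn_integral_real_affine[of "\<lambda>t. ?F (t *\<^sub>R \<nu> + y)" "norm u" "- norm u * (y \<bullet> z)"] norm_u by simp
    also have "(\<integral>\<^sup>+s. ?F ((- norm u * (y \<bullet> z) + norm u * s) *\<^sub>R \<nu> + y) \<partial>lborel) = (\<integral>\<^sup>+s. win s \<epsilon> * win (tnorm T (?P y + s *\<^sub>R u)) 1 \<partial>lborel)"
    proof (rule nn_integral_cong)
      fix s
      have "(- norm u * (y \<bullet> z) + norm u * s) *\<^sub>R \<nu> = (s - y \<bullet> z) *\<^sub>R u"
      proof -
        have "- norm u * (y \<bullet> z) + norm u * s = (s - y \<bullet> z) * norm u" by (simp add: algebra_simps)
        then show ?thesis using norm_u by (simp add: \<nu>_def)
      qed
      then have eq: "(- norm u * (y \<bullet> z) + norm u * s) *\<^sub>R \<nu> + y = ?P y + s *\<^sub>R u" by (simp add: algebra_simps)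
      have "(?P y + s *\<^sub>R u) \<bullet> z = s" using zu by (simp add: inner_add_left inner_diff_left inner_commute[of u z])
      then show "?F ((- norm u * (y \<bullet> z) + norm u * s) *\<^sub>R \<nu> + y) = win s \<epsilon> * win (tnorm T (?P y + s *\<^sub>R u)) 1"
        unfolding eq by simp
    qed
    finally show "(\<integral>\<^sup>+t. ?F (t *\<^sub>R \<nu> + y) \<partial>lborel) = (\<integral>\<^sup>+s. ennreal (norm u) * (win s \<epsilon> * win (tnorm T (?P y + s *\<^sub>R u)) 1) \<partial>lborel)"
      by (simp add: nn_integral_cmult)
  qed
  \<comment> \<open>A move of length at most \<open>\<epsilon>\<close> along \<open>u\<close>
    changes the norm by at most \<open>\<epsilon> * tnorm T u\<close>, so each parallel section,
    moved to height 0, lies in the central section of the ball of radius \<open>?R\<close>.\<close>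
  also have "\<dots> \<le> (\<integral>\<^sup>+y. \<integral>\<^sup>+s. ennreal (norm u) * win s \<epsilon> * win (tnorm T (?P y)) ?R \<partial>lborel \<partial>span_leb E)"
  proof (intro nn_integral_mono)
    fix y s
    have "tnorm T (?P y) \<le> ?R" if "\<bar>s\<bar> \<le> \<epsilon>" "tnorm T (?P y + s *\<^sub>R u) \<le> 1"
    proof -
      have "tnorm T (?P y) \<le> tnorm T (?P y + s *\<^sub>R u) + tnorm T ((- s) *\<^sub>R u)"
        using tnorm_triangle[of T "?P y + s *\<^sub>R u" "(- s) *\<^sub>R u"] by simp
      also have "tnorm T ((- s) *\<^sub>R u) \<le> \<epsilon> * tnorm T u"
        unfolding tnorm_scale using that by (simp add: mult_right_mono tnorm_nonneg)
      finally show ?thesis using that by simp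
    qed
    then show "ennreal (norm u) * (win s \<epsilon> * win (tnorm T (?P y + s *\<^sub>R u)) 1) \<le> ennreal (norm u) * win s \<epsilon> * win (tnorm T (?P y)) ?R"
      by (auto simp: win_def tnorm_abs)
  qed
  also have "\<dots> = (\<integral>\<^sup>+y. ennreal (norm u * (2 * \<epsilon>)) * win (tnorm T (?P y)) ?R \<partial>span_leb E)"
  proof (rule nn_integral_cong)
    fix y
    have l: "(\<integral>\<^sup>+s. win s \<epsilon> \<partial>lborel) = ennreal (2 * \<epsilon>)"
    proof -
      have "win s \<epsilon> = indicator {- \<epsilon>..\<epsilon>} s" for s by (auto simp: win_def indicator_def)
      then show ?thesis using \<epsilon> by simp
    qed
    have "(\<integral>\<^sup>+s. ennreal (norm u) * win s \<epsilon> * win (tnorm T (?P y)) ?R \<partial>lborel) = (\<integral>\<^sup>+s. ennreal (norm u) * win s \<epsilon> \<partial>lborel) * win (tnorm T (?P y)) ?R"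
      by (rule nn_integral_multc) measurable
    also have "(\<integral>\<^sup>+s. ennreal (norm u) * win s \<epsilon> \<partial>lborel) = ennreal (norm u) * (\<integral>\<^sup>+s. win s \<epsilon> \<partial>lborel)"
      by (rule nn_integral_cmult) measurable
    finally show "(\<integral>\<^sup>+s. ennreal (norm u) * win s \<epsilon> * win (tnorm T (?P y)) ?R \<partial>lborel) = ennreal (norm u * (2 * \<epsilon>)) * win (tnorm T (?P y)) ?R"
      unfolding l using \<epsilon> by (simp add: ennreal_mult)
  qed
  also have "\<dots> = ennreal (norm u * (2 * \<epsilon>)) * (\<integral>\<^sup>+y. win (tnorm T (?P y)) ?R \<partial>span_leb E)"
    by (rule nn_integral_cmult) measurable
  also have "\<dots> = ennreal (norm u * (2 * \<epsilon>) * ?R ^ card E) * emeasure (span_leb E) slice"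
    unfolding span_leb_slice_scale[OF R] using \<epsilon> R by (simp add: ennreal_mult mult.assoc)
  finally show ?thesis .
qed

lemma dual_full: "span (set_htree (dual_tree T)) = UNIV"
  using span_dual_tree[OF orth] full by simp

lemma proj_linear: "linear proj"
  unfolding proj_def by (intro linearI) (auto simp: inner_add_left algebra_simps)

lemma compact_shadow: "compact (shadow r)"
  unfolding shadow_def
  by (intro compact_continuous_image linear_continuous_on linear_linear[THEN iffD2] proj_linear
      compact_tnorm_ball orth_dual_tree orth dual_full)

lemma shadow_borel [measurable]: "shadow r \<in> sets borel"
  using compact_shadow by (rule borel_compact)

lemma span_leb_shadow_scale:
  assumes r: "r > 0" shows "emeasure (span_leb E) (shadow r) = ennreal (r ^ card E) * emeasure (span_leb E) (shadow 1)"
proof -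
  have "indicator (shadow r) (r *\<^sub>R y) = (indicator (shadow 1) y :: ennreal)" for y
  proof -
    have "r *\<^sub>R y \<in> shadow r \<longleftrightarrow> y \<in> shadow 1"
    proof
      assume "r *\<^sub>R y \<in> shadow r"
      then obtain p where p: "tnorm (dual_tree T) p \<le> r" "r *\<^sub>R y = proj p" by (auto simp: shadow_def)
      have "y = proj ((1 / r) *\<^sub>R p)" using p(2) r linear_scale[OF proj_linear, of "1 / r" p]
        by (metis (no_types) divide_self_if less_irrefl scaleR_one scaleR_scaleR times_divide_eq_left mult_1)
      moreover have "tnorm (dual_tree T) ((1 / r) *\<^sub>R p) \<le> 1" unfolding tnorm_scale using p(1) r by simp
      ultimately show "y \<in> shadow 1" by (auto simp: shadow_def)
    next
      assume "y \<in> shadow 1"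
      then obtain p where p: "tnorm (dual_tree T) p \<le> 1" "y = proj p" by (auto simp: shadow_def)
      have "r *\<^sub>R y = proj (r *\<^sub>R p)" using p(2) linear_scale[OF proj_linear, of r p] by simp
      moreover have "tnorm (dual_tree T) (r *\<^sub>R p) \<le> r" unfolding tnorm_scale using p(1) r by simp
      ultimately show "r *\<^sub>R y \<in> shadow r" by (auto simp: shadow_def)
    qed
    then show ?thesis by (simp add: indicator_def)
  qed
  moreover have "(\<integral>\<^sup>+y. indicator (shadow r) y \<partial>span_leb E) = ennreal (r ^ card E) * (\<integral>\<^sup>+y. indicator (shadow r) (r *\<^sub>R y) \<partial>span_leb E)"
    by (rule nn_integral_span_leb_scale[OF E(1) r]) measurable
  ultimately show ?thesis by simp
qed

text \<open>The vectors \<open>norm u *\<^sub>R z\<close> and \<open>\<nu>\<close> differ by a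
  vector of the hyperplane. At each height a translation inside the hyperplane therefore replaces
  one by the other, a shear, and rescaling the height gives \<open>1 / norm u\<close>.\<close>

lemma lborel_oblique:
  assumes f[measurable]: "f \<in> borel_measurable borel"
  shows "(\<integral>\<^sup>+x. f x \<partial>lborel) = ennreal (1 / norm u) * (\<integral>\<^sup>+y. \<integral>\<^sup>+t. f (y + t *\<^sub>R z) \<partial>lborel \<partial>span_leb E)"
proof -
  have "norm u *\<^sub>R z - \<nu> \<in> span E"
    using zu norm_u by (simp add: E(4) \<nu>_def inner_diff_left dot_square_norm power2_eq_square)
  then have h: "t *\<^sub>R (norm u *\<^sub>R z - \<nu>) \<in> span E" for t by (rule span_scale)
  have "(\<integral>\<^sup>+x. f x \<partial>lborel) = (\<integral>\<^sup>+t. \<integral>\<^sup>+y. f (t *\<^sub>R \<nu> + y) \<partial>span_leb E \<partial>lborel)"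
    by (rule lborel_split[OF f])
  also have "\<dots> = (\<integral>\<^sup>+t. \<integral>\<^sup>+y. f (y + (norm u * t) *\<^sub>R z) \<partial>span_leb E \<partial>lborel)"
  proof (rule nn_integral_cong)
    fix t
    have "(\<integral>\<^sup>+y. f (t *\<^sub>R \<nu> + (y + t *\<^sub>R (norm u *\<^sub>R z - \<nu>))) \<partial>span_leb E) = (\<integral>\<^sup>+y. f (t *\<^sub>R \<nu> + y) \<partial>span_leb E)"
      by (rule nn_integral_span_leb_translate[OF E(1) h]) measurable
    moreover have "t *\<^sub>R \<nu> + (y + t *\<^sub>R (norm u *\<^sub>R z - \<nu>)) = y + (norm u * t) *\<^sub>R z" for y
      by (simp add: algebra_simps)
    ultimately show "(\<integral>\<^sup>+y. f (t *\<^sub>R \<nu> + y) \<partial>span_leb E) = (\<integral>\<^sup>+y. f (y + (norm u * t) *\<^sub>R z) \<partial>span_leb E)" by simp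
  qed
  also have "\<dots> = ennreal (1 / norm u) * (\<integral>\<^sup>+t. \<integral>\<^sup>+y. f (y + t *\<^sub>R z) \<partial>span_leb E \<partial>lborel)"
  proof -
    have "(\<integral>\<^sup>+t. \<integral>\<^sup>+y. f (y + t *\<^sub>R z) \<partial>span_leb E \<partial>lborel) = ennreal (norm u) * (\<integral>\<^sup>+t. \<integral>\<^sup>+y. f (y + (norm u * t) *\<^sub>R z) \<partial>span_leb E \<partial>lborel)"
      using nn_integral_real_affine[of "\<lambda>t. \<integral>\<^sup>+y. f (y + t *\<^sub>R z) \<partial>span_leb E" "norm u" 0] norm_u
        borel_measurable_span_leb_integral[OF E(1), of "\<lambda>t y. f (y + t *\<^sub>R z)" borel] by simp
    then have "ennreal (1 / norm u) * (\<integral>\<^sup>+t. \<integral>\<^sup>+y. f (y + t *\<^sub>R z) \<partial>span_leb E \<partial>lborel)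
      = (ennreal (1 / norm u) * ennreal (norm u)) * (\<integral>\<^sup>+t. \<integral>\<^sup>+y. f (y + (norm u * t) *\<^sub>R z) \<partial>span_leb E \<partial>lborel)"
      by (simp only: mult.assoc)
    also have "ennreal (1 / norm u) * ennreal (norm u) = 1" using norm_u by (simp flip: ennreal_mult)
    finally show ?thesis by simp
  qed
  also have "(\<integral>\<^sup>+t. \<integral>\<^sup>+y. f (y + t *\<^sub>R z) \<partial>span_leb E \<partial>lborel) = (\<integral>\<^sup>+y. \<integral>\<^sup>+t. f (y + t *\<^sub>R z) \<partial>lborel \<partial>span_leb E)"
    by (rule nn_integral_span_leb_Tonelli[OF E(1) sigma_finite_lborel]) measurable
  finally show ?thesis .
qed

end

text \<open>By convexity the sublevel set is an interval, and the points that leave it in a step of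
  length \<open>\<epsilon>\<close> lie in its final stretch of that length.\<close>

lemma emeasure_exit_set:
  fixes \<phi> :: "real \<Rightarrow> real"
  assumes conv: "\<And>s t x. s \<le> x \<Longrightarrow> x \<le> t \<Longrightarrow> \<phi> s \<le> r \<Longrightarrow> \<phi> t \<le> r \<Longrightarrow> \<phi> x \<le> r"
    and \<epsilon>: "\<epsilon> > 0" and J: "J = {t. \<phi> t \<le> r \<and> r < \<phi> (t + \<epsilon>)}"
  shows "emeasure lborel J \<le> ennreal \<epsilon>"
proof (cases "J = {}")
  case False
  have gap: "t < s + \<epsilon>" if "s \<in> J" "t \<in> J" for s t
  proof (rule ccontr)
    assume "\<not> t < s + \<epsilon>"
    then have "\<phi> (s + \<epsilon>) \<le> r" using that \<epsilon> by (intro conv[of s "s + \<epsilon>" t]) (auto simp: J)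
    then show False using that by (simp add: J)
  qed
  obtain t0 where t0: "t0 \<in> J" using False by blast
  have bdd: "bdd_below J" using gap[OF _ t0] by (intro bdd_belowI[of _ "t0 - \<epsilon>"]) force
  have "J \<subseteq> {Inf J..Inf J + \<epsilon>}"
  proof
    fix t assume t: "t \<in> J"
    have "t - \<epsilon> \<le> Inf J" using gap[OF _ t] False by (intro cInf_greatest) force+
    then show "t \<in> {Inf J..Inf J + \<epsilon>}" using cInf_lower[OF t bdd] by simp
  qed
  then have "emeasure lborel J \<le> emeasure lborel {Inf J..Inf J + \<epsilon>}" by (rule emeasure_mono) simp
  then show ?thesis using \<epsilon> by simp
qed simp

section \<open>The mean slope bounded by the volume of the shadow\<close>

context hyperplane_frame
begin

abbreviation "M \<equiv> tnorm (dual_tree T)"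

text \<open>The lines in direction \<open>z\<close> that meet the ball of radius \<open>r\<close>
  are indexed by its shadow, and on each of them the points leaving the ball have length at most
  \<open>\<epsilon>\<close>.\<close>

lemma exit_volume:
  assumes r: "r > 0" and \<epsilon>: "\<epsilon> > 0"
  shows "emeasure lborel {p. M p \<le> r \<and> r < M (p + \<epsilon> *\<^sub>R z)} \<le> ennreal (\<epsilon> / norm u * r ^ card E) * emeasure (span_leb E) (shadow 1)"
proof -
  let ?J = "{p. M p \<le> r \<and> r < M (p + \<epsilon> *\<^sub>R z)}"
  have Jb[measurable]: "?J \<in> sets borel" by measurable
  have "emeasure lborel ?J = (\<integral>\<^sup>+p. indicator ?J p \<partial>lborel)" by simp
  also have "\<dots> = ennreal (1 / norm u) * (\<integral>\<^sup>+y. \<integral>\<^sup>+t. indicator ?J (y + t *\<^sub>R z) \<partial>lborel \<partial>span_leb E)"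
    by (rule lborel_oblique) measurable
  also have "(\<integral>\<^sup>+y. \<integral>\<^sup>+t. indicator ?J (y + t *\<^sub>R z) \<partial>lborel \<partial>span_leb E)
     = (\<integral>\<^sup>+y. (\<integral>\<^sup>+t. indicator ?J (y + t *\<^sub>R z) \<partial>lborel) * indicator {y. y \<bullet> u = 0} y \<partial>span_leb E)"
  proof (rule nn_integral_span_leb_cong)
    have m: "(\<lambda>y. \<integral>\<^sup>+t. indicator ?J (y + t *\<^sub>R z) \<partial>lborel) \<in> borel_measurable borel"
      by (rule lborel.borel_measurable_nn_integral) measurable
    show "(\<lambda>y. \<integral>\<^sup>+t. indicator ?J (y + t *\<^sub>R z) \<partial>lborel) \<in> borel_measurable borel" by (rule m)
    show "(\<lambda>y. (\<integral>\<^sup>+t. indicator ?J (y + t *\<^sub>R z) \<partial>lborel) * indicator {y. y \<bullet> u = 0} y) \<in> borel_measurable borel"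
      using m by measurable
  qed (simp add: E(4))
  also have "\<dots> \<le> (\<integral>\<^sup>+y. ennreal \<epsilon> * indicator (shadow r) y \<partial>span_leb E)"
  proof (rule nn_integral_mono)
    fix y
    let ?Jy = "{t. M (y + t *\<^sub>R z) \<le> r \<and> r < M (y + (t + \<epsilon>) *\<^sub>R z)}"
    show "(\<integral>\<^sup>+t. indicator ?J (y + t *\<^sub>R z) \<partial>lborel) * indicator {y. y \<bullet> u = 0} y \<le> ennreal \<epsilon> * indicator (shadow r) y"
    proof (cases "y \<bullet> u = 0")
      case yu: True
      have Jm: "?Jy \<in> sets borel" by measurable
      have "(\<integral>\<^sup>+t. indicator ?J (y + t *\<^sub>R z) \<partial>lborel) = (\<integral>\<^sup>+t. indicator ?Jy t \<partial>lborel)"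
        by (intro nn_integral_cong) (simp add: indicator_def scaleR_add_left add.assoc)
      also have "\<dots> = emeasure lborel ?Jy" using Jm by simp
      also have "\<dots> \<le> ennreal \<epsilon> * indicator (shadow r) y"
      proof (cases "?Jy = {}")
        case True
        show ?thesis unfolding True by simp
      next
        case False
        then obtain t where t: "M (y + t *\<^sub>R z) \<le> r" by blast
        have "proj (y + t *\<^sub>R z) = y" using yu zu by (simp add: proj_def inner_add_left)
        then have "y \<in> shadow r" using t unfolding shadow_def by (metis (mono_tags) image_eqI mem_Collect_eq)
        moreover have "emeasure lborel ?Jy \<le> ennreal \<epsilon>"
        proof (rule emeasure_exit_set[OF _ \<epsilon> refl])
          fix s t x assume x: "s \<le> x" "x \<le> t" and st: "M (y + s *\<^sub>R z) \<le> r" "M (y + t *\<^sub>R z) \<le> r"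
          show "M (y + x *\<^sub>R z) \<le> r"
          proof (cases "s = t")
            case True then show ?thesis using x st by simp
          next
            case False
            define a where "a = (t - x) / (t - s)"
            have a: "0 \<le> a" "0 \<le> 1 - a" using x False by (auto simp: a_def field_simps)
            have "a * (t - s) = t - x" using False by (simp add: a_def)
            then have "a * s + (1 - a) * t = x" by (simp add: algebra_simps)
            then have "a *\<^sub>R (y + s *\<^sub>R z) + (1 - a) *\<^sub>R (y + t *\<^sub>R z) = y + x *\<^sub>R z"
              using scaleR_add_left[of "a * s" "(1 - a) * t" z] by (simp add: algebra_simps)
            then have "M (y + x *\<^sub>R z) \<le> M (a *\<^sub>R (y + s *\<^sub>R z)) + M ((1 - a) *\<^sub>R (y + t *\<^sub>R z))"
              using tnorm_triangle[of "dual_tree T" "a *\<^sub>R (y + s *\<^sub>R z)" "(1 - a) *\<^sub>R (y + t *\<^sub>R z)"] by simp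
            also have "\<dots> = a * M (y + s *\<^sub>R z) + (1 - a) * M (y + t *\<^sub>R z)"
              unfolding tnorm_scale using a by simp
            also have "\<dots> \<le> a * r + (1 - a) * r" using a st by (intro add_mono mult_left_mono) auto
            finally show ?thesis by (simp add: algebra_simps)
          qed
        qed
        ultimately show ?thesis by simp
      qed
      finally show ?thesis using yu by simp
    qed simp
  qed
  also have "\<dots> = ennreal \<epsilon> * emeasure (span_leb E) (shadow r)" by (rule nn_integral_cmult_indicator) simp
  also have "ennreal (1 / norm u) * (ennreal \<epsilon> * emeasure (span_leb E) (shadow r)) = ennreal (\<epsilon> / norm u * r ^ card E) * emeasure (span_leb E) (shadow 1)"
    unfolding span_leb_shadow_scale[OF r] using \<epsilon> r
    by (simp add: mult.assoc[symmetric] flip: ennreal_mult)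
  finally show ?thesis by (simp add: mult_left_mono)
qed

text \<open>A difference quotient replaces the derivative. By the subgradient inequality, a step
  \<open>\<epsilon> *\<^sub>R z\<close> takes \<open>p\<close> out of the ball of every radius from
  \<open>M p\<close> up to \<open>M p + \<epsilon> * gslope T z p\<close>, so the weighted slope is
  bounded by exit volumes integrated against \<open>exp (- r)\<close>. The loss over this range of
  radii is at most \<open>exp (- (\<epsilon> * C))\<close>. The powers \<open>r ^ card E\<close>
  from \<open>exit_volume\<close> produce the factorial.\<close>

lemma slope_volume_eps:
  assumes \<epsilon>: "\<epsilon> > 0" and C: "\<And>p. \<bar>gslope T z p\<bar> \<le> C"
  shows "ennreal (exp (- (\<epsilon> * C))) * (\<integral>\<^sup>+p. ennreal (gslope T z p) * ennreal (exp (- M p)) \<partial>lborel)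
    \<le> ennreal (fact (card E) / norm u) * emeasure (span_leb E) (shadow 1)"
proof -
  let ?g = "gslope T z"
  let ?S = "{q :: 'a \<times> real. M (fst q) \<le> snd q \<and> snd q < M (fst q + \<epsilon> *\<^sub>R z)}"
  have "{q \<in> space (borel \<Otimes>\<^sub>M borel). M (fst q) \<le> snd q \<and> snd q < M (fst q + \<epsilon> *\<^sub>R z)} \<in> sets (borel \<Otimes>\<^sub>M (borel :: real measure))"
    by measurable
  then have Sb: "?S \<in> sets (borel \<Otimes>\<^sub>M borel)" by (simp add: space_pair_measure)
  then have [measurable]: "indicator ?S \<in> borel_measurable (borel \<Otimes>\<^sub>M (borel :: real measure))" by simp
  have pt: "ennreal \<epsilon> * (ennreal (exp (- (\<epsilon> * C))) * (ennreal (?g p) * ennreal (exp (- M p))))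
     \<le> (\<integral>\<^sup>+r. ennreal (exp (- r)) * indicator ?S (p, r) \<partial>lborel)" for p
  proof (cases "?g p > 0")
    case False
    then show ?thesis by (simp add: ennreal_neg)
  next
    case True
    let ?I = "{M p..<M p + \<epsilon> * ?g p}"
    have "ennreal \<epsilon> * (ennreal (exp (- (\<epsilon> * C))) * (ennreal (?g p) * ennreal (exp (- M p))))
      = ennreal (exp (- (M p + \<epsilon> * C))) * ennreal (\<epsilon> * ?g p)"
    proof -
      have "exp (- (M p + \<epsilon> * C)) = exp (- (\<epsilon> * C)) * exp (- M p)" by (simp flip: exp_add)
      then show ?thesis using True \<epsilon> by (simp only: ennreal_mult exp_ge_zero less_imp_le mult_ac)
    qed
    also have "\<dots> = (\<integral>\<^sup>+r. ennreal (exp (- (M p + \<epsilon> * C))) * indicator ?I r \<partial>lborel)"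
      using True \<epsilon> by (subst nn_integral_cmult_indicator) auto
    also have "\<dots> \<le> (\<integral>\<^sup>+r. ennreal (exp (- r)) * indicator ?S (p, r) \<partial>lborel)"
    proof (rule nn_integral_mono)
      fix r
      show "ennreal (exp (- (M p + \<epsilon> * C))) * indicator ?I r \<le> ennreal (exp (- r)) * indicator ?S (p, r)"
      proof (cases "r \<in> ?I")
        case True
        then have r: "M p \<le> r" "r < M p + \<epsilon> * ?g p" by auto
        have "\<epsilon> * ?g p \<le> \<epsilon> * C" using C[of p] \<epsilon> by (intro mult_left_mono) auto
        then have "exp (- (M p + \<epsilon> * C)) \<le> exp (- r)" using r by simp
        moreover have "(p, r) \<in> ?S" using r gslope_subgradient[of \<epsilon> T p z] \<epsilon> by simp
        ultimately show ?thesis by (simp add: indicator_def)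
      qed simp
    qed
    finally show ?thesis .
  qed
  have "ennreal \<epsilon> * (ennreal (exp (- (\<epsilon> * C))) * (\<integral>\<^sup>+p. ennreal (?g p) * ennreal (exp (- M p)) \<partial>lborel))
    = (\<integral>\<^sup>+p. ennreal \<epsilon> * (ennreal (exp (- (\<epsilon> * C))) * (ennreal (?g p) * ennreal (exp (- M p)))) \<partial>lborel)"
    by (simp add: nn_integral_cmult)
  also have "\<dots> \<le> (\<integral>\<^sup>+p. \<integral>\<^sup>+r. ennreal (exp (- r)) * indicator ?S (p, r) \<partial>lborel \<partial>lborel)"
    by (intro nn_integral_mono pt)
  also have "\<dots> = (\<integral>\<^sup>+r. \<integral>\<^sup>+p. ennreal (exp (- r)) * indicator ?S (p, r) \<partial>lborel \<partial>lborel)"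
    by (intro nn_integral_Tonelli sigma_finite_lborel) measurable
  also have "\<dots> \<le> (\<integral>\<^sup>+r. ennreal (\<epsilon> / norm u) * emeasure (span_leb E) (shadow 1) * (ennreal (r ^ card E * exp (- r)) * indicator {0..} r) \<partial>lborel)"
  proof (rule nn_integral_mono_AE, rule eventually_mono[OF AE_lborel_singleton[of "0::real"]])
    fix r :: real assume r0: "r \<noteq> 0"
    let ?J = "{p. M p \<le> r \<and> r < M (p + \<epsilon> *\<^sub>R z)}"
    have Jb: "?J \<in> sets borel" by measurable
    have i: "(\<integral>\<^sup>+p. ennreal (exp (- r)) * indicator ?S (p, r) \<partial>lborel) = ennreal (exp (- r)) * emeasure lborel ?J"
    proof -
      have "(\<integral>\<^sup>+p. ennreal (exp (- r)) * indicator ?S (p, r) \<partial>lborel) = (\<integral>\<^sup>+p. ennreal (exp (- r)) * indicator ?J p \<partial>lborel)"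
        by (simp add: indicator_def)
      then show ?thesis using Jb by (simp add: nn_integral_cmult_indicator)
    qed
    show "(\<integral>\<^sup>+p. ennreal (exp (- r)) * indicator ?S (p, r) \<partial>lborel) \<le> ennreal (\<epsilon> / norm u) * emeasure (span_leb E) (shadow 1) * (ennreal (r ^ card E * exp (- r)) * indicator {0..} r)"
    proof (cases "r > 0")
      case True
      have "ennreal (exp (- r)) * emeasure lborel ?J \<le> ennreal (exp (- r)) * (ennreal (\<epsilon> / norm u * r ^ card E) * emeasure (span_leb E) (shadow 1))"
        by (intro mult_left_mono exit_volume True \<epsilon>) simp
      also have "\<dots> = ennreal (\<epsilon> / norm u) * emeasure (span_leb E) (shadow 1) * (ennreal (r ^ card E * exp (- r)) * indicator {0..} r)"
      proof -
        have e1: "ennreal (\<epsilon> / norm u * r ^ card E) = ennreal (\<epsilon> / norm u) * ennreal (r ^ card E)"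
          by (rule ennreal_mult) (use True \<epsilon> in auto)
        have e2: "ennreal (r ^ card E * exp (- r)) = ennreal (r ^ card E) * ennreal (exp (- r))"
          by (rule ennreal_mult) (use True in auto)
        have "indicator {0..} r = (1 :: ennreal)" using True by simp
        then show ?thesis unfolding e1 e2 by (simp only: mult_ac mult_1_left)
      qed
      finally show ?thesis unfolding i .
    next
      case False
      then have "\<not> M p \<le> r" for p using tnorm_nonneg[of "dual_tree T" p] r0 by linarith
      then have J0: "?J = {}" by simp
      show ?thesis unfolding i J0 by simp
    qed
  qed
  also have "\<dots> = ennreal (\<epsilon> / norm u) * emeasure (span_leb E) (shadow 1) * ennreal (fact (card E))"
    by (subst nn_integral_cmult) (simp_all add: nn_intergal_power_times_exp_Ici)
  also have "\<dots> = ennreal \<epsilon> * (ennreal (fact (card E) / norm u) * emeasure (span_leb E) (shadow 1))"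
  proof -
    have "ennreal (\<epsilon> / norm u) * ennreal (fact (card E)) = ennreal \<epsilon> * ennreal (fact (card E) / norm u)"
      using \<epsilon> by (simp flip: ennreal_mult)
    then have "(ennreal (\<epsilon> / norm u) * ennreal (fact (card E))) * emeasure (span_leb E) (shadow 1)
      = (ennreal \<epsilon> * ennreal (fact (card E) / norm u)) * emeasure (span_leb E) (shadow 1)"
      by (simp only:)
    then show ?thesis by (simp only: mult.assoc mult.commute[of "ennreal (fact (card E))"])
  qed
  finally show ?thesis using \<epsilon> by (subst (asm) ennreal_mult_le_mult_iff) auto
qed

lemma slope_volume:
  assumes V: "emeasure (span_leb E) (shadow 1) < \<infinity>"
  shows "(\<integral>\<^sup>+p. ennreal (gslope T z p) * ennreal (exp (- M p)) \<partial>lborel)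
    \<le> ennreal (fact (card E) / norm u) * emeasure (span_leb E) (shadow 1)"
proof -
  let ?D = "\<integral>\<^sup>+p. ennreal (gslope T z p) * ennreal (exp (- M p)) \<partial>lborel"
  let ?K = "ennreal (fact (card E) / norm u) * emeasure (span_leb E) (shadow 1)"
  obtain C where C: "\<And>p. \<bar>gslope T z p\<bar> \<le> C" using gslope_bounded by blast
  have K: "?K < \<infinity>" using V by (simp add: ennreal_mult_less_top)
  obtain k where k: "?K = ennreal k" "k \<ge> 0" using K by (cases ?K) auto
  have b: "ennreal (exp (- (\<epsilon> * C))) * ?D \<le> ennreal k" if "\<epsilon> > 0" for \<epsilon>
    using slope_volume_eps[OF that C] unfolding k(1) .
  have "?D < \<infinity>"
  proof (rule ccontr)
    assume "\<not> ?D < \<infinity>"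
    then have "?D = \<infinity>" by (simp add: not_less top_unique)
    then show False using b[of 1] by (simp add: ennreal_mult_top top_unique)
  qed
  then obtain d where d: "?D = ennreal d" "d \<ge> 0" by (cases ?D) auto
  have bd: "exp (- (\<epsilon> * C)) * d \<le> k" if "\<epsilon> > 0" for \<epsilon>
    using b[OF that] d k by (simp flip: ennreal_mult)
  have "((\<lambda>\<epsilon>. exp (- (\<epsilon> * C)) * d) \<longlongrightarrow> exp (- (0 * C)) * d) (at_right 0)"
    by (intro tendsto_intros)
  then have lim: "((\<lambda>\<epsilon>. exp (- (\<epsilon> * C)) * d) \<longlongrightarrow> d) (at_right 0)" by simp
  have "d \<le> k"
    by (rule tendsto_upperbound[OF lim]) (use bd in \<open>auto simp: eventually_at_filter\<close>)
  then show ?thesis unfolding d(1) k(1) by (rule ennreal_leI)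
qed

text \<open>Thickening by a unit segment along \<open>\<nu>\<close> turns the volume in the
  hyperplane into a volume inside a ball of the whole space.\<close>

lemma span_leb_cball_finite: "emeasure (span_leb E) (cball 0 R) < \<infinity>"
proof -
  have "emeasure (span_leb E) (cball 0 R) = (\<integral>\<^sup>+t. indicator {0..1::real} t * emeasure (span_leb E) (cball 0 R) \<partial>lborel)"
    by (simp add: nn_integral_multc)
  also have "\<dots> \<le> (\<integral>\<^sup>+t. \<integral>\<^sup>+y. indicator (cball 0 (R + 1)) (t *\<^sub>R \<nu> + y) \<partial>span_leb E \<partial>lborel)"
  proof (rule nn_integral_mono)
    fix t :: real
    have "indicator {0..1} t * (\<integral>\<^sup>+y. indicator (cball 0 R) y \<partial>span_leb E) = (\<integral>\<^sup>+y. indicator {0..1} t * indicator (cball 0 R) y \<partial>span_leb E)"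
      by (rule nn_integral_cmult[symmetric], rule borel_measurable_indicator) simp
    also have "\<dots> \<le> (\<integral>\<^sup>+y. indicator (cball 0 (R + 1)) (t *\<^sub>R \<nu> + y) \<partial>span_leb E)"
    proof (rule nn_integral_mono)
      fix y
      have "norm (t *\<^sub>R \<nu> + y) \<le> R + 1" if "0 \<le> t" "t \<le> 1" "norm y \<le> R"
        using norm_triangle_ineq[of "t *\<^sub>R \<nu>" y] frame_norm[of \<nu>] that by simp
      then show "indicator {0..1} t * indicator (cball 0 R) y \<le> (indicator (cball 0 (R + 1)) (t *\<^sub>R \<nu> + y) :: ennreal)"
        by (auto simp: indicator_def)
    qed
    finally show "indicator {0..1} t * emeasure (span_leb E) (cball 0 R) \<le> (\<integral>\<^sup>+y. indicator (cball 0 (R + 1)) (t *\<^sub>R \<nu> + y) \<partial>span_leb E)"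
      by simp
  qed
  also have "\<dots> = emeasure lborel (cball (0::'a) (R + 1))"
    using lborel_split[OF borel_measurable_indicator[of "cball 0 (R + 1)" borel]] by simp
  also have "\<dots> < \<infinity>" by (rule emeasure_lborel_cball_finite)
  finally show ?thesis .
qed

lemma span_leb_bounded_finite:
  assumes "bounded A" shows "emeasure (span_leb E) A < \<infinity>"
proof -
  obtain R where "\<forall>x\<in>A. norm x \<le> R" using assms by (auto simp: bounded_iff)
  then have "A \<subseteq> cball 0 R" by auto
  then have "emeasure (span_leb E) A \<le> emeasure (span_leb E) (cball 0 R)" by (intro emeasure_mono) auto
  then show ?thesis using span_leb_cball_finite[of R] by (rule le_less_trans)
qed

lemma slice_borel [measurable]: "slice \<in> sets borel"
  unfolding slice_def by measurable

lemma emeasure_span_leb_hyperplane: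
  assumes [measurable]: "A \<in> sets borel"
  shows "emeasure (span_leb E) (A \<inter> {x. x \<bullet> u = 0}) = emeasure (span_leb E) A"
proof -
  have h: "{x. x \<bullet> u = 0} \<in> sets borel" by measurable
  have "(\<integral>\<^sup>+x. indicator (A \<inter> {x. x \<bullet> u = 0}) x \<partial>span_leb E) = (\<integral>\<^sup>+x. indicator A x \<partial>span_leb E)"
    by (rule nn_integral_span_leb_cong) (use h in \<open>auto simp: E(4) indicator_def\<close>)
  then show ?thesis using h by (simp add: sets.Int)
qed

lemma bounded_slice: "bounded (slice \<inter> {x. x \<bullet> u = 0})"
proof -
  obtain C where C: "\<And>x. norm x \<le> C * tnorm T x" using norm_le_tnorm[OF orth full] by blast
  have "norm y \<le> \<bar>C\<bar>" if y: "y \<bullet> u = 0" "tnorm T (y - (y \<bullet> z) *\<^sub>R u) \<le> 1" for y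
  proof -
    let ?w = "y - (y \<bullet> z) *\<^sub>R u"
    have "norm y * norm y = y \<bullet> ?w" using y(1) by (simp add: inner_diff_right dot_square_norm power2_eq_square)
    also have "\<dots> \<le> norm y * norm ?w" by (rule norm_cauchy_schwarz)
    finally have "norm y \<le> norm ?w" by (cases "y = 0") (auto simp: mult_le_cancel_left)
    also have "\<dots> \<le> C * tnorm T ?w" by (rule C)
    also have "\<dots> \<le> \<bar>C\<bar> * 1" using y(2) by (intro mult_mono) (auto simp: tnorm_nonneg)
    finally show ?thesis by simp
  qed
  then show ?thesis unfolding bounded_iff slice_def by blast
qed

text \<open>With \<open>n = hdim T\<close> and \<open>j\<close>, \<open>g\<close>, \<open>e\<close>
  the primal volume, the dual volume and the mean positive part of the slope, three estimates are
  multiplied: \<open>j \<le> 4 * k * norm u * v1 * e\<close> from the slab,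
  \<open>n! * g * e \<le> k' * (n - 1)! / norm u * v2\<close> from the exit sets, and
  \<open>j * n! * g = 4 ^ n\<close>. Both \<open>norm u\<close> and \<open>k * k' = 1\<close>
  cancel, leaving \<open>4 ^ n \<le> 4 * (n - 1)! * v1 * v2\<close>.\<close>

lemma main_bound:
  "4 ^ card E / fact (card E) \<le> measure (span_leb E) slice * measure (span_leb E) (shadow 1)"
proof -
  let ?t = "map_htree (\<lambda>v. v \<bullet> z) T"
  let ?n = "hdim T"
  have V1: "emeasure (span_leb E) slice < \<infinity>"
    using span_leb_bounded_finite[OF bounded_slice] emeasure_span_leb_hyperplane[OF slice_borel] by simp
  have V2: "emeasure (span_leb E) (shadow 1) < \<infinity>"
    by (rule span_leb_bounded_finite[OF compact_imp_bounded[OF compact_shadow]])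
  define v1 v2 where "v1 = measure (span_leb E) slice" and "v2 = measure (span_leb E) (shadow 1)"
  have v: "emeasure (span_leb E) slice = ennreal v1" "emeasure (span_leb E) (shadow 1) = ennreal v2" "v1 \<ge> 0" "v2 \<ge> 0"
    using V1 V2 by (auto simp: v1_def v2_def emeasure_eq_ennreal_measure less_top)
  define k k' where "k = tree_scale T" and "k' = tree_scale (dual_tree T)"
  have k: "k > 0" "k' > 0" "k * k' = 1"
    unfolding k_def k'_def using tree_scale_pos orth orth_dual_tree tree_scale_dual by auto
  let ?J = "emeasure (pos_law ?t) {x. \<bar>fst x\<bar> \<le> 1}"
  let ?Ew = "\<integral>\<^sup>+w. ennreal \<bar>w\<bar> \<partial>slope_law ?t"
  let ?Ep = "\<integral>\<^sup>+w. ennreal w \<partial>slope_law ?t"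
  \<comment> \<open>Exit volumes control only the positive part of the slope; the symmetry of its
    law supplies the other half.\<close>
  have Ew: "?Ew = 2 * ?Ep"
  proof -
    have "?Ew = (\<integral>\<^sup>+w. ennreal w + ennreal (- w) \<partial>slope_law ?t)"
      by (intro nn_integral_cong) (auto simp: abs_if ennreal_neg)
    also have "\<dots> = ?Ep + (\<integral>\<^sup>+w. ennreal (- w) \<partial>slope_law ?t)" by (rule nn_integral_add) measurable
    also have "(\<integral>\<^sup>+w. ennreal (- w) \<partial>slope_law ?t) = ?Ep" by (rule slope_law_neg) measurable
    finally show ?thesis by (simp add: mult_2)
  qed
  have G: "ennreal (fact ?n) * dual_vol ?t * ?Ep \<le> ennreal (k' * (fact (card E) / norm u) * v2)"
  proof -
    have "ennreal (fact ?n) * dual_vol ?t * ?Ep = (\<integral>\<^sup>+x. ennreal (snd x) * ennreal (exp (- \<bar>fst x\<bar>)) \<partial>grad_law ?t)"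
      by (subst grad_law_exp) (simp_all add: slope_law_integral[symmetric] mult.assoc)
    also have "\<dots> = (\<integral>\<^sup>+p. ennreal (gslope T z p) * ennreal (exp (- M p)) \<partial>span_leb (set_htree (dual_tree T)))"
      using grad_law_tree[OF orth, of "\<lambda>x. ennreal (snd x) * ennreal (exp (- \<bar>fst x\<bar>))" z] by (simp add: tnorm_abs)
    also have "\<dots> = ennreal k' * (\<integral>\<^sup>+p. ennreal (gslope T z p) * ennreal (exp (- M p)) \<partial>lborel)"
      unfolding k'_def by (rule span_leb_tree[OF orth_dual_tree[OF orth] dual_full]) measurable
    also have "\<dots> \<le> ennreal k' * (ennreal (fact (card E) / norm u) * ennreal v2)"
      using slope_volume[OF V2] unfolding v(2) by (rule mult_left_mono) simp
    also have "\<dots> = ennreal (k' * (fact (card E) / norm u) * v2)"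
      using k v by (simp add: mult.assoc flip: ennreal_mult)
    finally show ?thesis .
  qed
  have "?Ep < \<infinity>"
  proof (rule ccontr)
    assume "\<not> ?Ep < \<infinity>"
    then have "?Ep = \<infinity>" by (simp add: not_less top_unique)
    then show False using G dual_vol_nonzero[of ?t] by (simp add: ennreal_mult_top top_unique)
  qed
  then obtain e where e: "?Ep = ennreal e" "e \<ge> 0" by (cases ?Ep) auto
  obtain g where g: "dual_vol ?t = ennreal g" "g \<ge> 0" using dual_vol_finite[of ?t] by (cases "dual_vol ?t") auto
  have "?J < \<infinity>" using strip_finite_pos_law[of ?t] by (simp add: strip_finite_def)
  then obtain j where j: "?J = ennreal j" "j \<ge> 0" by (cases ?J) auto
  have G': "fact ?n * g * e \<le> k' * (fact (card E) / norm u) * v2"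
    using G k v g e by (simp flip: ennreal_mult)
  have J: "j * (fact ?n * g) = 4 ^ ?n"
  proof -
    have "ennreal j * (ennreal (fact ?n) * ennreal g) = ennreal (4 ^ ?n)"
      using volume_product[of ?t] unfolding grad_law_exp1 j(1) g(1) by simp
    then have "ennreal (j * (fact ?n * g)) = ennreal (4 ^ ?n)"
      using j g by (simp flip: ennreal_mult)
    then show ?thesis using j g by (subst (asm) ennreal_inj) auto
  qed
  let ?b = "\<lambda>\<epsilon>. k * (norm u * 2 * (1 + \<epsilon> * tnorm T u) ^ card E * v1) * (\<epsilon> + 2 * e)"
  have S: "j \<le> ?b \<epsilon>" if \<epsilon>: "\<epsilon> > 0" for \<epsilon>
  proof -
    let ?R = "1 + \<epsilon> * tnorm T u"
    have R: "?R > 0" using \<epsilon> tnorm_nonneg[of T u] by (simp add: add_pos_nonneg)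
    have "(\<integral>\<^sup>+x. win (snd x) \<epsilon> * win (fst x) 1 \<partial>pos_law ?t) = (\<integral>\<^sup>+x. win (x \<bullet> z) \<epsilon> * win (tnorm T x) 1 \<partial>span_leb (set_htree T))"
      using pos_law_tree[OF orth, of "\<lambda>x. win (snd x) \<epsilon> * win (fst x) 1" z] by simp
    also have "\<dots> = ennreal k * (\<integral>\<^sup>+x. win (x \<bullet> z) \<epsilon> * win (tnorm T x) 1 \<partial>lborel)"
      unfolding k_def by (rule span_leb_tree[OF orth full]) measurable
    also have "\<dots> \<le> ennreal k * (ennreal (norm u * (2 * \<epsilon>) * ?R ^ card E) * ennreal v1)"
      using slab_volume[OF \<epsilon>] unfolding v(1) by (rule mult_left_mono) simp
    finally have "(\<integral>\<^sup>+x. win (snd x) \<epsilon> * win (fst x) 1 \<partial>pos_law ?t) \<le> ennreal (k * (norm u * (2 * \<epsilon>) * ?R ^ card E * v1))"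
      using k v \<epsilon> R by (simp add: mult.assoc flip: ennreal_mult)
    then have "(\<integral>\<^sup>+x. win (snd x) \<epsilon> * win (fst x) 1 \<partial>pos_law ?t) * (ennreal \<epsilon> + ?Ew) \<le> ennreal (k * (norm u * (2 * \<epsilon>) * ?R ^ card E * v1)) * (ennreal \<epsilon> + ?Ew)"
      by (rule mult_right_mono) simp
    with slab_inequality[OF \<epsilon>, of ?t]
    have "ennreal \<epsilon> * ennreal j \<le> ennreal (k * (norm u * (2 * \<epsilon>) * ?R ^ card E * v1)) * (ennreal \<epsilon> + ?Ew)"
      unfolding j(1) by (rule order_trans)
    also have "ennreal \<epsilon> + ?Ew = ennreal (\<epsilon> + 2 * e)"
      unfolding Ew e(1) using \<epsilon> e by (simp add: ennreal_mult)
    finally have le: "ennreal \<epsilon> * ennreal j \<le> ennreal (k * (norm u * (2 * \<epsilon>) * ?R ^ card E * v1)) * ennreal (\<epsilon> + 2 * e)" .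
    have nn: "0 \<le> k * (norm u * (2 * \<epsilon>) * ?R ^ card E * v1)" "0 \<le> \<epsilon> + 2 * e" "0 \<le> \<epsilon>"
      using \<epsilon> k v e R by auto
    have "\<epsilon> * j \<le> k * (norm u * (2 * \<epsilon>) * ?R ^ card E * v1) * (\<epsilon> + 2 * e)"
      using le unfolding ennreal_mult[OF nn(3) j(2), symmetric] ennreal_mult[OF nn(1,2), symmetric]
      by (subst (asm) ennreal_le_iff) (use nn in auto)
    also have "\<dots> = \<epsilon> * ?b \<epsilon>" by (simp add: mult_ac)
    finally show ?thesis using \<epsilon> by (simp only: mult_le_cancel_left_pos)
  qed
  \<comment> \<open>Letting \<open>\<epsilon>\<close> tend to 0 removes both errors at once, the
    enlargement of the section and the summand \<open>\<epsilon>\<close> of the slab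
    inequality.\<close>
  have "(?b \<longlongrightarrow> ?b 0) (at_right 0)" by (intro tendsto_intros)
  then have "j \<le> ?b 0"
    by (rule tendsto_lowerbound) (use S in \<open>auto simp: eventually_at_filter\<close>)
  then have j': "j \<le> 4 * k * norm u * v1 * e" by simp
  have "4 ^ ?n = j * (fact ?n * g)" using J by simp
  also have "\<dots> \<le> (4 * k * norm u * v1 * e) * (fact ?n * g)" using j' g by (intro mult_right_mono) auto
  also have "\<dots> = (4 * k * norm u * v1) * (fact ?n * g * e)" by (simp add: mult_ac)
  also have "\<dots> \<le> (4 * k * norm u * v1) * (k' * (fact (card E) / norm u) * v2)"
    using k v norm_u by (intro mult_left_mono G') auto
  also have "\<dots> = 4 * (k * k') * fact (card E) * (v1 * v2)" using norm_u by simp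
  also have "\<dots> = 4 * fact (card E) * (v1 * v2)" using k by simp
  finally have "4 * 4 ^ card E \<le> 4 * fact (card E) * (v1 * v2)"
    unfolding card_frame_hdim[symmetric] by simp
  then show ?thesis unfolding v1_def[symmetric] v2_def[symmetric] by (simp add: field_simps)
qed

end

section \<open>Hanner polytopes\<close>

lemma tnorm_zero: "tnorm T 0 = 0"
  using tnorm_scale[of T 0 0] by simp

lemma tnorm_orth_zero: "(\<And>v. v \<in> set_htree T \<Longrightarrow> w \<bullet> v = 0) \<Longrightarrow> tnorm T w = 0"
  using tnorm_add_orth[of T w 0] tnorm_zero[of T] by simp

lemma tnorm_leaf: "orth_tree T \<Longrightarrow> v \<in> set_htree T \<Longrightarrow> tnorm T v = 1"
proof (induction T)
  case (LInf a b)
  from LInf.prems(2) consider "v \<in> set_htree a" | "v \<in> set_htree b" by auto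
  then show ?case
  proof cases
    case 1
    then have "tnorm b v = 0" using LInf.prems(1) by (intro tnorm_orth_zero) auto
    then show ?thesis using LInf 1 by simp
  next
    case 2
    then have "tnorm a v = 0" using LInf.prems(1) by (intro tnorm_orth_zero) (auto simp: inner_commute[of v])
    then show ?thesis using LInf 2 by simp
  qed
next
  case (LOne a b)
  from LOne.prems(2) consider "v \<in> set_htree a" | "v \<in> set_htree b" by auto
  then show ?case
  proof cases
    case 1
    then have "tnorm b v = 0" using LOne.prems(1) by (intro tnorm_orth_zero) auto
    then show ?thesis using LOne 1 by simp
  next
    case 2
    then have "tnorm a v = 0" using LOne.prems(1) by (intro tnorm_orth_zero) (auto simp: inner_commute[of v])
    then show ?thesis using LOne 2 by simp
  qed
qed simp

lemma tnorm_definite: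
  assumes "orth_tree T" "x \<in> span (set_htree T)" "tnorm T x = 0" shows "x = 0"
proof -
  have "x \<bullet> x \<le> 0" using inner_le_tnorm[OF assms(1,2), of x] assms(3) by simp
  then show ?thesis by (metis inner_eq_zero_iff inner_ge_zero order_antisym)
qed

text \<open>The restriction to the span is essential, because \<open>tnorm\<close> vanishes on the
  orthogonal complement of the leaves.\<close>

definition tball :: "'a::euclidean_space htree \<Rightarrow> 'a set" where
  "tball T = {x \<in> span (set_htree T). tnorm T x \<le> 1}"

lemma leaves_in_tball: "orth_tree T \<Longrightarrow> set_htree T \<subseteq> tball T"
  by (auto simp: tball_def tnorm_leaf span_base)

lemma convex_tball: "convex (tball T)"
proof (rule convexI)
  fix x y and s t :: real assume xy: "x \<in> tball T" "y \<in> tball T" and st: "0 \<le> s" "0 \<le> t" "s + t = 1"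
  have "tnorm T (s *\<^sub>R x + t *\<^sub>R y) \<le> s * tnorm T x + t * tnorm T y"
    using tnorm_triangle[of T "s *\<^sub>R x" "t *\<^sub>R y"] st by (simp add: tnorm_scale)
  also have "\<dots> \<le> s * 1 + t * 1" using xy st by (intro add_mono mult_left_mono) (auto simp: tball_def)
  finally show "s *\<^sub>R x + t *\<^sub>R y \<in> tball T"
    using xy st by (auto simp: tball_def intro: span_add span_scale)
qed

lemma tnorm_orth_split:
  assumes vw: "\<And>v w. v \<in> set_htree a \<Longrightarrow> w \<in> set_htree b \<Longrightarrow> v \<bullet> w = 0"
    and x: "x \<in> span (set_htree a)" and y: "y \<in> span (set_htree b)"
  shows "tnorm a (x + y) = tnorm a x" "tnorm b (x + y) = tnorm b y"
proof -
  have wv: "\<And>v w. v \<in> set_htree b \<Longrightarrow> w \<in> set_htree a \<Longrightarrow> v \<bullet> w = 0"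
    by (subst inner_commute, rule vw)
  show "tnorm a (x + y) = tnorm a x" using vw by (intro tnorm_add_orth span_orth[OF y]) auto
  have "tnorm b (y + x) = tnorm b y" using wv by (intro tnorm_add_orth span_orth[OF x]) auto
  then show "tnorm b (x + y) = tnorm b y" by (simp add: add.commute)
qed

lemma tball_LInf:
  assumes "orth_tree (LInf a b)"
  shows "tball (LInf a b) = {x + y | x y. x \<in> tball a \<and> y \<in> tball b}"
proof -
  have vw: "\<And>v w. v \<in> set_htree a \<Longrightarrow> w \<in> set_htree b \<Longrightarrow> v \<bullet> w = 0" using assms by auto
  have "x + y \<in> tball (LInf a b) \<longleftrightarrow> x \<in> tball a \<and> y \<in> tball b"
    if "x \<in> span (set_htree a)" "y \<in> span (set_htree b)" for x y
    using that tnorm_orth_split[OF vw that] by (auto simp: tball_def span_Un)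
  moreover have "\<exists>x y. p = x + y \<and> x \<in> span (set_htree a) \<and> y \<in> span (set_htree b)" if "p \<in> tball (LInf a b)" for p
    using that by (auto simp: tball_def span_Un)
  ultimately show ?thesis by (fastforce simp: tball_def)
qed

lemma tball_LOne:
  assumes o: "orth_tree (LOne a b)"
  shows "tball (LOne a b) = convex hull (tball a \<union> tball b)"
proof
  have vw: "\<And>v w. v \<in> set_htree a \<Longrightarrow> w \<in> set_htree b \<Longrightarrow> v \<bullet> w = 0" using o by auto
  have oab: "orth_tree a" "orth_tree b" using o by auto
  show "convex hull (tball a \<union> tball b) \<subseteq> tball (LOne a b)"
  proof (rule hull_minimal, rule subsetI)
    fix p assume "p \<in> tball a \<union> tball b"
    then show "p \<in> tball (LOne a b)"
    proof
      assume "p \<in> tball a"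
      then show ?thesis using tnorm_orth_split[OF vw, where x=p and y=0]
        by (auto simp: tball_def span_zero tnorm_zero intro: subsetD[OF span_mono, rotated])
    next
      assume "p \<in> tball b"
      then show ?thesis using tnorm_orth_split[OF vw, where x=0 and y=p]
        by (auto simp: tball_def span_zero tnorm_zero intro: subsetD[OF span_mono, rotated])
    qed
  qed (rule convex_tball)
  show "tball (LOne a b) \<subseteq> convex hull (tball a \<union> tball b)"
  proof
    fix p assume p: "p \<in> tball (LOne a b)"
    then obtain x y where xy: "p = x + y" "x \<in> span (set_htree a)" "y \<in> span (set_htree b)"
      by (auto simp: tball_def span_Un)
    define s where "s = tnorm a x"
    have n: "s + tnorm b y \<le> 1" "s \<ge> 0" "tnorm b y \<ge> 0"
      using p tnorm_orth_split[OF vw xy(2,3)] by (auto simp: tball_def xy(1) s_def tnorm_nonneg)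
    show "p \<in> convex hull (tball a \<union> tball b)"
    proof (cases "s = 0")
      case True
      then have "x = 0" using tnorm_definite[OF oab(1) xy(2)] by (simp add: s_def)
      then have "p \<in> tball b" using xy n True by (simp add: tball_def)
      then show ?thesis by (intro hull_inc) auto
    next
      case False
      then have s: "s > 0" using n by simp
      show ?thesis
      proof (cases "s = 1")
        case True
        then have "tnorm b y = 0" using n by simp
        then have "y = 0" using tnorm_definite[OF oab(2) xy(3)] by simp
        then have "p \<in> tball a" using xy True by (simp add: tball_def s_def)
        then show ?thesis by (intro hull_inc) auto
      next
        case False
        then have s1: "1 - s > 0" using n by simp
        \<comment> \<open>The second weight is \<open>1 - s\<close> rather than
          \<open>tnorm b y\<close>, so that the weights add up to 1; as
          \<open>tnorm b y \<le> 1 - s\<close>, the quotient still lies in the ball. The excluded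
          values 0 and 1 of \<open>s\<close> force \<open>x\<close> or \<open>y\<close> to vanish by
          definiteness.\<close>
        have "(1 / s) *\<^sub>R x \<in> tball a" using s xy by (simp add: tball_def tnorm_scale span_scale s_def[symmetric])
        moreover have "(1 / (1 - s)) *\<^sub>R y \<in> tball b" using s1 n xy by (simp add: tball_def tnorm_scale span_scale)
        ultimately have "s *\<^sub>R ((1 / s) *\<^sub>R x) + (1 - s) *\<^sub>R ((1 / (1 - s)) *\<^sub>R y) \<in> convex hull (tball a \<union> tball b)"
          using s s1 by (intro convexD[OF convex_convex_hull] hull_inc) auto
        then show ?thesis using s s1 xy by simp
      qed
    qed
  qed
qed

text \<open>The leaves belong to the polytopes themselves and hence to the given subspaces
  \<open>U\<close> and \<open>W\<close>, so the orthogonality of these subspaces passes to the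
  leaves.\<close>

lemma hanner_polytope_tree:
  assumes "hanner_polytope B" shows "\<exists>T. orth_tree T \<and> B = tball T"
  using assms
proof (induction rule: hanner_polytope.induct)
  case (segment v)
  have "closed_segment (- v) v = tball (Seg v)"
  proof (rule set_eqI)
    fix x
    have "x \<in> tball (Seg v) \<longleftrightarrow> (\<exists>t. x = t *\<^sub>R v \<and> \<bar>t\<bar> \<le> 1)"
      using segment by (auto simp: tball_def span_singleton abs_mult)
    also have "\<dots> \<longleftrightarrow> (\<exists>s. 0 \<le> s \<and> s \<le> 1 \<and> x = (1 - s) *\<^sub>R (- v) + s *\<^sub>R v)"
    proof
      assume "\<exists>t. x = t *\<^sub>R v \<and> \<bar>t\<bar> \<le> 1"
      then obtain t where t: "x = t *\<^sub>R v" "\<bar>t\<bar> \<le> 1" by blast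
      have "(1 - (t + 1) / 2) *\<^sub>R (- v) + ((t + 1) / 2) *\<^sub>R v = ((t + 1) / 2 - (1 - (t + 1) / 2)) *\<^sub>R v"
        by (subst scaleR_diff_left[of "(t + 1) / 2"]) (simp only: scaleR_minus_right add.commute diff_conv_add_uminus)
      also have "(t + 1) / 2 - (1 - (t + 1) / 2) = t" by (simp add: field_simps)
      finally show "\<exists>s. 0 \<le> s \<and> s \<le> 1 \<and> x = (1 - s) *\<^sub>R (- v) + s *\<^sub>R v"
        using t by (intro exI[of _ "(t + 1) / 2"]) (auto simp: abs_le_iff)
    next
      assume "\<exists>s. 0 \<le> s \<and> s \<le> 1 \<and> x = (1 - s) *\<^sub>R (- v) + s *\<^sub>R v"
      then obtain s where s: "0 \<le> s" "s \<le> 1" "x = (1 - s) *\<^sub>R (- v) + s *\<^sub>R v" by blast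
      have "x = (s - (1 - s)) *\<^sub>R v" unfolding s(3) scaleR_diff_left[of s] by simp
      then show "\<exists>t. x = t *\<^sub>R v \<and> \<bar>t\<bar> \<le> 1" using s by (intro exI[of _ "s - (1 - s)"]) auto
    qed
    also have "\<dots> \<longleftrightarrow> x \<in> closed_segment (- v) v" by (auto simp: in_segment)
    finally show "x \<in> closed_segment (- v) v \<longleftrightarrow> x \<in> tball (Seg v)" by simp
  qed
  then show ?case using segment by (intro exI[of _ "Seg v"]) simp
next
  case (cartesian_product A B U W)
  then obtain a b where ab: "orth_tree a" "A = tball a" "orth_tree b" "B = tball b" by blast
  have "\<forall>v\<in>set_htree a. \<forall>w\<in>set_htree b. v \<bullet> w = 0"
    using leaves_in_tball[OF ab(1)] leaves_in_tball[OF ab(3)] cartesian_product ab unfolding orthogonal_def by blast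
  then have o: "orth_tree (LInf a b)" using ab by simp
  then show ?case using tball_LInf[OF o] ab by (intro exI[of _ "LInf a b"]) simp
next
  case (l1_sum A B U W)
  then obtain a b where ab: "orth_tree a" "A = tball a" "orth_tree b" "B = tball b" by blast
  have "\<forall>v\<in>set_htree a. \<forall>w\<in>set_htree b. v \<bullet> w = 0"
    using leaves_in_tball[OF ab(1)] leaves_in_tball[OF ab(3)] l1_sum ab unfolding orthogonal_def by blast
  then have o: "orth_tree (LOne a b)" using ab by simp
  then show ?case using tball_LOne[OF o] ab by (intro exI[of _ "LOne a b"]) simp
qed

section \<open>Hyperplanes, polars, projections and the conclusion\<close>

lemma linear_hyperplane_normal:
  assumes "linear_hyperplane H"
  obtains u where "u \<noteq> 0" "H = {x. x \<bullet> u = 0}"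
proof -
  have H: "subspace H" "dim H + 1 = DIM('a)" using assms by (auto simp: linear_hyperplane_def)
  then obtain u where u: "u \<noteq> 0" "span H \<subseteq> {x. u \<bullet> x = 0}"
    using lowdim_subset_hyperplane[of H] by auto
  have "H = {x. u \<bullet> x = 0}"
  proof (rule subspace_dim_equal[OF H(1) subspace_hyperplane])
    show "H \<subseteq> {x. u \<bullet> x = 0}" using u(2) span_superset by blast
    show "dim {x. u \<bullet> x = 0} \<le> dim H" using dim_hyperplane[OF u(1)] H(2) by simp
  qed
  then show ?thesis using that[of u] u(1) by (simp add: inner_commute)
qed

text \<open>Exposes the basis behind the choice operator. Since \<open>main_bound\<close> holds in
  every frame, nothing further has to be known about it.\<close>

lemma subspace_lborel_span_leb:
  assumes "subspace V"
  obtains E where "finite E" "pairwise orthogonal E" "\<And>e. e \<in> E \<Longrightarrow> norm e = 1" "span E = V" "subspace_lborel V = span_leb E"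
proof -
  define E where "E = (SOME E. orthonormal_basis_of V E)"
  have "orthonormal_basis_of V E"
    unfolding E_def by (rule someI_ex[OF orthonormal_basis_of_exists[OF assms]])
  then have E: "pairwise orthogonal E" "\<And>e. e \<in> E \<Longrightarrow> norm e = 1" "span E = V"
    by (auto simp: orthonormal_basis_of_def)
  have "independent E" using E(1) E(2)[of 0] by (intro pairwise_orthogonal_independent) auto
  then have "finite E" by (rule independent_imp_finite)
  moreover have "subspace_lborel V = span_leb E"
    by (simp add: subspace_lborel_def span_leb_def E_def Let_def)
  ultimately show ?thesis using that E by blast
qed

lemma polar_in_closed:
  assumes "subspace V" shows "closed (polar_in V K)"
proof -
  have "polar_in V K = V \<inter> (\<Inter>x\<in>K. {y. x \<bullet> y \<le> 1})" by (auto simp: polar_in_def)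
  moreover have "closed (\<Inter>x\<in>K. {y. x \<bullet> y \<le> 1})" by (intro closed_INT ballI closed_halfspace_le)
  ultimately show ?thesis using closed_subspace[OF assms] by (simp add: closed_Int)
qed

text \<open>A point \<open>y\<close> of the polar is tested against the vector of length
  \<open>\<delta>\<close> in its own direction.\<close>

lemma polar_in_bounded:
  assumes V: "subspace V" and \<delta>: "\<delta> > 0" and K: "cball 0 \<delta> \<inter> V \<subseteq> K"
  shows "bounded (polar_in V K)"
proof -
  have "norm y \<le> 1 / \<delta>" if y: "y \<in> polar_in V K" for y
  proof (cases "y = 0")
    case False
    let ?x = "(\<delta> / norm y) *\<^sub>R y"
    have "?x \<in> cball 0 \<delta> \<inter> V" using False \<delta> y V by (auto simp: polar_in_def subspace_scale)
    then have "?x \<in> K" using K by blast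
    then have "?x \<bullet> y \<le> 1" using y unfolding polar_in_def by blast
    moreover have "?x \<bullet> y = \<delta> * norm y" using False by (simp add: dot_square_norm power2_eq_square)
    ultimately show ?thesis using \<delta> by (simp add: field_simps)
  qed (use \<delta> in simp)
  then show ?thesis by (auto simp: bounded_iff)
qed

lemma tball_contains_cball:
  assumes "orth_tree T" "span (set_htree T) = UNIV"
  obtains \<delta> where "\<delta> > 0" "cball 0 \<delta> \<subseteq> tball T"
proof -
  obtain C where C: "\<And>x. tnorm T x \<le> C * norm x" using tnorm_le_norm by blast
  have le: "tnorm T x \<le> 1" if "norm x \<le> 1 / (\<bar>C\<bar> + 1)" for x
  proof -
    have "tnorm T x \<le> C * norm x" by (rule C)
    also have "\<dots> \<le> (\<bar>C\<bar> + 1) * norm x" by (intro mult_right_mono) auto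
    also have "\<dots> \<le> (\<bar>C\<bar> + 1) * (1 / (\<bar>C\<bar> + 1))" using that by (intro mult_left_mono) auto
    also have "\<dots> = 1" by (simp add: add_nonneg_eq_0_iff)
    finally show ?thesis .
  qed
  have "cball 0 (1 / (\<bar>C\<bar> + 1)) \<subseteq> tball T"
    using le assms(2) by (auto simp: tball_def mem_cball)
  moreover have "1 / (\<bar>C\<bar> + 1) > 0" by (simp add: add_nonneg_pos)
  ultimately show ?thesis using that by blast
qed

text \<open>As its image is proper, \<open>P\<close> has a nonzero kernel vector. This vector is not
  fixed by \<open>P\<close>, hence lies outside \<open>H\<close> and can be scaled to height 1 over
  \<open>H\<close>; subtracting the right multiple of it moves any \<open>x\<close> into
  \<open>H\<close>, where \<open>P\<close> is the identity.\<close>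

lemma projection_kernel_vector:
  fixes P :: "'a::euclidean_space \<Rightarrow> 'a"
  assumes P: "linear_projection_onto P H" and u: "u \<noteq> 0" and H: "H = {x. x \<bullet> u = 0}"
  obtains z where "z \<bullet> u = 1" "\<And>x. P x = x - (x \<bullet> u) *\<^sub>R z"
proof -
  have lin: "linear P" and PP: "\<And>x. P (P x) = P x" and r: "range P = H"
    using P by (auto simp: linear_projection_onto_def fun_eq_iff)
  have fix_H: "P x = x" if "x \<in> H" for x using that PP unfolding r[symmetric] by auto
  have "u \<notin> range P" using u by (simp add: r H)
  then have "\<not> inj P" using linear_injective_imp_surjective[OF lin] by blast
  then obtain w where w: "P w = 0" "w \<noteq> 0" using linear_injective_0[OF lin] by blast
  have wu: "w \<bullet> u \<noteq> 0" using fix_H[of w] w by (auto simp: H)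
  define z where "z = w /\<^sub>R (w \<bullet> u)"
  have z: "z \<bullet> u = 1" "P z = 0" using wu w by (auto simp: z_def linear_scale[OF lin])
  have "P x = x - (x \<bullet> u) *\<^sub>R z" for x
  proof -
    have "x - (x \<bullet> u) *\<^sub>R z \<in> H" using z by (simp add: H inner_diff_left)
    then have "P (x - (x \<bullet> u) *\<^sub>R z) = x - (x \<bullet> u) *\<^sub>R z" by (rule fix_H)
    then show ?thesis using z by (simp add: linear_diff[OF lin] linear_scale[OF lin])
  qed
  then show ?thesis using that z(1) by blast
qed

theorem theorem4p4:
  fixes B H K :: "(real ^ 'n) set"
  assumes "CARD('n) \<ge> 2"
    and "hanner_polytope B"
    and "interior B \<noteq> {}"
    and "linear_hyperplane H"
    and "K = B \<inter> H \<or> (\<exists>P. linear_projection_onto P H \<and> K = P ` B)"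
  shows "vol_in H K * vol_in H (polar_in H K) \<ge> 4 ^ (CARD('n) - 1) / fact (CARD('n) - 1)"
proof -
  obtain T where T: "orth_tree T" "B = tball T" using hanner_polytope_tree[OF assms(2)] by blast
  have spanT: "span (set_htree T) = UNIV"
  proof -
    have "\<not> dim B < DIM(real ^ 'n)" using empty_interior_lowdim assms(3) by blast
    moreover have "dim B \<le> dim (span (set_htree T))" by (rule dim_subset) (auto simp: T(2) tball_def)
    then have "dim B \<le> dim (set_htree T)" by simp
    ultimately have "dim (set_htree T) = DIM(real ^ 'n)" using dim_subset_UNIV[of "set_htree T"] by linarith
    then show ?thesis by (simp only: dim_eq_full)
  qed
  have B: "B = {x. tnorm T x \<le> 1}" using spanT by (auto simp: T(2) tball_def)
  obtain u where u: "u \<noteq> 0" "H = {x. x \<bullet> u = 0}" using linear_hyperplane_normal[OF assms(4)] .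
  have sub: "subspace H" using assms(4) by (simp add: linear_hyperplane_def)
  obtain E where E: "finite E" "pairwise orthogonal E" "\<And>e. e \<in> E \<Longrightarrow> norm e = 1" "span E = H" "subspace_lborel H = span_leb E"
    by (rule subspace_lborel_span_leb[OF sub]) blast
  have vol: "vol_in H A = measure (span_leb E) A" for A by (simp add: vol_in_def E(5))
  obtain \<delta> where \<delta>: "\<delta> > 0" "cball 0 \<delta> \<subseteq> B" using tball_contains_cball[OF T(1) spanT] unfolding T(2) .
  have Hm: "H \<in> sets borel" using closed_subspace[OF sub] by (rule borel_closed)
  have polar_b: "polar_in H K \<in> sets borel" using polar_in_closed[OF sub] by (rule borel_closed)
  show ?thesis using assms(5)
  proof
    assume K: "K = B \<inter> H"
    \<comment> \<open>With \<open>z\<close> parallel to \<open>u\<close> the frame is orthogonal: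
      \<open>y \<bullet> z\<close> vanishes on \<open>H\<close>, so \<open>slice\<close> cuts out of
      \<open>H\<close> exactly the section of \<open>B\<close>.\<close>
    define z where "z = u /\<^sub>R (u \<bullet> u)"
    have zu: "z \<bullet> u = 1" using u(1) by (simp add: z_def)
    interpret hyperplane_frame T u z E
      by standard (use T(1) spanT zu E u(2) in auto)
    have yz: "y \<bullet> z = 0" if "y \<in> H" for y using that by (simp add: z_def u(2))
    have "K = slice \<inter> {x. x \<bullet> u = 0}" using yz by (auto simp: K B slice_def u(2))
    then have V1: "measure (span_leb E) slice = measure (span_leb E) K"
      using emeasure_span_leb_hyperplane[OF slice_borel] by (simp add: measure_def)
    \<comment> \<open>The polar of the section has to be bounded from below in volume; for this it
      suffices that it contains the orthogonal projection of the dual ball.\<close>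
    have "shadow 1 \<subseteq> polar_in H K"
    proof
      fix y assume "y \<in> shadow 1"
      then obtain p where p: "M p \<le> 1" "y = p - (p \<bullet> u) *\<^sub>R z" by (auto simp: shadow_def proj_def)
      have "y \<in> H" using zu by (simp add: p(2) u(2) inner_diff_left)
      moreover have "x \<bullet> y \<le> 1" if x: "x \<in> K" for x
      proof -
        have xz: "x \<bullet> z = 0" using x yz K by auto
        have "x \<bullet> y = x \<bullet> p" by (simp add: p(2) inner_diff_right xz)
        also have "\<dots> \<le> tnorm T x * M p" by (rule inner_le_tnorm[OF T(1)]) (simp add: spanT)
        also have "\<dots> \<le> 1 * 1" using x K B p by (intro mult_mono) (auto simp: tnorm_nonneg)
        finally show ?thesis by simp
      qed
      ultimately show "y \<in> polar_in H K" by (simp add: polar_in_def)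
    qed
    \<comment> \<open>As \<open>measure\<close> assigns 0 to sets of infinite measure, the
      comparison of volumes requires the polar to be of finite measure.\<close>
    moreover have "emeasure (span_leb E) (polar_in H K) < \<infinity>"
      by (rule span_leb_bounded_finite[OF polar_in_bounded[OF sub \<delta>(1)]]) (use \<delta> K in auto)
    ultimately have V2: "measure (span_leb E) (shadow 1) \<le> measure (span_leb E) (polar_in H K)"
      using polar_b by (intro measure_mono_fmeasurable) (auto simp: fmeasurable_def)
    have c: "card E = CARD('n) - 1" using card_frame by simp
    have "4 ^ card E / fact (card E) \<le> measure (span_leb E) slice * measure (span_leb E) (shadow 1)" by (rule main_bound)
    also have "\<dots> \<le> measure (span_leb E) K * measure (span_leb E) (polar_in H K)"
      unfolding V1 by (intro mult_left_mono V2) simp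
    finally show ?thesis unfolding vol c .
  next
    assume "\<exists>P. linear_projection_onto P H \<and> K = P ` B"
    then obtain P where P: "linear_projection_onto P H" "K = P ` B" by blast
    obtain z where z: "z \<bullet> u = 1" "\<And>x. P x = x - (x \<bullet> u) *\<^sub>R z"
      by (rule projection_kernel_vector[OF P(1) u]) blast
    \<comment> \<open>The roles of the two balls are exchanged. In the frame of the dual tree
      \<open>M\<close> is \<open>tnorm T\<close>, so \<open>shadow 1\<close> is the projection
      \<open>K\<close> of \<open>B\<close>, and it is now \<open>slice\<close> that has to be found
      inside the polar.\<close>
    interpret hyperplane_frame "dual_tree T" u z E
      by standard (use orth_dual_tree[OF T(1)] span_dual_tree[OF T(1)] spanT z(1) E u(2) in auto)
    have K: "K = shadow 1" unfolding shadow_def P(2) B by (simp add: proj_def[abs_def] z(2))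
    have "slice \<inter> H \<subseteq> polar_in H K"
    proof
      fix y assume y: "y \<in> slice \<inter> H"
      have "x \<bullet> y \<le> 1" if "x \<in> K" for x
      proof -
        obtain b where b: "tnorm T b \<le> 1" "x = b - (b \<bullet> u) *\<^sub>R z" using \<open>x \<in> K\<close> by (auto simp: P(2) B z(2))
        have "x \<bullet> y = b \<bullet> (y - (y \<bullet> z) *\<^sub>R u)" by (simp add: b(2) inner_diff_left inner_diff_right inner_commute)
        also have "\<dots> \<le> tnorm T b * tnorm (dual_tree T) (y - (y \<bullet> z) *\<^sub>R u)"
          by (rule inner_le_tnorm[OF T(1)]) (simp add: spanT)
        also have "\<dots> \<le> 1 * 1" using b y by (intro mult_mono) (auto simp: tnorm_nonneg slice_def)
        finally show ?thesis by simp
      qed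
      then show "y \<in> polar_in H K" using y by (simp add: polar_in_def)
    qed
    moreover have "emeasure (span_leb E) (polar_in H K) < \<infinity>"
    proof (rule span_leb_bounded_finite[OF polar_in_bounded[OF sub \<delta>(1)]], rule subsetI)
      fix x assume x: "x \<in> cball 0 \<delta> \<inter> H"
      then have "P x = x" by (simp add: z(2) u(2))
      then show "x \<in> K" using x \<delta> unfolding P(2) by (metis IntD1 image_eqI subsetD)
    qed
    ultimately have "measure (span_leb E) (slice \<inter> H) \<le> measure (span_leb E) (polar_in H K)"
      using polar_b Hm by (intro measure_mono_fmeasurable) (auto simp: fmeasurable_def)
    then have V1: "measure (span_leb E) slice \<le> measure (span_leb E) (polar_in H K)"
      using emeasure_span_leb_hyperplane[OF slice_borel] by (simp add: measure_def u(2))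
    have c: "card E = CARD('n) - 1" using card_frame by simp
    have "4 ^ card E / fact (card E) \<le> measure (span_leb E) slice * measure (span_leb E) (shadow 1)" by (rule main_bound)
    also have "\<dots> \<le> measure (span_leb E) (polar_in H K) * measure (span_leb E) K"
      unfolding K[symmetric] by (intro mult_right_mono V1) simp
    finally show ?thesis unfolding vol c by (simp add: mult.commute)
  qed
qed

end
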